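(* Let $\psi\in L^2(\mathbb{R}^2)$ and suppose that for almost every $y\in\mathbb{R}$, $\operatorname{ess\text{-}supp}\,\psi(\hat{\cdot},y)\subset[-1/2,1/2]$. For $k,m\in\mathbb{Z}$ put $$\psi_{k,m}(x_1,x_2)=2^{-k/2}\psi\left(\frac{x_1-2^k m}{2^k},x_2\right).$$ The system $\{\psi_{k,m}\}_{k,m\in\mathbb{Z}}$, with the counting measure on $\mathbb{Z}\times\mathbb{Z}$ as parameter measure, is reproducing in $L^2(\mathbb{R}^2)$ (i.e. $\sum_{k,m}\langle f,\psi_{k,m}\rangle\langle\psi_{k,m},g\rangle=\langle f,g\rangle$ for all $f,g\in L^2(\mathbb{R}^2)$) if and only if for every pair $f,g\in L^2(\mathbb{R})$ the equality $$\langle f,g\rangle=\sum_{k\in\mathbb{Z}}\int_{\mathbb{R}}\overline{\psi\left(\widehat{2^k\xi},y\right)}\,f(y)\,dy\int_{\mathbb{R}}\psi\left(\widehat{2^k\xi},y\right)\overline{g(y)}\,dy$$ holds for almost every $\xi\in\mathbb{R}$.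
   Context: The Fourier transform is $\hat f(\xi)=\int f(x)e^{-2\pi i x\xi}\,dx$. For $\psi(x_1,x_2)$, $\psi(\hat{s},y)$ denotes the Fourier transform of $\psi$ in the first variable only, evaluated at frequency $s$, with second variable $y$; $\psi(\hat{\cdot},y)$ is this function of the frequency variable for fixed $y$. For a measurable function $h$ on a topological space with a Borel measure $\mu$, $\operatorname{ess\text{-}supp}\,h$ is the intersection of all closed sets $F$ such that $h=0$ $\mu$-a.e. on the complement of $F$. *)

theory Defs
  imports "HOL-Analysis.Analysis"
begin

definition L2 :: "'a measure \<Rightarrow> ('a \<Rightarrow> complex) \<Rightarrow> bool" where
  "L2 M f \<longleftrightarrow> f \<in> borel_measurable M \<and> integrable M (\<lambda>x. (cmod (f x))\<^sup>2)"

definition l2_inner :: "'a measure \<Rightarrow> ('a \<Rightarrow> complex) \<Rightarrow> ('a \<Rightarrow> complex) \<Rightarrow> complex" where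
  "l2_inner M f g = (\<integral>x. f x * cnj (g x) \<partial>M)"

definition ess_supp :: "'a::topological_space measure \<Rightarrow> ('a \<Rightarrow> 'b::zero) \<Rightarrow> 'a set" where
  "ess_supp M h = \<Inter>{F. closed F \<and> (AE x in M. x \<notin> F \<longrightarrow> h x = 0)}"

text \<open>Plancherel (L2) Fourier transform with kernel exp(-2 pi i x xi):
  F is (a representative of) the Fourier transform of the L2 function f iff
  the truncated transforms over [-R,R] converge to F in L2 as R tends to infinity.\<close>
definition fourier_L2 :: "(real \<Rightarrow> complex) \<Rightarrow> (real \<Rightarrow> complex) \<Rightarrow> bool" where
  "fourier_L2 f F \<longleftrightarrow> L2 lborel f \<and> L2 lborel F \<and>
     ((\<lambda>R::real. \<integral>\<^sup>+ \<xi>. ennreal ((cmod (F \<xi> -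
         set_lebesgue_integral lborel {-R..R} (\<lambda>x. f x * cis (- 2 * pi * x * \<xi>))))\<^sup>2) \<partial>lborel)
       \<longlongrightarrow> 0) at_top"

text \<open>Psi is (a jointly measurable representative of) the Fourier transform of psi in the
  first variable: Psi(s,y) = psi(hat s, y).\<close>
definition partial_fourier1 :: "(real \<times> real \<Rightarrow> complex) \<Rightarrow> (real \<times> real \<Rightarrow> complex) \<Rightarrow> bool" where
  "partial_fourier1 \<psi> \<Psi> \<longleftrightarrow> \<Psi> \<in> borel_measurable lborel \<and>
     (AE y in lborel. fourier_L2 (\<lambda>x. \<psi> (x, y)) (\<lambda>s. \<Psi> (s, y)))"

definition reproducing :: "'a measure \<Rightarrow> ('i \<Rightarrow> 'a \<Rightarrow> complex) \<Rightarrow> bool" where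
  "reproducing M \<Phi> \<longleftrightarrow> (\<forall>f g. L2 M f \<longrightarrow> L2 M g \<longrightarrow>
     integrable (count_space UNIV) (\<lambda>p. l2_inner M f (\<Phi> p) * l2_inner M (\<Phi> p) g) \<and>
     (\<integral>p. l2_inner M f (\<Phi> p) * l2_inner M (\<Phi> p) g \<partial>count_space UNIV) = l2_inner M f g)"

definition psi_km :: "(real \<times> real \<Rightarrow> complex) \<Rightarrow> int \<times> int \<Rightarrow> real \<times> real \<Rightarrow> complex" where
  "psi_km \<psi> = (\<lambda>(k, m) (x1, x2).
     complex_of_real (2 powr (- real_of_int k / 2)) *
       \<psi> ((x1 - 2 powr real_of_int k * real_of_int m) / 2 powr real_of_int k, x2))"

end

theory Submission
  imports Defs "HOL-Probability.Probability"
begin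

text \<open>
  On a tensor product \<open>a \<otimes> b\<close> the coefficient against \<open>\<psi>\<^sub>k\<^sub>,\<^sub>m\<close> is, up to the factor \<open>2\<^sup>-\<^sup>k\<^sup>/\<^sup>2\<close>, the
  \<open>m\<close>-th Fourier coefficient of \<open>\<eta> \<mapsto> A(2\<^sup>-\<^sup>k\<eta>) P\<^sub>b(\<eta>)\<close>, where \<open>A\<close> is the Fourier transform of \<open>a\<close> and
  \<open>P\<^sub>b(\<eta>)\<close> is the integral of \<open>b\<close> against the conjugate of \<open>\<Psi>(\<eta>, \<cdot>)\<close>; this function lives on
  \<open>[-1/2, 1/2]\<close>. Parseval in \<open>m\<close> therefore gives
  \<open>\<Sum>\<^sub>k\<^sub>,\<^sub>m |\<langle>a \<otimes> b, \<psi>\<^sub>k\<^sub>,\<^sub>m\<rangle>|\<^sup>2 = \<integral> |A(\<xi>)|\<^sup>2 \<Sum>\<^sub>k |P\<^sub>b(2\<^sup>k\<xi>)|\<^sup>2 d\<xi>\<close>.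
  If the system is reproducing, the left-hand side is \<open>\<parallel>a\<parallel>\<^sup>2\<parallel>b\<parallel>\<^sup>2\<close> for all \<open>a\<close> in a dense set, so the inner
  sum is \<open>\<parallel>b\<parallel>\<^sup>2\<close> almost everywhere, and polarization gives the pointwise identity. Conversely,
  integrating the pointwise identity against \<open>A(\<xi>)\<close> and the conjugate of \<open>A'(\<xi>)\<close> gives the
  reproducing identity on tensor products, whose span is dense; an expansion that holds on a dense
  subspace holds on its closure by Bessel's inequality.

  Only functions \<open>a\<close> for which both Fourier integrals converge absolutely are used. They are
  obtained by smoothing indicators with Gaussians, so the Plancherel theorem is never needed in full.
\<close>

section \<open>The space of square-integrable functions\<close>

text \<open>The Parseval step holds at each single scale for every admissible \<psi>, so the content
  of the equivalence sits in the sum over k. That sum may a priori be infinite, and the identity for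
  it is tested only on a dense set, so it cannot simply be extended by continuity. The diagonal case
  is therefore treated first, with sums in \<open>ennreal\<close>, where Tonelli applies before any
  finiteness is known; it then supplies the square-summability behind absolute convergence for two
  different tensors. A second constraint: the hypotheses on \<Psi> concern slices at fixed y, while
  the pairing integrates over y at fixed frequency. Recovering \<Psi> as an L2 function on the plane
  lets Fubini exchange the two kinds of slices. The translation step is 2^k because, after rescaling
  to scale k, the integers m index the full system of characters of an interval of length 1, exactly
  the allowed support. The exceptional null set of the pointwise identity may depend on f and g, so
  polarization can work pair by pair from finitely many diagonal statements.\<close>

definition l2_norm :: "'a measure \<Rightarrow> ('a \<Rightarrow> complex) \<Rightarrow> real" where
  "l2_norm M f = sqrt (\<integral>x. (cmod (f x))\<^sup>2 \<partial>M)"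

lemma borel_measurable_cnj [measurable (raw), simp]:
  "f \<in> borel_measurable M \<Longrightarrow> (\<lambda>x. cnj (f x)) \<in> borel_measurable M"
  by (rule borel_measurable_continuous_on[OF continuous_on_cnj[OF continuous_on_id]])

lemma L2_measurable: "L2 M f \<Longrightarrow> f \<in> borel_measurable M"
  by (simp add: L2_def)

lemma L2_integrable: "L2 M f \<Longrightarrow> integrable M (\<lambda>x. (cmod (f x))\<^sup>2)"
  by (simp add: L2_def)

lemma l2_norm_nonneg [simp]: "0 \<le> l2_norm M f"
  by (simp add: l2_norm_def)

lemma l2_norm_square: "(l2_norm M f)\<^sup>2 = (\<integral>x. (cmod (f x))\<^sup>2 \<partial>M)"
  by (simp add: l2_norm_def)

lemma L2_I_nn_integral:
  assumes "f \<in> borel_measurable M" "(\<integral>\<^sup>+x. ennreal ((cmod (f x))\<^sup>2) \<partial>M) < \<infinity>"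
  shows "L2 M f"
  using assms unfolding L2_def by (auto intro!: integrableI_bounded)

lemma L2_nn_integral:
  assumes "L2 M f"
  shows "(\<integral>\<^sup>+x. ennreal ((cmod (f x))\<^sup>2) \<partial>M) = ennreal ((l2_norm M f)\<^sup>2)"
  unfolding l2_norm_square
  by (rule nn_integral_eq_integral) (use assms in \<open>auto simp: L2_def\<close>)

lemma L2_mult_integrable:
  assumes "L2 M f" "L2 M g"
  shows "integrable M (\<lambda>x. f x * g x)"
proof -
  note [measurable] = assms[THEN L2_measurable]
  show ?thesis
  proof (rule Bochner_Integration.integrable_bound)
    show "integrable M (\<lambda>x. (cmod (f x))\<^sup>2 + (cmod (g x))\<^sup>2)"
      by (intro Bochner_Integration.integrable_add L2_integrable assms)
    have "cmod (f x) * cmod (g x) \<le> (cmod (f x))\<^sup>2 + (cmod (g x))\<^sup>2" for x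
      using sum_squares_bound[of "cmod (f x)" "cmod (g x)"]
        mult_nonneg_nonneg[OF norm_ge_zero[of "f x"] norm_ge_zero[of "g x"]] by linarith
    then show "AE x in M. norm (f x * g x) \<le> norm ((cmod (f x))\<^sup>2 + (cmod (g x))\<^sup>2)"
      by (auto simp: norm_mult)
  qed measurable
qed

lemma L2_cnj: "L2 M f \<Longrightarrow> L2 M (\<lambda>x. cnj (f x))"
  by (simp add: L2_def)

lemma L2_inner_integrable:
  assumes "L2 M f" "L2 M g"
  shows "integrable M (\<lambda>x. f x * cnj (g x))"
  by (rule L2_mult_integrable[OF assms(1) L2_cnj[OF assms(2)]])

lemma L2_bounded_mult:
  assumes "L2 M f" "g \<in> borel_measurable M" "\<And>x. x \<in> space M \<Longrightarrow> cmod (g x) \<le> B"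
  shows "L2 M (\<lambda>x. g x * f x)"
proof -
  note [measurable] = assms(2) L2_measurable[OF assms(1)]
  have "integrable M (\<lambda>x. (cmod (g x * f x))\<^sup>2)"
  proof (rule Bochner_Integration.integrable_bound)
    show "integrable M (\<lambda>x. B\<^sup>2 * (cmod (f x))\<^sup>2)"
      by (intro integrable_mult_right L2_integrable assms)
    show "AE x in M. norm ((cmod (g x * f x))\<^sup>2) \<le> norm (B\<^sup>2 * (cmod (f x))\<^sup>2)"
      using assms(3) by (intro AE_I2) (auto simp: norm_mult power_mult_distrib intro!: mult_right_mono power_mono)
  qed measurable
  then show ?thesis by (simp add: L2_def)
qed

lemma L2_cmult: "L2 M f \<Longrightarrow> L2 M (\<lambda>x. c * f x)"
  by (rule L2_bounded_mult[where B="cmod c"]) auto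

lemma L2_zero [simp]: "L2 M (\<lambda>x. 0)"
  by (simp add: L2_def)

lemma L2_add:
  assumes "L2 M f" "L2 M g"
  shows "L2 M (\<lambda>x. f x + g x)"
proof -
  note [measurable] = assms[THEN L2_measurable]
  have "integrable M (\<lambda>x. (cmod (f x + g x))\<^sup>2)"
  proof (rule Bochner_Integration.integrable_bound)
    show "integrable M (\<lambda>x. 2 * (cmod (f x))\<^sup>2 + 2 * (cmod (g x))\<^sup>2)"
      by (intro Bochner_Integration.integrable_add integrable_mult_right L2_integrable assms)
    have "(cmod (f x + g x))\<^sup>2 \<le> 2 * (cmod (f x))\<^sup>2 + 2 * (cmod (g x))\<^sup>2" for x
    proof -
      have "(cmod (f x + g x))\<^sup>2 \<le> (cmod (f x) + cmod (g x))\<^sup>2"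
        by (intro power_mono norm_triangle_ineq) auto
      also have "\<dots> \<le> 2 * (cmod (f x))\<^sup>2 + 2 * (cmod (g x))\<^sup>2"
        using sum_squares_bound[of "cmod (f x)" "cmod (g x)"] by (simp add: power2_sum)
      finally show ?thesis .
    qed
    then show "AE x in M. norm ((cmod (f x + g x))\<^sup>2) \<le> norm (2 * (cmod (f x))\<^sup>2 + 2 * (cmod (g x))\<^sup>2)"
      by auto
  qed measurable
  then show ?thesis by (simp add: L2_def)
qed

lemma L2_diff: "L2 M f \<Longrightarrow> L2 M g \<Longrightarrow> L2 M (\<lambda>x. f x - g x)"
  using L2_add[of M f "\<lambda>x. -1 * g x"] L2_cmult[of M g "-1"] by simp

lemma l2_inner_add_left:
  "L2 M f \<Longrightarrow> L2 M g \<Longrightarrow> L2 M h \<Longrightarrow> l2_inner M (\<lambda>x. f x + g x) h = l2_inner M f h + l2_inner M g h"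
  unfolding l2_inner_def
  by (simp add: distrib_right L2_inner_integrable Bochner_Integration.integral_add)

lemma l2_inner_diff_left:
  "L2 M f \<Longrightarrow> L2 M g \<Longrightarrow> L2 M h \<Longrightarrow> l2_inner M (\<lambda>x. f x - g x) h = l2_inner M f h - l2_inner M g h"
  unfolding l2_inner_def
  by (simp add: left_diff_distrib L2_inner_integrable Bochner_Integration.integral_diff)

lemma l2_inner_cmult_left: "l2_inner M (\<lambda>x. c * f x) h = c * l2_inner M f h"
  unfolding l2_inner_def by (simp add: mult.assoc)

lemma l2_inner_commute: "l2_inner M f g = cnj (l2_inner M g f)"
  unfolding l2_inner_def by (simp add: mult.commute Bochner_Integration.integral_cnj[symmetric] del: Bochner_Integration.integral_cnj)

lemma l2_inner_add_right:
  "L2 M f \<Longrightarrow> L2 M g \<Longrightarrow> L2 M h \<Longrightarrow> l2_inner M h (\<lambda>x. f x + g x) = l2_inner M h f + l2_inner M h g"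
  by (simp add: l2_inner_commute[of M h] l2_inner_add_left)

lemma l2_inner_diff_right:
  "L2 M f \<Longrightarrow> L2 M g \<Longrightarrow> L2 M h \<Longrightarrow> l2_inner M h (\<lambda>x. f x - g x) = l2_inner M h f - l2_inner M h g"
  by (simp add: l2_inner_commute[of M h] l2_inner_diff_left)

lemma l2_inner_cmult_right: "l2_inner M h (\<lambda>x. c * f x) = cnj c * l2_inner M h f"
  by (simp add: l2_inner_commute[of M h] l2_inner_cmult_left)

lemma l2_inner_self: "l2_inner M f f = complex_of_real ((l2_norm M f)\<^sup>2)"
  unfolding l2_inner_def l2_norm_square
  by (simp add: complex_norm_square[symmetric] integral_complex_of_real[symmetric] del: integral_complex_of_real of_real_power)

lemma l2_inner_le_integral:
  assumes "L2 M f" "L2 M g"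
  shows "(\<integral>x. cmod (f x) * cmod (g x) \<partial>M) \<le> l2_norm M f * l2_norm M g"
proof -
  note [measurable] = assms[THEN L2_measurable]
  have int: "integrable M (\<lambda>x. cmod (f x) * cmod (g x))"
    using integrable_norm[OF L2_mult_integrable[OF assms]] by (simp add: norm_mult)
  have "(\<integral>\<^sup>+x. ennreal (cmod (f x)) * ennreal (cmod (g x)) \<partial>M)\<^sup>2
     \<le> (\<integral>\<^sup>+x. (ennreal (cmod (f x)))\<^sup>2 \<partial>M) * (\<integral>\<^sup>+x. (ennreal (cmod (g x)))\<^sup>2 \<partial>M)"
    by (rule Cauchy_Schwarz_nn_integral) auto
  also have "\<dots> = ennreal ((l2_norm M f)\<^sup>2) * ennreal ((l2_norm M g)\<^sup>2)"
    using L2_nn_integral[OF assms(1)] L2_nn_integral[OF assms(2)] by (simp add: ennreal_power)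
  also have "\<dots> = ennreal ((l2_norm M f * l2_norm M g)\<^sup>2)"
    by (simp add: ennreal_mult' power_mult_distrib)
  also have "(\<integral>\<^sup>+x. ennreal (cmod (f x)) * ennreal (cmod (g x)) \<partial>M) = ennreal (\<integral>x. cmod (f x) * cmod (g x) \<partial>M)"
    using nn_integral_eq_integral[OF int] by (simp add: ennreal_mult')
  finally have "(\<integral>x. cmod (f x) * cmod (g x) \<partial>M)\<^sup>2 \<le> (l2_norm M f * l2_norm M g)\<^sup>2"
    by (subst (asm) ennreal_power) auto
  then show ?thesis
    by (rule power2_le_imp_le) simp
qed

lemma l2_Cauchy_Schwarz:
  assumes "L2 M f" "L2 M g"
  shows "cmod (l2_inner M f g) \<le> l2_norm M f * l2_norm M g"
proof -
  have "cmod (l2_inner M f g) \<le> (\<integral>x. cmod (f x * cnj (g x)) \<partial>M)"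
    unfolding l2_inner_def by (rule integral_norm_bound)
  also have "\<dots> \<le> l2_norm M f * l2_norm M g"
    using l2_inner_le_integral[OF assms] by (simp add: norm_mult)
  finally show ?thesis .
qed

lemma l2_norm_cmult: "l2_norm M (\<lambda>x. c * f x) = cmod c * l2_norm M f"
  by (simp add: l2_norm_def norm_mult power_mult_distrib real_sqrt_mult)

lemma l2_norm_minus_commute: "l2_norm M (\<lambda>x. f x - g x) = l2_norm M (\<lambda>x. g x - f x)"
  by (simp add: l2_norm_def norm_minus_commute)

lemma l2_norm_triangle:
  assumes "L2 M f" "L2 M g"
  shows "l2_norm M (\<lambda>x. f x + g x) \<le> l2_norm M f + l2_norm M g"
proof -
  have "complex_of_real ((l2_norm M (\<lambda>x. f x + g x))\<^sup>2)
    = complex_of_real ((l2_norm M f)\<^sup>2) + l2_inner M f g + l2_inner M g f + complex_of_real ((l2_norm M g)\<^sup>2)"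
    using assms by (simp add: l2_inner_self[symmetric] l2_inner_add_left l2_inner_add_right L2_add del: of_real_power)
  then have "(l2_norm M (\<lambda>x. f x + g x))\<^sup>2
    = (l2_norm M f)\<^sup>2 + Re (l2_inner M f g) + Re (l2_inner M g f) + (l2_norm M g)\<^sup>2"
    by (metis (no_types, lifting) Re_complex_of_real plus_complex.sel(1))
  also have "\<dots> \<le> (l2_norm M f)\<^sup>2 + l2_norm M f * l2_norm M g + l2_norm M g * l2_norm M f + (l2_norm M g)\<^sup>2"
    using l2_Cauchy_Schwarz[OF assms] l2_Cauchy_Schwarz[OF assms(2,1)]
      complex_Re_le_cmod[of "l2_inner M f g"] complex_Re_le_cmod[of "l2_inner M g f"]
    by linarith
  also have "\<dots> = (l2_norm M f + l2_norm M g)\<^sup>2"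
    by (simp add: power2_eq_square algebra_simps)
  finally show ?thesis
    by (rule power2_le_imp_le) simp
qed

lemma l2_norm_triangle_diff:
  assumes "L2 M f" "L2 M g" "L2 M h"
  shows "l2_norm M (\<lambda>x. f x - h x) \<le> l2_norm M (\<lambda>x. f x - g x) + l2_norm M (\<lambda>x. g x - h x)"
  using l2_norm_triangle[OF L2_diff[OF assms(1,2)] L2_diff[OF assms(2,3)]] by simp

lemma l2_norm_le_add_diff:
  assumes "L2 M f" "L2 M g"
  shows "l2_norm M f \<le> l2_norm M g + l2_norm M (\<lambda>x. f x - g x)"
  using l2_norm_triangle[OF assms(2) L2_diff[OF assms]] by simp

lemma tendsto_l2_norm_dominated:
  assumes "\<And>n. f n \<in> borel_measurable M" "g \<in> borel_measurable M"
    and "integrable M w" "\<And>n x. x \<in> space M \<Longrightarrow> (cmod (f n x - g x))\<^sup>2 \<le> w x"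
    and "AE x in M. (\<lambda>n. f n x) \<longlonglongrightarrow> g x"
  shows "(\<lambda>n. l2_norm M (\<lambda>x. f n x - g x)) \<longlonglongrightarrow> 0"
proof -
  note [measurable] = assms(1,2)
  have "(\<lambda>n. \<integral>x. (cmod (f n x - g x))\<^sup>2 \<partial>M) \<longlonglongrightarrow> (\<integral>x. 0 \<partial>M)"
  proof (rule integral_dominated_convergence[OF _ _ assms(3)])
    show "AE x in M. (\<lambda>n. (cmod (f n x - g x))\<^sup>2) \<longlonglongrightarrow> 0"
      using assms(5)
    proof eventually_elim
      case (elim x)
      then have "(\<lambda>n. f n x - g x) \<longlonglongrightarrow> 0" by (simp add: LIM_zero)
      from tendsto_power[OF tendsto_norm_zero[OF this], of 2] show ?case by simp
    qed
    show "AE x in M. norm ((cmod (f n x - g x))\<^sup>2) \<le> w x" for n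
      using assms(4) by auto
  qed measurable
  from tendsto_real_sqrt[OF this] show ?thesis by (simp add: l2_norm_def)
qed

text \<open>The squared differences tend to 0 in L1, which yields the subsequence. It provides the
  pointwise limits that Fatou's lemma consumes in
  \<open>AE_eq_const_of_fourier_pair\<close>.\<close>

lemma l2_norm_tendsto_AE_subseq:
  assumes "\<And>n. L2 M (f n)" "L2 M g" "(\<lambda>n. l2_norm M (\<lambda>x. f n x - g x)) \<longlonglongrightarrow> 0"
  shows "\<exists>r::nat\<Rightarrow>nat. strict_mono r \<and> (AE x in M. (\<lambda>n. f (r n) x) \<longlonglongrightarrow> g x)"
proof -
  have "\<exists>r::nat\<Rightarrow>nat. strict_mono r \<and> (AE x in M. (\<lambda>n. (cmod (f (r n) x - g x))\<^sup>2) \<longlonglongrightarrow> 0)"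
  proof (rule tendsto_L1_AE_subseq)
    show "integrable M (\<lambda>x. (cmod (f n x - g x))\<^sup>2)" for n
      by (intro L2_integrable L2_diff assms)
    have "(\<lambda>n. (l2_norm M (\<lambda>x. f n x - g x))\<^sup>2) \<longlonglongrightarrow> 0\<^sup>2"
      by (intro tendsto_power assms)
    then show "(\<lambda>n. \<integral>x. norm ((cmod (f n x - g x))\<^sup>2) \<partial>M) \<longlonglongrightarrow> 0"
      by (simp add: l2_norm_square)
  qed
  then obtain r :: "nat \<Rightarrow> nat" where r: "strict_mono r" "AE x in M. (\<lambda>n. (cmod (f (r n) x - g x))\<^sup>2) \<longlonglongrightarrow> 0"
    by blast
  have "AE x in M. (\<lambda>n. f (r n) x) \<longlonglongrightarrow> g x"
    using r(2)
  proof eventually_elim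
    case (elim x)
    from tendsto_real_sqrt[OF this] have "(\<lambda>n. cmod (f (r n) x - g x)) \<longlonglongrightarrow> 0" by simp
    then show ?case by (simp add: tendsto_norm_zero_iff LIM_zero_iff)
  qed
  with r(1) show ?thesis by blast
qed

text \<open>Square-integrability is demanded of both f and d because \<open>l2_norm\<close> is 0
  whenever the square is not integrable, so a small value of \<open>l2_norm\<close> alone says
  nothing. Functions are not identified up to null sets: the closure is taken for a seminorm and
  contains every almost-everywhere modification of its members.\<close>

definition l2_closure :: "'a measure \<Rightarrow> ('a \<Rightarrow> complex) set \<Rightarrow> ('a \<Rightarrow> complex) set" where
  "l2_closure M D = {f. L2 M f \<and> (\<forall>e>0. \<exists>d\<in>D. L2 M d \<and> l2_norm M (\<lambda>x. f x - d x) < e)}"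

lemma l2_closure_L2: "f \<in> l2_closure M D \<Longrightarrow> L2 M f"
  by (simp add: l2_closure_def)

lemma l2_closureD:
  assumes "f \<in> l2_closure M D" "e > 0"
  obtains d where "d \<in> D" "L2 M d" "l2_norm M (\<lambda>x. f x - d x) < e"
  using assms by (auto simp: l2_closure_def)

lemma l2_closure_superset: "d \<in> D \<Longrightarrow> L2 M d \<Longrightarrow> d \<in> l2_closure M D"
  by (auto simp: l2_closure_def l2_norm_def intro!: bexI[of _ d])

lemma l2_closure_seq:
  assumes "f \<in> l2_closure M D"
  shows "\<exists>d. (\<forall>n::nat. d n \<in> D \<and> L2 M (d n)) \<and> (\<lambda>n. l2_norm M (\<lambda>x. d n x - f x)) \<longlonglongrightarrow> 0"
proof -
  have "\<exists>d. d \<in> D \<and> L2 M d \<and> l2_norm M (\<lambda>x. f x - d x) < 1 / real (Suc n)" for n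
    using l2_closureD[OF assms, of "1 / real (Suc n)"] by (metis of_nat_0_less_iff zero_less_Suc zero_less_divide_1_iff)
  then obtain d where d: "\<And>n. d n \<in> D" "\<And>n. L2 M (d n)" "\<And>n. l2_norm M (\<lambda>x. f x - d n x) < 1 / real (Suc n)"
    by metis
  have "(\<lambda>n. l2_norm M (\<lambda>x. d n x - f x)) \<longlonglongrightarrow> 0"
  proof (rule tendsto_sandwich[OF _ _ tendsto_const LIMSEQ_inverse_real_of_nat])
    show "eventually (\<lambda>n. l2_norm M (\<lambda>x. d n x - f x) \<le> inverse (real (Suc n))) sequentially"
      using d(3) by (intro always_eventually) (auto simp: l2_norm_minus_commute[of M _ f] inverse_eq_divide intro: less_imp_le)
  qed auto
  with d show ?thesis by blast
qed

lemma l2_closure_limit: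
  assumes "\<And>n::nat. f n \<in> l2_closure M D" "L2 M g" "(\<lambda>n. l2_norm M (\<lambda>x. f n x - g x)) \<longlonglongrightarrow> 0"
  shows "g \<in> l2_closure M D"
  unfolding l2_closure_def
proof (safe intro!: assms(2))
  fix e :: real assume "e > 0"
  then have "eventually (\<lambda>n. l2_norm M (\<lambda>x. f n x - g x) < e/2) sequentially"
    using order_tendstoD(2)[OF assms(3), of "e/2"] by simp
  then obtain n where n: "l2_norm M (\<lambda>x. f n x - g x) < e/2"
    by (auto simp: eventually_sequentially)
  obtain d where d: "d \<in> D" "L2 M d" "l2_norm M (\<lambda>x. f n x - d x) < e/2"
    using l2_closureD[OF assms(1)[of n], of "e/2"] \<open>e > 0\<close> by auto
  have "l2_norm M (\<lambda>x. g x - d x) < e"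
    using l2_norm_triangle_diff[OF assms(2) l2_closure_L2[OF assms(1)[of n]] d(2)] n d(3)
    by (simp add: l2_norm_minus_commute[of M g "f n"])
  with d show "\<exists>d\<in>D. L2 M d \<and> l2_norm M (\<lambda>x. g x - d x) < e" by blast
qed

definition linear_space :: "('a \<Rightarrow> complex) set \<Rightarrow> bool" where
  "linear_space D \<longleftrightarrow> (\<lambda>x. 0) \<in> D \<and> (\<forall>f\<in>D. \<forall>g\<in>D. (\<lambda>x. f x + g x) \<in> D) \<and>
     (\<forall>c. \<forall>f\<in>D. (\<lambda>x. c * f x) \<in> D)"

lemma linear_spaceD:
  assumes "linear_space D"
  shows "(\<lambda>x. 0) \<in> D" "f \<in> D \<Longrightarrow> g \<in> D \<Longrightarrow> (\<lambda>x. f x + g x) \<in> D" "f \<in> D \<Longrightarrow> (\<lambda>x. c * f x) \<in> D"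
  using assms by (auto simp: linear_space_def)

lemma zero_mem_l2_closure: "linear_space D \<Longrightarrow> (\<lambda>x. 0) \<in> l2_closure M D"
  by (rule l2_closure_superset[OF linear_spaceD(1)]) auto

lemma l2_closure_add:
  assumes D: "linear_space D"
    and "f \<in> l2_closure M D" "g \<in> l2_closure M D"
  shows "(\<lambda>x. f x + g x) \<in> l2_closure M D"
  unfolding l2_closure_def
proof (safe intro!: L2_add l2_closure_L2[OF assms(2)] l2_closure_L2[OF assms(3)])
  fix e :: real assume "e > 0"
  obtain d where d: "d \<in> D" "L2 M d" "l2_norm M (\<lambda>x. f x - d x) < e/2"
    using l2_closureD[OF assms(2), of "e/2"] \<open>e > 0\<close> by auto
  obtain d' where d': "d' \<in> D" "L2 M d'" "l2_norm M (\<lambda>x. g x - d' x) < e/2"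
    using l2_closureD[OF assms(3), of "e/2"] \<open>e > 0\<close> by auto
  have "l2_norm M (\<lambda>x. (f x + g x) - (d x + d' x)) < e"
    using l2_norm_triangle[OF L2_diff[OF l2_closure_L2[OF assms(2)] d(2)] L2_diff[OF l2_closure_L2[OF assms(3)] d'(2)]] d(3) d'(3)
    by (simp add: algebra_simps)
  then show "\<exists>d\<in>D. L2 M d \<and> l2_norm M (\<lambda>x. f x + g x - d x) < e"
    using d d' linear_spaceD[OF D] L2_add by (intro bexI[of _ "\<lambda>x. d x + d' x"]) auto
qed

lemma l2_closure_cmult:
  assumes D: "linear_space D" and "f \<in> l2_closure M D"
  shows "(\<lambda>x. c * f x) \<in> l2_closure M D"
  unfolding l2_closure_def
proof (safe intro!: L2_cmult l2_closure_L2[OF assms(2)])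
  fix e :: real assume "e > 0"
  \<comment> \<open>The summand 1 keeps the tolerance e / (|c| + 1) meaningful when c = 0.\<close>
  have pos: "cmod c + 1 > 0" by (simp add: add_nonneg_pos)
  obtain d where d: "d \<in> D" "L2 M d" "l2_norm M (\<lambda>x. f x - d x) < e / (cmod c + 1)"
    using l2_closureD[OF assms(2), of "e / (cmod c + 1)"] \<open>e > 0\<close> pos by auto
  have "l2_norm M (\<lambda>x. c * f x - c * d x) = cmod c * l2_norm M (\<lambda>x. f x - d x)"
    by (simp add: right_diff_distrib[symmetric] l2_norm_cmult)
  also have "\<dots> \<le> (cmod c + 1) * l2_norm M (\<lambda>x. f x - d x)"
    by (intro mult_right_mono) auto
  also have "\<dots> < e"
    using d(3) pos by (simp add: field_simps)
  finally show "\<exists>d\<in>D. L2 M d \<and> l2_norm M (\<lambda>x. c * f x - d x) < e"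
    using d linear_spaceD[OF D] L2_cmult by (intro bexI[of _ "\<lambda>x. c * d x"]) auto
qed

section \<open>Dense subspaces and expansions\<close>

lemma tendsto_l2_inner:
  assumes "\<And>n::nat. L2 M (f n)" "L2 M g" "L2 M h" "(\<lambda>n. l2_norm M (\<lambda>x. f n x - g x)) \<longlonglongrightarrow> 0"
  shows "(\<lambda>n. l2_inner M (f n) h) \<longlonglongrightarrow> l2_inner M g h"
proof (rule LIM_zero_cancel, rule Lim_null_comparison)
  show "eventually (\<lambda>n. norm (l2_inner M (f n) h - l2_inner M g h) \<le> l2_norm M (\<lambda>x. f n x - g x) * l2_norm M h) sequentially"
    using l2_Cauchy_Schwarz[OF L2_diff[OF assms(1,2)] assms(3)]
    by (intro always_eventually) (simp add: l2_inner_diff_left assms(1-3))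
  show "(\<lambda>n. l2_norm M (\<lambda>x. f n x - g x) * l2_norm M h) \<longlonglongrightarrow> 0"
    using tendsto_mult[OF assms(4) tendsto_const[of "l2_norm M h"]] by simp
qed

lemma tendsto_l2_norm:
  assumes "\<And>n::nat. L2 M (f n)" "L2 M g" "(\<lambda>n. l2_norm M (\<lambda>x. f n x - g x)) \<longlonglongrightarrow> 0"
  shows "(\<lambda>n. l2_norm M (f n)) \<longlonglongrightarrow> l2_norm M g"
proof (rule LIM_zero_cancel, rule Lim_null_comparison[OF _ assms(3)], intro always_eventually allI)
  fix n
  show "norm (l2_norm M (f n) - l2_norm M g) \<le> l2_norm M (\<lambda>x. f n x - g x)"
    using l2_norm_le_add_diff[OF assms(1)[of n] assms(2)] l2_norm_le_add_diff[OF assms(2) assms(1)[of n]]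
    by (simp add: l2_norm_minus_commute[of M g "f n"])
qed

lemma l2_closure_sum:
  assumes D: "linear_space D"
    and "\<And>i. i \<in> I \<Longrightarrow> f i \<in> l2_closure M D"
  shows "(\<lambda>x. \<Sum>i\<in>I. f i x) \<in> l2_closure M D"
  using assms(2)
proof (induction I rule: infinite_finite_induct)
  case (insert i I)
  then show ?case
    using l2_closure_add[OF D, of "f i" M "\<lambda>x. \<Sum>i\<in>I. f i x"] by simp
qed (use zero_mem_l2_closure[OF D] in auto)

section \<open>Density criteria: from indicators of boxes to all square-integrable functions\<close>

lemma L2_indicator:
  assumes "A \<in> sets M" "emeasure M A < \<infinity>"
  shows "L2 M (indicator A)"
proof -
  have "integrable M (\<lambda>x. (cmod (indicator A x))\<^sup>2) \<longleftrightarrow> integrable M (indicator A :: _ \<Rightarrow> real)"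
    by (intro Bochner_Integration.integrable_cong) (auto simp: indicator_def)
  then show ?thesis
    using assms by (auto simp: L2_def)
qed

text \<open>Dynkin's argument: boxes form an intersection-stable generator of the Borel sets,
  complements come from subtraction and disjoint unions from partial sums. The set \<Omega> of
  finite measure keeps every indicator in L2, and its indicator is the majorant for all
  limits.\<close>

lemma indicator_mem_l2_closure:
  fixes D :: "('a::euclidean_space \<Rightarrow> complex) set"
  assumes D: "linear_space D"
    and \<Omega>: "\<Omega> \<in> sets borel" "emeasure lborel \<Omega> < \<infinity>"
    and box: "\<And>a b. indicator (box a b \<inter> \<Omega>) \<in> l2_closure lborel D"
    and S: "S \<in> sets borel"
  shows "indicator (S \<inter> \<Omega>) \<in> l2_closure lborel D"
proof -
  note [measurable] = \<Omega>(1)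
  have fin: "emeasure lborel (A \<inter> \<Omega>) < \<infinity>" if "A \<in> sets borel" for A
    using emeasure_mono[of "A \<inter> \<Omega>" \<Omega> lborel] \<Omega> that by (auto simp: order_le_less_trans)
  have L2i: "L2 lborel (indicator (A \<inter> \<Omega>))" if "A \<in> sets borel" for A
    using fin[OF that] that \<Omega> by (intro L2_indicator) auto
  have int\<Omega>: "integrable lborel (indicator \<Omega> :: _ \<Rightarrow> real)"
    using \<Omega> by simp
  have lim: "indicator (A \<inter> \<Omega>) \<in> l2_closure lborel D"
    if A: "A \<in> sets borel" and f: "\<And>n::nat. f n \<in> l2_closure lborel D"
      and bnd: "\<And>n x. (cmod (f n x - indicator (A \<inter> \<Omega>) x))\<^sup>2 \<le> indicator \<Omega> x"
      and conv: "\<And>x. (\<lambda>n. f n x) \<longlonglongrightarrow> indicator (A \<inter> \<Omega>) x" for A f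
  proof (rule l2_closure_limit[OF f L2i[OF A]])
    show "(\<lambda>n. l2_norm lborel (\<lambda>x. f n x - indicator (A \<inter> \<Omega>) x)) \<longlonglongrightarrow> 0"
      using f[THEN l2_closure_L2, THEN L2_measurable] L2i[OF A, THEN L2_measurable] conv bnd
      by (intro tendsto_l2_norm_dominated[OF _ _ int\<Omega>]) auto
  qed
  \<comment> \<open>The whole space is not a box, so \<Omega> itself is reached by exhausting it
    with growing boxes; the complement step subtracts from it.\<close>
  have all: "indicator (UNIV \<inter> \<Omega>) \<in> l2_closure lborel D"
  proof (rule lim[where f="\<lambda>n. indicator (box (- (real n *\<^sub>R One)) (real n *\<^sub>R One) \<inter> \<Omega>)"])
    show "(cmod (indicator (box (- (real n *\<^sub>R One)) (real n *\<^sub>R One) \<inter> \<Omega>) x - indicator (UNIV \<inter> \<Omega>) x))\<^sup>2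
      \<le> indicator \<Omega> x" for n x
      by (auto simp: indicator_def)
    fix x :: 'a
    obtain n where n: "x \<in> box (- (real n *\<^sub>R One)) (real n *\<^sub>R One)"
      using UN_box_eq_UNIV by blast
    have "x \<in> box (- (real m *\<^sub>R One)) (real m *\<^sub>R One)" if "m \<ge> n" for m
      using n that by (force simp: mem_box)
    then show "(\<lambda>n. indicator (box (- (real n *\<^sub>R One)) (real n *\<^sub>R One) \<inter> \<Omega>) x) \<longlonglongrightarrow> (indicator (UNIV \<inter> \<Omega>) x :: complex)"
      by (intro tendsto_eventually eventually_sequentiallyI[of n]) (auto simp: indicator_def)
  qed (use box in auto)
  have S': "S \<in> sigma_sets UNIV (range (\<lambda>(a::'a, b). box a b))"
    using S by (simp add: borel_eq_box)
  show ?thesis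
  proof (rule sigma_sets_induct_disjoint[OF _ _ S'])
    show "Int_stable (range (\<lambda>(a::'a, b). box a b))"
      by (auto simp: Int_stable_def box_Int_box)
  next
    fix A assume A: "A \<in> sigma_sets UNIV (range (\<lambda>(a::'a, b). box a b))" "indicator (A \<inter> \<Omega>) \<in> l2_closure lborel D"
    have "(\<lambda>x. indicator (UNIV \<inter> \<Omega>) x + (-1) * indicator (A \<inter> \<Omega>) x) \<in> l2_closure lborel D"
      by (intro l2_closure_add[OF D] all l2_closure_cmult[OF D] A)
    also have "(\<lambda>x. indicator (UNIV \<inter> \<Omega>) x + (-1) * indicator (A \<inter> \<Omega>) x) = (indicator ((UNIV - A) \<inter> \<Omega>) :: 'a \<Rightarrow> complex)"
      by (auto simp: indicator_def)
    finally show "indicator ((UNIV - A) \<inter> \<Omega>) \<in> l2_closure lborel D" .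
  next
    fix A :: "nat \<Rightarrow> 'a set"
    assume A: "disjoint_family A" "range A \<subseteq> sigma_sets UNIV (range (\<lambda>(a::'a, b). box a b))"
      "\<And>i. indicator (A i \<inter> \<Omega>) \<in> l2_closure lborel D"
    have Ab: "A i \<in> sets borel" for i
      using A(2) by (auto simp: borel_eq_box)
    have part: "(\<Sum>i<n. indicator (A i \<inter> \<Omega>) x) = (indicator ((\<Union>i<n. A i) \<inter> \<Omega>) x :: complex)" for n x
    proof -
      have "(\<Sum>i<n. indicator (A i) x) = (indicator (\<Union>i<n. A i) x :: complex)"
        using A(1) by (subst indicator_UN_disjoint) (auto simp: disjoint_family_on_def)
      then show ?thesis
        by (simp add: indicator_inter_arith sum_distrib_right[symmetric])
    qed
    show "indicator ((\<Union>i. A i) \<inter> \<Omega>) \<in> l2_closure lborel D"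
    proof (rule lim[where f="\<lambda>n x. \<Sum>i<n. indicator (A i \<inter> \<Omega>) x"])
      show "(\<lambda>x. \<Sum>i<n. indicator (A i \<inter> \<Omega>) x) \<in> l2_closure lborel D" for n
        by (intro l2_closure_sum[OF D] A)
      show "(cmod ((\<Sum>i<n. indicator (A i \<inter> \<Omega>) x) - indicator ((\<Union>i. A i) \<inter> \<Omega>) x))\<^sup>2 \<le> indicator \<Omega> x" for n x
        unfolding part by (auto simp: indicator_def)
      show "(\<lambda>n. \<Sum>i<n. indicator (A i \<inter> \<Omega>) x) \<longlonglongrightarrow> (indicator ((\<Union>i. A i) \<inter> \<Omega>) x :: complex)" for x
      proof (cases "x \<in> (\<Union>i. A i)")
        case True
        then obtain k where k: "x \<in> A k" by auto
        show ?thesis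
          unfolding part using k by (intro tendsto_eventually eventually_sequentiallyI[of "Suc k"])
            (auto simp: indicator_def)
      next
        case False
        then show ?thesis
          unfolding part by (intro tendsto_eventually always_eventually) (auto simp: indicator_def)
      qed
    qed (use Ab in auto)
  next
    show "indicator ({} \<inter> \<Omega>) \<in> l2_closure lborel D"
      using zero_mem_l2_closure[OF D, of lborel] by (simp add: indicator_def[abs_def])
  qed (use box in auto)
qed

text \<open>The approximating simple functions satisfy |F_i| \<le> 2|f|. This one bound does two
  jobs: F_i vanishes outside \<Omega>, hence is a combination of indicators of sets S \<inter>
  \<Omega>, and |F_i - f|^2 is dominated by 9|f|^2.\<close>

lemma mem_l2_closure_vanishing_outside:
  fixes D :: "('a::euclidean_space \<Rightarrow> complex) set"
  assumes D: "linear_space D"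
    and \<Omega>: "\<Omega> \<in> sets borel" "emeasure lborel \<Omega> < \<infinity>"
    and box: "\<And>a b. indicator (box a b \<inter> \<Omega>) \<in> l2_closure lborel D"
    and f: "L2 lborel f" "\<And>x. x \<notin> \<Omega> \<Longrightarrow> f x = 0"
  shows "f \<in> l2_closure lborel D"
proof -
  obtain F where F: "\<And>i. simple_function lborel (F i)" "\<And>x. (\<lambda>i. F i x) \<longlonglongrightarrow> f x"
    "\<And>i x. dist (F i x) 0 \<le> 2 * dist (f x) 0"
    using borel_measurable_implies_sequence_metric[OF L2_measurable[OF f(1)], of 0] by auto
  have Fi: "F i \<in> l2_closure lborel D" for i
  proof -
    have "(\<lambda>x. \<Sum>y\<in>range (F i). y * indicator (F i -` {y} \<inter> \<Omega>) x) \<in> l2_closure lborel D"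
      using F(1)[of i]
      by (intro l2_closure_sum[OF D] l2_closure_cmult[OF D] indicator_mem_l2_closure[OF D \<Omega> box])
        (auto simp: simple_function_def)
    also have "(\<lambda>x. \<Sum>y\<in>range (F i). y * indicator (F i -` {y} \<inter> \<Omega>) x) = F i"
    proof
      fix x
      have fin: "finite (range (F i))"
        using F(1)[of i] by (auto simp: simple_function_def)
      have "(\<Sum>y\<in>range (F i). y * indicator (F i -` {y} \<inter> \<Omega>) x) = (\<Sum>y\<in>range (F i). if y = F i x then y * indicator \<Omega> x else 0)"
        by (intro sum.cong) (auto simp: indicator_def)
      also have "\<dots> = F i x * indicator \<Omega> x"
        using fin by (simp add: sum.delta)
      also have "\<dots> = F i x"
        using F(3)[of i x] f(2)[of x] by (auto simp: indicator_def)
      finally show "(\<Sum>y\<in>range (F i). y * indicator (F i -` {y} \<inter> \<Omega>) x) = F i x" .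
    qed
    finally show ?thesis .
  qed
  show ?thesis
  proof (rule l2_closure_limit[where f=F, OF Fi f(1)], rule tendsto_l2_norm_dominated[where f=F])
    show "integrable lborel (\<lambda>x. 9 * (cmod (f x))\<^sup>2)"
      by (intro integrable_mult_right L2_integrable f)
    show "(cmod (F n x - f x))\<^sup>2 \<le> 9 * (cmod (f x))\<^sup>2" for n x
    proof -
      have "cmod (F n x - f x) \<le> 3 * cmod (f x)"
        using F(3)[of n x] norm_triangle_ineq4[of "F n x" "f x"] by simp
      from power_mono[OF this, of 2] show ?thesis by (simp add: power_mult_distrib)
    qed
  qed (use F Fi[THEN l2_closure_L2, THEN L2_measurable] L2_measurable[OF f(1)] in auto)
qed

section \<open>Bessel's inequality and the extension of expansions to closures\<close>

lemma l2_inner_mult_commute: "l2_inner M f g * l2_inner M g f = complex_of_real ((cmod (l2_inner M f g))\<^sup>2)"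
  by (subst (2) l2_inner_commute) (simp add: complex_norm_square del: of_real_power)

text \<open>For a fixed finite S both sides are continuous in f, so the bound passes from D to its
  closure, although the equality for the full sum does not pass by this argument.\<close>

lemma l2_closure_Bessel:
  assumes \<phi>: "\<And>p. L2 M (\<phi> p)"
    and D: "\<And>d. d \<in> D \<Longrightarrow> ((\<lambda>p. l2_inner M d (\<phi> p) * l2_inner M (\<phi> p) d) has_sum l2_inner M d d) UNIV"
    and f: "f \<in> l2_closure M D" and S: "finite S"
  shows "(\<Sum>p\<in>S. (cmod (l2_inner M f (\<phi> p)))\<^sup>2) \<le> (l2_norm M f)\<^sup>2"
proof -
  obtain d where d: "\<forall>n::nat. d n \<in> D \<and> L2 M (d n)" "(\<lambda>n. l2_norm M (\<lambda>x. d n x - f x)) \<longlonglongrightarrow> 0"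
    using l2_closure_seq[OF f] by blast
  show ?thesis
  proof (rule LIMSEQ_le)
    show "(\<lambda>n. \<Sum>p\<in>S. (cmod (l2_inner M (d n) (\<phi> p)))\<^sup>2) \<longlonglongrightarrow> (\<Sum>p\<in>S. (cmod (l2_inner M f (\<phi> p)))\<^sup>2)"
      using d l2_closure_L2[OF f] \<phi> by (intro tendsto_sum tendsto_power tendsto_norm tendsto_l2_inner) auto
    show "(\<lambda>n. (l2_norm M (d n))\<^sup>2) \<longlonglongrightarrow> (l2_norm M f)\<^sup>2"
      using d l2_closure_L2[OF f] by (intro tendsto_power tendsto_l2_norm) auto
    have "(\<Sum>p\<in>S. (cmod (l2_inner M (d n) (\<phi> p)))\<^sup>2) \<le> (l2_norm M (d n))\<^sup>2" for n
    proof -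
      have "((\<lambda>p. (cmod (l2_inner M (d n) (\<phi> p)))\<^sup>2) has_sum (l2_norm M (d n))\<^sup>2) UNIV"
        using D[of "d n"] d(1) unfolding l2_inner_mult_commute l2_inner_self has_sum_of_real_iff by blast
      then show ?thesis
        using S by (intro finite_sum_le_has_sum) auto
    qed
    then show "\<exists>N. \<forall>n\<ge>N. (\<Sum>p\<in>S. (cmod (l2_inner M (d n) (\<phi> p)))\<^sup>2) \<le> (l2_norm M (d n))\<^sup>2" by blast
  qed
qed

lemma l2_closure_Bessel2:
  assumes \<phi>: "\<And>p. L2 M (\<phi> p)"
    and D: "\<And>d. d \<in> D \<Longrightarrow> ((\<lambda>p. l2_inner M d (\<phi> p) * l2_inner M (\<phi> p) d) has_sum l2_inner M d d) UNIV"
    and f: "f \<in> l2_closure M D" and g: "g \<in> l2_closure M D" and S: "finite S"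
  shows "cmod (\<Sum>p\<in>S. l2_inner M f (\<phi> p) * l2_inner M (\<phi> p) g) \<le> l2_norm M f * l2_norm M g"
proof -
  have c: "cmod (l2_inner M (\<phi> p) g) = cmod (l2_inner M g (\<phi> p))" for p
    by (subst l2_inner_commute) simp
  have L: "L2_set (\<lambda>p. cmod (l2_inner M h (\<phi> p))) S \<le> l2_norm M h" if "h \<in> l2_closure M D" for h
    using l2_closure_Bessel[OF \<phi> D that S] by (simp add: L2_set_def real_le_lsqrt)
  have "cmod (\<Sum>p\<in>S. l2_inner M f (\<phi> p) * l2_inner M (\<phi> p) g)
    \<le> (\<Sum>p\<in>S. cmod (l2_inner M f (\<phi> p) * l2_inner M (\<phi> p) g))"
    by (rule norm_sum)
  also have "\<dots> = (\<Sum>p\<in>S. \<bar>cmod (l2_inner M f (\<phi> p))\<bar> * \<bar>cmod (l2_inner M g (\<phi> p))\<bar>)"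
    by (simp add: norm_mult c)
  also have "\<dots> \<le> L2_set (\<lambda>p. cmod (l2_inner M f (\<phi> p))) S * L2_set (\<lambda>p. cmod (l2_inner M g (\<phi> p))) S"
    by (rule L2_set_mult_ineq)
  also have "\<dots> \<le> l2_norm M f * l2_norm M g"
    using L[OF f] L[OF g] by (intro mult_mono) auto
  finally show ?thesis .
qed

text \<open>The finite partial sums are sesquilinear forms bounded by the product of the norms,
  uniformly in the finite index set (\<open>l2_closure_Bessel2\<close>). Replacing f and g by nearby
  members of D therefore costs an error that is independent of that set.\<close>

lemma l2_closure_expansion:
  assumes \<phi>: "\<And>p. L2 M (\<phi> p)"
    and lin: "linear_space D"
    and D: "\<And>d d'. d \<in> D \<Longrightarrow> d' \<in> D \<Longrightarrow> ((\<lambda>p. l2_inner M d (\<phi> p) * l2_inner M (\<phi> p) d') has_sum l2_inner M d d') UNIV"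
    and f: "f \<in> l2_closure M D" and g: "g \<in> l2_closure M D"
  shows "((\<lambda>p. l2_inner M f (\<phi> p) * l2_inner M (\<phi> p) g) has_sum l2_inner M f g) UNIV"
  unfolding has_sum_def tendsto_iff
proof (intro allI impI)
  fix e :: real assume e: "e > 0"
  define F where "F = l2_norm M f + 1"
  define G where "G = l2_norm M g + 1"
  have pos: "F > 0" "G > 0" by (simp_all add: F_def G_def add_nonneg_pos)
  \<comment> \<open>The cap 1 gives |d| \<le> F in norm. The other term makes each of the four
    replacement errors at most e/8; with the error e/4 of the expansion on D the total is below
    3e/4.\<close>
  define \<delta> where "\<delta> = min 1 (e / (8 * F * G))"
  have \<delta>: "\<delta> > 0" "\<delta> \<le> 1" using e pos by (auto simp: \<delta>_def)
  have "\<delta> * (F * G) \<le> e / (8 * F * G) * (F * G)"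
    using pos by (intro mult_right_mono) (auto simp: \<delta>_def)
  also have "\<dots> = e / 8" using pos by simp
  finally have \<delta>e: "\<delta> * (F * G) \<le> e / 8" .
  obtain d where d: "d \<in> D" "L2 M d" "l2_norm M (\<lambda>x. f x - d x) < \<delta>"
    using l2_closureD[OF f \<delta>(1)] by blast
  obtain d' where d': "d' \<in> D" "L2 M d'" "l2_norm M (\<lambda>x. g x - d' x) < \<delta>"
    using l2_closureD[OF g \<delta>(1)] by blast
  note L = l2_closure_L2[OF f] l2_closure_L2[OF g] d(2) d'(2)
  have dF: "l2_norm M d \<le> F"
    using l2_norm_le_add_diff[OF L(3,1)] d(3) \<delta>(2) by (simp add: F_def l2_norm_minus_commute[of M d f])
  have FG1: "F \<ge> 1" "G \<ge> 1" by (simp_all add: F_def G_def)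
  have fd: "(\<lambda>x. f x - d x) \<in> l2_closure M D"
    using l2_closure_add[OF lin f l2_closure_cmult[OF lin l2_closure_superset[OF d(1,2)]], of "-1"] by simp
  have gd: "(\<lambda>x. g x - d' x) \<in> l2_closure M D"
    using l2_closure_add[OF lin g l2_closure_cmult[OF lin l2_closure_superset[OF d'(1,2)]], of "-1"] by simp
  have dcl: "d \<in> l2_closure M D"
    by (rule l2_closure_superset[OF d(1,2)])
  have b1: "l2_norm M (\<lambda>x. f x - d x) * l2_norm M g \<le> e / 8"
  proof -
    have "l2_norm M (\<lambda>x. f x - d x) * l2_norm M g \<le> \<delta> * G"
      using d(3) \<delta> by (intro mult_mono) (auto simp: G_def)
    also have "\<dots> \<le> \<delta> * (F * G)" using FG1 \<delta> by (intro mult_left_mono) auto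
    finally show ?thesis using \<delta>e by simp
  qed
  have b2: "l2_norm M d * l2_norm M (\<lambda>x. g x - d' x) \<le> e / 8"
  proof -
    have "l2_norm M d * l2_norm M (\<lambda>x. g x - d' x) \<le> F * \<delta>"
      using d'(3) dF pos by (intro mult_mono) auto
    also have "\<dots> \<le> \<delta> * (F * G)" using FG1 \<delta> by (simp add: mult.commute mult.left_commute)
    finally show ?thesis using \<delta>e by simp
  qed
  have ev: "eventually (\<lambda>S. dist (\<Sum>p\<in>S. l2_inner M d (\<phi> p) * l2_inner M (\<phi> p) d') (l2_inner M d d') < e / 4) (finite_subsets_at_top UNIV)"
    using D[OF d(1) d'(1)] e unfolding has_sum_def by (intro tendstoD) auto
  have fin: "eventually finite (finite_subsets_at_top UNIV)"
    by (rule eventually_finite_subsets_at_top_weakI) auto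
  \<comment> \<open>First f is replaced by d against the original g, then g by d' against the new d;
    \<open>split2\<close> does the same for the inner product itself.\<close>
  have split: "l2_inner M f h * l2_inner M h g
    = l2_inner M (\<lambda>x. f x - d x) h * l2_inner M h g + l2_inner M d h * l2_inner M h (\<lambda>x. g x - d' x)
      + l2_inner M d h * l2_inner M h d'" if "L2 M h" for h
    using L that by (simp add: l2_inner_diff_left l2_inner_diff_right algebra_simps)
  have split2: "l2_inner M f g = l2_inner M (\<lambda>x. f x - d x) g + l2_inner M d (\<lambda>x. g x - d' x) + l2_inner M d d'"
    using L by (simp add: l2_inner_diff_left l2_inner_diff_right)
  have norm5: "cmod (u + v + w - x - y) \<le> cmod u + cmod v + cmod w + cmod x + cmod y" for u v w x y
    using norm_triangle_ineq4[of "u + v + w - x" y] norm_triangle_ineq4[of "u + v + w" x]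
      norm_triangle_ineq[of "u + v" w] norm_triangle_ineq[of u v] by linarith
  show "eventually (\<lambda>S. dist (\<Sum>p\<in>S. l2_inner M f (\<phi> p) * l2_inner M (\<phi> p) g) (l2_inner M f g) < e) (finite_subsets_at_top UNIV)"
    using ev fin
  proof eventually_elim
    case (elim S)
    define A where "A = (\<Sum>p\<in>S. l2_inner M (\<lambda>x. f x - d x) (\<phi> p) * l2_inner M (\<phi> p) g)"
    define B where "B = (\<Sum>p\<in>S. l2_inner M d (\<phi> p) * l2_inner M (\<phi> p) (\<lambda>x. g x - d' x))"
    define C where "C = (\<Sum>p\<in>S. l2_inner M d (\<phi> p) * l2_inner M (\<phi> p) d')"
    have s: "(\<Sum>p\<in>S. l2_inner M f (\<phi> p) * l2_inner M (\<phi> p) g) = A + B + C"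
      unfolding A_def B_def C_def by (simp add: split[OF \<phi>] sum.distrib)
    have A: "cmod A \<le> e / 8"
      using l2_closure_Bessel2[OF \<phi> D fd g elim(2)] b1 unfolding A_def by simp
    have B: "cmod B \<le> e / 8"
      using l2_closure_Bessel2[OF \<phi> D dcl gd elim(2)] b2 unfolding B_def by simp
    have A': "cmod (l2_inner M (\<lambda>x. f x - d x) g) \<le> e / 8"
      using l2_Cauchy_Schwarz[OF l2_closure_L2[OF fd] L(2)] b1 by simp
    have B': "cmod (l2_inner M d (\<lambda>x. g x - d' x)) \<le> e / 8"
      using l2_Cauchy_Schwarz[OF L(3) l2_closure_L2[OF gd]] b2 by simp
    have C: "cmod (C - l2_inner M d d') < e / 4"
      using elim(1) unfolding C_def dist_norm .
    have "(A + B + C) - l2_inner M f g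
      = A + B + (C - l2_inner M d d') - l2_inner M (\<lambda>x. f x - d x) g - l2_inner M d (\<lambda>x. g x - d' x)"
      unfolding split2 by simp
    also have "cmod \<dots> \<le> cmod A + cmod B + cmod (C - l2_inner M d d')
       + cmod (l2_inner M (\<lambda>x. f x - d x) g) + cmod (l2_inner M d (\<lambda>x. g x - d' x))"
      by (rule norm5)
    also have "\<dots> < e" using A B A' B' C e by linarith
    finally show ?case unfolding s dist_norm .
  qed
qed

section \<open>Fourier series\<close>

text \<open>Generated by closure rules instead of finite sums, so that (sesqui)linear claims reduce
  to generators by one induction per argument.\<close>

inductive_set linear_hull :: "('a \<Rightarrow> complex) set \<Rightarrow> ('a \<Rightarrow> complex) set" for B where
  zero: "(\<lambda>x. 0) \<in> linear_hull B"
| base: "b \<in> B \<Longrightarrow> b \<in> linear_hull B"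
| add: "f \<in> linear_hull B \<Longrightarrow> g \<in> linear_hull B \<Longrightarrow> (\<lambda>x. f x + g x) \<in> linear_hull B"
| cmult: "f \<in> linear_hull B \<Longrightarrow> (\<lambda>x. c * f x) \<in> linear_hull B"

lemma linear_space_linear_hull: "linear_space (linear_hull B)"
  by (auto simp: linear_space_def intro: linear_hull.intros)

lemma linear_hull_L2: "f \<in> linear_hull B \<Longrightarrow> (\<And>b. b \<in> B \<Longrightarrow> L2 M b) \<Longrightarrow> L2 M f"
  by (induction rule: linear_hull.induct) (simp_all add: L2_add L2_cmult)

text \<open>Makes the hull of the Fourier modes an algebra, which the product case for polynomials
  on the circle relies on.\<close>

lemma linear_hull_mult:
  assumes "\<And>b b'. b \<in> B \<Longrightarrow> b' \<in> B \<Longrightarrow> (\<lambda>x. b x * b' x) \<in> linear_hull B"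
    and "f \<in> linear_hull B" "g \<in> linear_hull B"
  shows "(\<lambda>x. f x * g x) \<in> linear_hull B"
  using assms(2)
proof induction
  case (base b)
  show ?case
    using assms(3)
  proof induction
    case (base b') then show ?case using assms(1) \<open>b \<in> B\<close> by blast
  next
    case (add f g) then show ?case by (simp add: distrib_left linear_hull.add)
  next
    case (cmult f c)
    then show ?case using linear_hull.cmult[OF cmult.IH, of c] by (simp add: mult.left_commute)
  qed (simp add: linear_hull.zero)
next
  case (add f g) then show ?case by (simp add: distrib_right linear_hull.add)
next
  case (cmult f c)
  then show ?case using linear_hull.cmult[OF cmult.IH, of c] by (simp add: mult.assoc)
qed (simp add: linear_hull.zero)

text \<open>Both sides are sesquilinear and has-sum statements add and scale, so generators suffice
  before passing to the closure. It serves twice: with the Fourier modes, where orthonormality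
  settles the generators, and with tensor products, where the pointwise identity does.\<close>

lemma linear_hull_expansion:
  assumes \<phi>: "\<And>p. L2 M (\<phi> p)" and B: "\<And>b. b \<in> B \<Longrightarrow> L2 M b"
    and exp: "\<And>b b'. b \<in> B \<Longrightarrow> b' \<in> B \<Longrightarrow>
      ((\<lambda>p. l2_inner M b (\<phi> p) * l2_inner M (\<phi> p) b') has_sum l2_inner M b b') UNIV"
    and f: "f \<in> l2_closure M (linear_hull B)" and g: "g \<in> l2_closure M (linear_hull B)"
  shows "((\<lambda>p. l2_inner M f (\<phi> p) * l2_inner M (\<phi> p) g) has_sum l2_inner M f g) UNIV"
proof (rule l2_closure_expansion[OF \<phi> linear_space_linear_hull _ f g])
  have gen: "((\<lambda>p. l2_inner M b (\<phi> p) * l2_inner M (\<phi> p) h) has_sum l2_inner M b h) UNIV"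
    if "b \<in> B" "h \<in> linear_hull B" for b h
    using that(2)
  proof induction
    case zero
    have "l2_inner M h (\<lambda>x. 0) = 0" for h by (simp add: l2_inner_def)
    then show ?case by simp
  next
    case (base b') then show ?case by (rule exp[OF that(1)])
  next
    case (add f g)
    note L = linear_hull_L2[OF add.hyps(1) B] linear_hull_L2[OF add.hyps(2) B]
    show ?case
      using has_sum_add[OF add.IH] by (simp add: l2_inner_add_right L \<phi> B[OF that(1)] distrib_left)
  next
    case (cmult f c)
    show ?case
      using has_sum_cmult_right[OF cmult.IH, of "cnj c"] by (simp add: l2_inner_cmult_right mult.left_commute)
  qed
  fix d h assume "d \<in> linear_hull B" and h: "h \<in> linear_hull B"
  then show "((\<lambda>p. l2_inner M d (\<phi> p) * l2_inner M (\<phi> p) h) has_sum l2_inner M d h) UNIV"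
  proof induction
    case zero
    have "l2_inner M (\<lambda>x. 0) h = 0" for h by (simp add: l2_inner_def)
    then show ?case by simp
  next
    case (base b) then show ?case using gen h by blast
  next
    case (add f g)
    note L = linear_hull_L2[OF add.hyps(1) B] linear_hull_L2[OF add.hyps(2) B]
    show ?case
      using has_sum_add[OF add.IH[OF h]] by (simp add: l2_inner_add_left L \<phi> linear_hull_L2[OF h B] distrib_right)
  next
    case (cmult f c)
    show ?case
      using has_sum_cmult_right[OF cmult.IH[OF h], of c] by (simp add: l2_inner_cmult_left mult.assoc)
  qed
qed

text \<open>The characters of the circle are cut off to the open unit interval so that they live in
  L2 of the line; as the indicator is idempotent, products of modes are again modes. The sign is
  chosen so that the inner product against mode m integrates against e^{2 pi i m t}, the factor that
  a shift by m produces in \<open>fourier_pair_affine\<close>.\<close>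

definition fourier_mode :: "int \<Rightarrow> real \<Rightarrow> complex" where
  "fourier_mode m t = indicator {-1/2<..<1/2} t * cis (- 2 * pi * m * t)"

lemma borel_measurable_cis [measurable]: "cis \<in> borel_measurable borel"
  by (intro borel_measurable_continuous_onI continuous_intros)

lemma fourier_mode_measurable [measurable]: "fourier_mode m \<in> borel_measurable borel"
  unfolding fourier_mode_def[abs_def] by measurable

lemma fourier_mode_mult: "fourier_mode m t * fourier_mode n t = fourier_mode (m + n) t"
  by (auto simp: fourier_mode_def indicator_def cis_mult algebra_simps)

lemma L2_fourier_mode: "L2 lborel (fourier_mode m)"
  unfolding fourier_mode_def[abs_def]
  by (subst mult.commute) (rule L2_bounded_mult[where B=1], auto intro!: L2_indicator)

lemma integral_cis:
  fixes k :: int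
  shows "(\<integral>t. indicator {-1/2<..<1/2} t * cis (2 * pi * k * t) \<partial>lborel) = (if k = 0 then 1 else 0)"
proof (cases "k = 0")
  case True
  have "(\<integral>t. indicator {-1/2<..<1/2} t * cis (2 * pi * k * t) \<partial>lborel)
      = (\<integral>t. complex_of_real (indicator {-1/2<..<1/2::real} t) \<partial>lborel)"
    using True by (intro Bochner_Integration.integral_cong) (auto simp: indicator_def)
  also have "\<dots> = complex_of_real (\<integral>t. indicator {-1/2<..<1/2::real} t \<partial>lborel)"
    by (rule integral_complex_of_real)
  also have "\<dots> = 1" by (subst Bochner_Integration.integral_indicator) simp_all
  finally show ?thesis using True by simp
next
  case False
  define F where "F t = cis (2 * pi * k * t) / (2 * pi * k * \<i>)" for t
  have "(\<integral>t. indicator {-1/2<..<1/2} t * cis (2 * pi * k * t) \<partial>lborel)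
    = (\<integral>t. indicator {-1/2..1/2} t *\<^sub>R cis (2 * pi * k * t) \<partial>lborel)"
  proof (rule integral_cong_AE)
    have "AE t in lborel. t \<noteq> (-1/2::real)" "AE t in lborel. t \<noteq> (1/2::real)"
      by (rule AE_lborel_singleton)+
    then show "AE t in lborel. indicator {-1/2<..<1/2} t * cis (2 * pi * k * t) = indicator {-1/2..1/2} t *\<^sub>R cis (2 * pi * k * t)"
      by eventually_elim (auto simp: indicator_def)
  qed measurable
  also have "\<dots> = F (1/2) - F (-1/2)"
  proof (rule integral_FTC_Icc)
    fix x :: real
    show "(F has_vector_derivative cis (2 * pi * k * x)) (at x within {-1/2..1/2})"
      unfolding F_def using False
      by (auto intro!: derivative_eq_intros simp: has_vector_derivative_def field_simps scaleR_conv_of_real)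
  qed (auto intro!: continuous_intros)
  also have "\<dots> = 0"
  proof -
    have "sin (pi * real_of_int k) = 0" by (rule sin_npi_int)
    then have "cis (pi * k) = cis (- (pi * k))" by (simp add: complex_eq_iff)
    moreover have "2 * pi * real_of_int k * (1/2) = pi * k" "2 * pi * real_of_int k * (-1/2) = - (pi * k)" by simp_all
    ultimately show ?thesis unfolding F_def by simp
  qed
  finally show ?thesis using False by simp
qed

lemma l2_inner_fourier_mode: "l2_inner lborel (fourier_mode m) (fourier_mode n) = (if m = n then 1 else 0)"
proof -
  have "fourier_mode m t * cnj (fourier_mode n t) = indicator {-1/2<..<1/2} t * cis (2 * pi * (n - m) * t)" for t
    by (auto simp: fourier_mode_def indicator_def cis_cnj cis_mult algebra_simps)
  then show ?thesis
    using integral_cis[of "n - m"] by (simp add: l2_inner_def)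
qed


section \<open>Completeness of the Fourier modes\<close>

lemma cis_circle_inj:
  assumes "cis (2 * pi * t) = cis (2 * pi * s)" "\<bar>t\<bar> < 1/2" "\<bar>s\<bar> \<le> 1/2"
  shows "t = s"
proof -
  obtain n :: int where "\<i> * complex_of_real (2 * pi * t) = \<i> * complex_of_real (2 * pi * s) + (of_int (2 * n) * pi) * \<i>"
    using assms(1) unfolding cis_conv_exp exp_eq by blast
  then have "Im (\<i> * complex_of_real (2 * pi * t)) = Im (\<i> * complex_of_real (2 * pi * s) + (of_int (2 * n) * pi) * \<i>)"
    by (rule arg_cong)
  then have "2 * pi * t = 2 * pi * s + 2 * of_int n * pi" by simp
  then have "pi * t = pi * (s + of_int n)" by (simp add: algebra_simps)
  then have ts: "t = s + of_int n" by simp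
  \<comment> \<open>One strict bound is enough for |t - s| < 1. The point s may be an endpoint,
    which is what the compact set in \<open>box_mem_l2_closure_fourier_mode\<close> asks
    for.\<close>
  then have "\<bar>real_of_int n\<bar> < 1" using assms(2,3) by linarith
  then have "n = 0" by linarith
  then show ?thesis using ts by simp
qed

text \<open>On the unit circle Re z and Im z are combinations of z and its conjugate, that is, of
  two modes, and the modes are closed under products. This connects Stone-Weierstrass on the circle
  to trigonometric polynomials.\<close>

lemma real_polynomial_function_trigonometric:
  assumes "real_polynomial_function p"
  shows "(\<lambda>t. indicator {-1/2<..<1/2} t * complex_of_real (p (cis (2 * pi * t)))) \<in> linear_hull (range fourier_mode)"
  using assms
proof induction
  case (linear f)
  have f: "f z = Re z * f 1 + Im z * f \<i>" for z
  proof -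
    have "f z = f (Re z *\<^sub>R 1 + Im z *\<^sub>R \<i>)"
      by (rule arg_cong[where f=f]) (simp add: complex_eq_iff)
    also have "\<dots> = Re z * f 1 + Im z * f \<i>"
      by (simp only: bounded_linear.axioms(1)[OF linear, THEN linear_add] bounded_linear.axioms(1)[OF linear, THEN linear_scale] real_scaleR_def)
    finally show ?thesis .
  qed
  \<comment> \<open>With z = \<open>cis (2 * pi * t)\<close>, mode -1 is z and mode 1 its conjugate;
    the coefficients come from Re z = (z + cnj z)/2 and Im z = (z - cnj z)/(2i).\<close>
  have "indicator {-1/2<..<1/2} t * complex_of_real (f (cis (2 * pi * t)))
    = ((f 1 + \<i> * f \<i>) / 2) * fourier_mode 1 t + ((f 1 - \<i> * f \<i>) / 2) * fourier_mode (-1) t" for t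
    unfolding f[of "cis _"] fourier_mode_def by (auto simp: indicator_def complex_eq_iff algebra_simps add_divide_distrib diff_divide_distrib)
  then show ?case
    by (simp only:) (intro linear_hull.add linear_hull.cmult linear_hull.base rangeI)
next
  case (const c)
  have "indicator {-1/2<..<1/2} t * complex_of_real c = complex_of_real c * fourier_mode 0 t" for t
    by (simp add: fourier_mode_def)
  then show ?case by (simp only:) (intro linear_hull.cmult linear_hull.base rangeI)
next
  case (add f g)
  show ?case using linear_hull.add[OF add(3,4)] by (simp add: distrib_left)
next
  case (mult f g)
  have eq: "indicator {-1/2<..<1/2} t * complex_of_real (f (cis (2 * pi * t)) * g (cis (2 * pi * t)))
    = (indicator {-1/2<..<1/2} t * complex_of_real (f (cis (2 * pi * t)))) * (indicator {-1/2<..<1/2} t * complex_of_real (g (cis (2 * pi * t))))" for t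
    by (simp add: indicator_def)
  show ?case
    unfolding eq
    by (rule linear_hull_mult[OF _ mult(3,4)]) (auto simp: fourier_mode_mult intro!: linear_hull.base)
qed

text \<open>Uniform approximation on the circle by Stone-Weierstrass is also L2 approximation,
  because the interval has length 1. Starting from a function on the circle builds the periodicity
  at the endpoints in.\<close>

lemma continuous_circle_mem_l2_closure:
  fixes u :: "complex \<Rightarrow> real"
  assumes "continuous_on UNIV u"
  shows "(\<lambda>t. indicator {-1/2<..<1/2} t * complex_of_real (u (cis (2 * pi * t)))) \<in> l2_closure lborel (linear_hull (range fourier_mode))"
proof -
  let ?I = "{-1/2<..<1/2::real}"
  have mu [measurable]: "u \<in> borel_measurable borel"
    using assms by (rule borel_measurable_continuous_onI)
  have bounded_L2: "L2 lborel (\<lambda>t. indicator ?I t * complex_of_real (v (cis (2 * pi * t))))"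
      "l2_norm lborel (\<lambda>t. indicator ?I t * complex_of_real (v (cis (2 * pi * t)))) \<le> B"
    if [measurable]: "v \<in> borel_measurable borel" and v: "\<And>z. norm z = 1 \<Longrightarrow> \<bar>v z\<bar> \<le> B" and B: "B \<ge> 0" for v B
  proof -
    show L: "L2 lborel (\<lambda>t. indicator ?I t * complex_of_real (v (cis (2 * pi * t))))"
      by (subst mult.commute, rule L2_bounded_mult[where B=B]) (auto intro!: L2_indicator v)
    have "(\<integral>t. (cmod (indicator ?I t * complex_of_real (v (cis (2 * pi * t)))))\<^sup>2 \<partial>lborel) \<le> (\<integral>t. B\<^sup>2 * indicator ?I t \<partial>lborel)"
    proof (rule integral_mono[OF L2_integrable[OF L]])
      show "(cmod (indicator ?I t * complex_of_real (v (cis (2 * pi * t)))))\<^sup>2 \<le> B\<^sup>2 * indicator ?I t" for t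
        using power_mono[OF v, of "cis (2 * pi * t)" 2] by (auto simp: indicator_def)
    qed simp
    also have "\<dots> = B\<^sup>2" by (simp del: indicator_simps)
    finally show "l2_norm lborel (\<lambda>t. indicator ?I t * complex_of_real (v (cis (2 * pi * t)))) \<le> B"
      unfolding l2_norm_def using B by (intro real_le_lsqrt) auto
  qed
  have "compact (u ` sphere 0 1)"
    by (intro compact_continuous_image continuous_on_subset[OF assms]) auto
  then obtain B where B: "\<And>z. norm z = 1 \<Longrightarrow> \<bar>u z\<bar> \<le> B" "B \<ge> 0"
    using compact_imp_bounded bounded_pos by (metis image_eqI less_imp_le mem_sphere_0 real_norm_def)
  show ?thesis
    unfolding l2_closure_def
  proof (safe intro!: bounded_L2(1)[OF mu B])
    fix e :: real assume e: "e > 0"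
    obtain p where p: "real_polynomial_function p" "\<And>z. z \<in> sphere 0 1 \<Longrightarrow> \<bar>u z - p z\<bar> < e / 2"
      using Stone_Weierstrass_real_polynomial_function[of "sphere 0 1" u "e / 2"] continuous_on_subset[OF assms] e by auto
    have pc: "continuous_on UNIV p"
      using p(1) by (simp add: continuous_on_polymonial_function real_polynomial_function_eq)
    have mp [measurable]: "p \<in> borel_measurable borel"
      using pc by (rule borel_measurable_continuous_onI)
    have "l2_norm lborel (\<lambda>t. indicator ?I t * complex_of_real ((\<lambda>z. u z - p z) (cis (2 * pi * t)))) \<le> e / 2"
      using p(2) e by (intro bounded_L2(2)) (auto intro: less_imp_le)
    also have "\<dots> < e" using e by simp
    finally have "l2_norm lborel (\<lambda>t. indicator ?I t * complex_of_real (u (cis (2 * pi * t))) - indicator ?I t * complex_of_real (p (cis (2 * pi * t)))) < e"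
      by (simp add: algebra_simps)
    moreover have "L2 lborel f" if "f \<in> linear_hull (range fourier_mode)" for f
      using linear_hull_L2[OF that, of lborel] L2_fourier_mode by auto
    ultimately show "\<exists>d\<in>linear_hull (range fourier_mode). L2 lborel d \<and>
       l2_norm lborel (\<lambda>t. indicator ?I t * complex_of_real (u (cis (2 * pi * t))) - d t) < e"
      using real_polynomial_function_trigonometric[OF p(1)] by blast
  qed
qed

text \<open>The part of the interval outside the box is wrapped onto a compact subset K of the
  circle. The continuous functions min(1, j dist(z, K)) vanish on K and become 1 at every other
  point, so they converge to the indicator with values in [0, 1].\<close>

lemma box_mem_l2_closure_fourier_mode:
  "indicator (box a b \<inter> {-1/2<..<1/2}) \<in> l2_closure lborel (linear_hull (range fourier_mode))"
proof -
  let ?I = "{-1/2<..<1/2::real}"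
  \<comment> \<open>The closed interval makes A, and hence K, compact. Both endpoints are wrapped to
    -1, possibly placing in K the image of an endpoint that lies in the box; this is harmless, as
    membership in K is only tested at interior points t.\<close>
  define A where "A = {-1/2..1/2} - box a b"
  define K where "K = (\<lambda>t. cis (2 * pi * t)) ` A"
  have "compact A"
    unfolding A_def by (intro compact_diff) (auto intro: open_box)
  then have K: "compact K"
    unfolding K_def by (intro compact_continuous_image continuous_intros)
  show ?thesis
  \<comment> \<open>An empty A is treated separately because \<open>infdist z {} = 0\<close>, so the
    approximating functions would be 0 instead of 1; the indicator is then mode 0.\<close>
  proof (cases "A = {}")
    case True
    then have "x \<in> box a b" if "x \<in> {-1/2..1/2}" for x
      using that unfolding A_def by blast
    then have I: "box a b \<inter> ?I = ?I" by force
    have "fourier_mode 0 = indicator (box a b \<inter> ?I)"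
      unfolding I by (simp add: fourier_mode_def[abs_def] fun_eq_iff)
    moreover have "fourier_mode 0 \<in> l2_closure lborel (linear_hull (range fourier_mode))"
      by (intro l2_closure_superset linear_hull.base L2_fourier_mode rangeI)
    ultimately show ?thesis by simp
  next
    case False
    then have K0: "K \<noteq> {}" by (simp add: K_def)
    have inK: "cis (2 * pi * t) \<in> K \<longleftrightarrow> t \<notin> box a b" if "t \<in> ?I" for t
    proof
      assume "cis (2 * pi * t) \<in> K"
      then obtain s where s: "s \<in> A" "cis (2 * pi * t) = cis (2 * pi * s)" by (auto simp: K_def)
      have "\<bar>t\<bar> < 1/2"
        using that unfolding greaterThanLessThan_iff abs_less_iff by linarith
      moreover have "\<bar>s\<bar> \<le> 1/2"
        using s(1) unfolding A_def Diff_iff atLeastAtMost_iff abs_le_iff by linarith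
      ultimately have "t = s" by (rule cis_circle_inj[OF s(2)])
      then show "t \<notin> box a b" using s by (simp add: A_def)
    next
      assume "t \<notin> box a b"
      then have "t \<in> A" using that by (simp add: A_def del: box_real)
      then show "cis (2 * pi * t) \<in> K" unfolding K_def by (rule imageI)
    qed
    define u where "u j z = min 1 (real j * infdist z K)" for j z
    have cu: "continuous_on UNIV (u j)" for j
      unfolding u_def by (intro continuous_intros)
    have u01: "0 \<le> u j z" "u j z \<le> 1" for j z
      by (auto simp: u_def infdist_nonneg)
    have ucl: "(\<lambda>t. indicator ?I t * complex_of_real (u j (cis (2 * pi * t)))) \<in> l2_closure lborel (linear_hull (range fourier_mode))" for j
      by (rule continuous_circle_mem_l2_closure[OF cu])
    have conv: "(\<lambda>j. indicator ?I t * complex_of_real (u j (cis (2 * pi * t)))) \<longlonglongrightarrow> indicator (box a b \<inter> ?I) t" for t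
    proof (cases "t \<in> ?I")
      case t: True
      show ?thesis
      proof (cases "t \<in> box a b")
        case True
        then have pos: "infdist (cis (2 * pi * t)) K > 0"
          using inK[OF t] K0 compact_imp_closed[OF K] by (intro infdist_pos_not_in_closed) auto
        obtain N :: nat where N: "1 < real N * infdist (cis (2 * pi * t)) K"
          using reals_Archimedean3[OF pos] by blast
        have "u j (cis (2 * pi * t)) = 1" if "j \<ge> N" for j
        proof -
          have "real N * infdist (cis (2 * pi * t)) K \<le> real j * infdist (cis (2 * pi * t)) K"
            using that pos by (intro mult_right_mono) auto
          then show ?thesis using N by (simp add: u_def)
        qed
        then show ?thesis
          using True t by (intro tendsto_eventually eventually_sequentiallyI[of N]) auto
      next
        case False
        then have "indicator (box a b \<inter> ?I) t = (0::complex)" by (intro indicator_simps) blast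
        moreover have "u j (cis (2 * pi * t)) = 0" for j
          using False inK[OF t] by (simp add: u_def del: box_real)
        ultimately show ?thesis by (simp only:) simp
      qed
    qed simp
    have m: "indicator (box a b \<inter> ?I) \<in> borel_measurable lborel" by simp
    show ?thesis
    proof (rule l2_closure_limit[where f="\<lambda>j t. indicator ?I t * complex_of_real (u j (cis (2 * pi * t)))", OF ucl])
      show "L2 lborel (indicator (box a b \<inter> ?I))"
        by (intro L2_indicator emeasure_bounded_finite bounded_Int) auto
      show "(\<lambda>n. l2_norm lborel (\<lambda>t. indicator ?I t * complex_of_real (u n (cis (2 * pi * t))) - indicator (box a b \<inter> ?I) t)) \<longlonglongrightarrow> 0"
      proof (rule tendsto_l2_norm_dominated[where w="indicator ?I" and f="\<lambda>j t. indicator ?I t * complex_of_real (u j (cis (2 * pi * t)))"])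
        show "(\<lambda>t. indicator ?I t * complex_of_real (u n (cis (2 * pi * t)))) \<in> borel_measurable lborel" for n
          using L2_measurable[OF l2_closure_L2[OF ucl]] .
        show "(cmod (indicator ?I t * complex_of_real (u n (cis (2 * pi * t))) - indicator (box a b \<inter> ?I) t))\<^sup>2 \<le> indicator ?I t" for n t
        proof -
          have "cmod (complex_of_real x - 1) \<le> 1" if "0 \<le> x" "x \<le> 1" for x
          proof -
            have eq: "complex_of_real x - 1 = complex_of_real (x - 1)" by simp
            show ?thesis unfolding eq norm_of_real using that by simp
          qed
          then show ?thesis
            using u01[of n "cis (2 * pi * t)"] by (auto simp: indicator_def power_le_one)
        qed
        show "AE t in lborel. (\<lambda>n. indicator ?I t * complex_of_real (u n (cis (2 * pi * t)))) \<longlonglongrightarrow> indicator (box a b \<inter> ?I) t"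
          by (rule AE_I2) (rule conv)
        show "indicator (box a b \<inter> ?I) \<in> borel_measurable lborel" by (rule m)
        show "integrable lborel (indicat_real ?I)" by simp
      qed
    qed
  qed
qed

lemma fourier_series_Parseval:
  assumes "L2 lborel f" "L2 lborel g" "\<And>t. t \<notin> {-1/2<..<1/2} \<Longrightarrow> f t = 0" "\<And>t. t \<notin> {-1/2<..<1/2} \<Longrightarrow> g t = 0"
  shows "((\<lambda>m. l2_inner lborel f (fourier_mode m) * l2_inner lborel (fourier_mode m) g) has_sum l2_inner lborel f g) UNIV"
proof (rule linear_hull_expansion[OF L2_fourier_mode])
  have cl: "f \<in> l2_closure lborel (linear_hull (range fourier_mode))"
    if "L2 lborel f" "\<And>t. t \<notin> {-1/2<..<1/2} \<Longrightarrow> f t = 0" for f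
    by (rule mem_l2_closure_vanishing_outside[OF linear_space_linear_hull _ _ box_mem_l2_closure_fourier_mode that]) auto
  show "f \<in> l2_closure lborel (linear_hull (range fourier_mode))" "g \<in> l2_closure lborel (linear_hull (range fourier_mode))"
    using assms by (intro cl; blast)+
  show "L2 lborel b" if "b \<in> range fourier_mode" for b
    using that L2_fourier_mode by auto
  fix b b' assume "b \<in> range fourier_mode" "b' \<in> range fourier_mode"
  then obtain m n where mn: "b = fourier_mode m" "b' = fourier_mode n" by auto
  show "((\<lambda>p. l2_inner lborel b (fourier_mode p) * l2_inner lborel (fourier_mode p) b') has_sum l2_inner lborel b b') UNIV"
    unfolding mn by (rule has_sum_finite_neutralI[of "{m}"]) (auto simp: l2_inner_fourier_mode)
qed

section \<open>Fourier pairs and Gaussian smoothing\<close>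

text \<open>A pair of integrable functions that are pointwise Fourier transforms of each other; this
  forces both to be bounded and hence square-integrable.\<close>

definition fourier_pair :: "(real \<Rightarrow> complex) \<Rightarrow> (real \<Rightarrow> complex) \<Rightarrow> bool" where
  "fourier_pair a A \<longleftrightarrow> integrable lborel a \<and> integrable lborel A \<and>
     (\<forall>x. a x = (\<integral>\<xi>. A \<xi> * cis (2 * pi * x * \<xi>) \<partial>lborel)) \<and>
     (\<forall>\<xi>. A \<xi> = (\<integral>x. a x * cis (- 2 * pi * x * \<xi>) \<partial>lborel))"

lemma fourier_pairD:
  assumes "fourier_pair a A"
  shows "a x = (\<integral>\<xi>. A \<xi> * cis (2 * pi * x * \<xi>) \<partial>lborel)"
    and "A \<xi> = (\<integral>x. a x * cis (- 2 * pi * x * \<xi>) \<partial>lborel)"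
  using assms unfolding fourier_pair_def by blast+

lemma integrable_mult_cis:
  assumes "integrable lborel f" "g \<in> borel_measurable borel"
  shows "integrable lborel (\<lambda>x. f x * cis (g x))"
proof (rule Bochner_Integration.integrable_bound[OF assms(1)])
  note [measurable] = assms(2) borel_measurable_integrable[OF assms(1)]
  show "(\<lambda>x. f x * cis (g x)) \<in> borel_measurable lborel" by measurable
qed (simp add: norm_mult)

lemma L2_integrable_bounded:
  assumes "integrable M f" "\<And>x. cmod (f x) \<le> B"
  shows "L2 M f"
proof -
  note [measurable] = borel_measurable_integrable[OF assms(1)]
  have "integrable M (\<lambda>x. (cmod (f x))\<^sup>2)"
  proof (rule Bochner_Integration.integrable_bound)
    show "integrable M (\<lambda>x. B * cmod (f x))"
      using assms(1) by simp
    have "(cmod (f x))\<^sup>2 \<le> B * cmod (f x)" for x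
      using assms(2)[of x] unfolding power2_eq_square by (rule mult_right_mono) simp
    then show "AE x in M. norm ((cmod (f x))\<^sup>2) \<le> norm (B * cmod (f x))"
      by (intro AE_I2) (simp add: order_trans[OF _ abs_ge_self])
  qed measurable
  then show ?thesis by (simp add: L2_def)
qed

lemma fourier_pair_integrable:
  "fourier_pair a A \<Longrightarrow> integrable lborel a" "fourier_pair a A \<Longrightarrow> integrable lborel A"
  by (simp_all add: fourier_pair_def)

lemma fourier_pair_bounded:
  assumes "fourier_pair a A"
  shows "cmod (a x) \<le> (\<integral>\<xi>. cmod (A \<xi>) \<partial>lborel)" "cmod (A \<xi>) \<le> (\<integral>x. cmod (a x) \<partial>lborel)"
proof -
  have "cmod (a x) = cmod (\<integral>\<xi>. A \<xi> * cis (2 * pi * x * \<xi>) \<partial>lborel)"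
    by (rule arg_cong[OF fourier_pairD(1)[OF assms]])
  also have "\<dots> \<le> (\<integral>\<xi>. cmod (A \<xi> * cis (2 * pi * x * \<xi>)) \<partial>lborel)"
    by (rule integral_norm_bound)
  finally show "cmod (a x) \<le> (\<integral>\<xi>. cmod (A \<xi>) \<partial>lborel)" by (simp add: norm_mult)
  have "cmod (A \<xi>) = cmod (\<integral>x. a x * cis (- 2 * pi * x * \<xi>) \<partial>lborel)"
    by (rule arg_cong[OF fourier_pairD(2)[OF assms]])
  also have "\<dots> \<le> (\<integral>x. cmod (a x * cis (- 2 * pi * x * \<xi>)) \<partial>lborel)"
    by (rule integral_norm_bound)
  finally show "cmod (A \<xi>) \<le> (\<integral>x. cmod (a x) \<partial>lborel)" by (simp add: norm_mult)
qed

lemma fourier_pair_L2: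
  assumes "fourier_pair a A"
  shows "L2 lborel a" "L2 lborel A"
  using L2_integrable_bounded[OF fourier_pair_integrable(1)[OF assms] fourier_pair_bounded(1)[OF assms]]
    L2_integrable_bounded[OF fourier_pair_integrable(2)[OF assms] fourier_pair_bounded(2)[OF assms]] .

lemma fourier_pair_measurable:
  assumes "fourier_pair a A"
  shows "a \<in> borel_measurable borel" "A \<in> borel_measurable borel"
  using fourier_pair_integrable[OF assms, THEN borel_measurable_integrable] by simp_all

section \<open>Closure properties of Fourier pairs\<close>

lemma lborel_integral_scale:
  fixes f :: "real \<Rightarrow> complex"
  assumes "s > 0"
  shows "(\<integral>x. f (s * (x + t)) \<partial>lborel) = complex_of_real (1 / s) * (\<integral>x. f x \<partial>lborel)"
  using lborel_integral_real_affine[of s f "s * t"] assms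
  by (simp add: distrib_left add.commute scaleR_conv_of_real)

lemma fourier_pair_zero: "fourier_pair (\<lambda>x. 0) (\<lambda>x. 0)"
  by (simp add: fourier_pair_def)

lemma fourier_pair_add:
  assumes "fourier_pair a A" "fourier_pair b B"
  shows "fourier_pair (\<lambda>x. a x + b x) (\<lambda>x. A x + B x)"
  unfolding fourier_pair_def
proof (intro conjI allI)
  show "a x + b x = (\<integral>\<xi>. (A \<xi> + B \<xi>) * cis (2 * pi * x * \<xi>) \<partial>lborel)" for x
    unfolding distrib_right fourier_pairD(1)[OF assms(1), of x] fourier_pairD(1)[OF assms(2), of x]
    by (intro Bochner_Integration.integral_add[symmetric] integrable_mult_cis fourier_pair_integrable[OF assms(1)] fourier_pair_integrable[OF assms(2)]) auto
  show "A \<xi> + B \<xi> = (\<integral>x. (a x + b x) * cis (- 2 * pi * x * \<xi>) \<partial>lborel)" for \<xi>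
    unfolding distrib_right fourier_pairD(2)[OF assms(1), of \<xi>] fourier_pairD(2)[OF assms(2), of \<xi>]
    by (intro Bochner_Integration.integral_add[symmetric] integrable_mult_cis fourier_pair_integrable[OF assms(1)] fourier_pair_integrable[OF assms(2)]) auto
qed (intro Bochner_Integration.integrable_add fourier_pair_integrable[OF assms(1)] fourier_pair_integrable[OF assms(2)])+

lemma fourier_pair_cmult:
  assumes "fourier_pair a A"
  shows "fourier_pair (\<lambda>x. c * a x) (\<lambda>x. c * A x)"
  unfolding fourier_pair_def
proof (intro conjI allI)
  show "c * a x = (\<integral>\<xi>. c * A \<xi> * cis (2 * pi * x * \<xi>) \<partial>lborel)" for x
    unfolding mult.assoc[of c] integral_mult_right_zero using fourier_pairD(1)[OF assms, of x] by (simp only:)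
  show "c * A \<xi> = (\<integral>x. c * a x * cis (- 2 * pi * x * \<xi>) \<partial>lborel)" for \<xi>
    unfolding mult.assoc[of c] integral_mult_right_zero using fourier_pairD(2)[OF assms, of \<xi>] by (simp only:)
qed (intro integrable_mult_right fourier_pair_integrable[OF assms])+

text \<open>Inversion is built into the notion of pair, which makes it symmetric up to a reflection.
  Consequently each member of \<open>fourier_image\<close> is also the transform of something, and
  one density theorem serves both the space side and the frequency side.\<close>

lemma fourier_pair_swap:
  assumes "fourier_pair a A"
  shows "fourier_pair (\<lambda>x. A (- x)) a"
  unfolding fourier_pair_def
proof (intro conjI allI)
  have A: "A \<xi> = (\<integral>x. a x * cis (- 2 * pi * x * \<xi>) \<partial>lborel)" and a: "a x = (\<integral>\<xi>. A \<xi> * cis (2 * pi * x * \<xi>) \<partial>lborel)" for x \<xi>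
    using fourier_pairD[OF assms] by blast+
  show "integrable lborel (\<lambda>x. A (- x))"
    using lborel_integrable_real_affine[OF fourier_pair_integrable(2)[OF assms], of "-1" 0] by simp
  show "integrable lborel a" by (rule fourier_pair_integrable(1)[OF assms])
  show "A (- x) = (\<integral>\<xi>. a \<xi> * cis (2 * pi * x * \<xi>) \<partial>lborel)" for x
    unfolding A by (simp add: mult.assoc mult.commute[of x])
  show "a \<xi> = (\<integral>x. A (- x) * cis (- 2 * pi * x * \<xi>) \<partial>lborel)" for \<xi>
    unfolding a[of \<xi>] by (subst lborel_integral_real_affine[of "-1" _ 0]) (simp_all add: mult.assoc mult.commute[of \<xi>])
qed

text \<open>Writing the argument as \<open>s * (x + t)\<close> keeps the phase free of s: for t = m
  it is the same character at every scale, which is why one Fourier series on the unit interval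
  handles all k.\<close>

lemma fourier_pair_affine:
  assumes "fourier_pair a A" "s > 0"
  shows "fourier_pair (\<lambda>x. a (s * (x + t))) (\<lambda>\<xi>. complex_of_real (1 / s) * A (\<xi> / s) * cis (2 * pi * t * \<xi>))"
  unfolding fourier_pair_def
proof (intro conjI allI)
  have A: "A \<xi> = (\<integral>x. a x * cis (- 2 * pi * x * \<xi>) \<partial>lborel)" and a: "a x = (\<integral>\<xi>. A \<xi> * cis (2 * pi * x * \<xi>) \<partial>lborel)" for x \<xi>
    using fourier_pairD[OF assms(1)] by blast+
  show "integrable lborel (\<lambda>x. a (s * (x + t)))"
    using lborel_integrable_real_affine[OF fourier_pair_integrable(1)[OF assms(1)], of s "s * t"] assms(2)
    by (simp add: distrib_left add.commute)
  have "integrable lborel (\<lambda>\<xi>. A (\<xi> / s))"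
    using lborel_integrable_real_affine[OF fourier_pair_integrable(2)[OF assms(1)], of "1 / s" 0] assms(2) by simp
  then show "integrable lborel (\<lambda>\<xi>. complex_of_real (1 / s) * A (\<xi> / s) * cis (2 * pi * t * \<xi>))"
    by (intro integrable_mult_cis) auto
  fix x
  have "(\<integral>\<xi>. complex_of_real (1 / s) * A (\<xi> / s) * cis (2 * pi * t * \<xi>) * cis (2 * pi * x * \<xi>) \<partial>lborel)
    = (\<integral>\<xi>. complex_of_real (1 / s) * (\<lambda>\<xi>. A \<xi> * cis (2 * pi * (s * (x + t)) * \<xi>)) ((1 / s) * (\<xi> + 0)) \<partial>lborel)"
    using assms(2) by (intro Bochner_Integration.integral_cong) (auto simp: mult.assoc cis_mult algebra_simps)
  also have "\<dots> = complex_of_real (1 / s) * (\<integral>\<xi>. (\<lambda>\<xi>. A \<xi> * cis (2 * pi * (s * (x + t)) * \<xi>)) ((1 / s) * (\<xi> + 0)) \<partial>lborel)"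
    by (rule integral_mult_right_zero)
  also have "\<dots> = (\<integral>\<xi>. A \<xi> * cis (2 * pi * (s * (x + t)) * \<xi>) \<partial>lborel)"
    using assms(2) by (subst lborel_integral_scale) simp_all
  finally show "a (s * (x + t)) = (\<integral>\<xi>. complex_of_real (1 / s) * A (\<xi> / s) * cis (2 * pi * t * \<xi>) * cis (2 * pi * x * \<xi>) \<partial>lborel)"
    by (simp only: a[of "s * (x + t)"])
next
  have A: "A \<xi> = (\<integral>x. a x * cis (- 2 * pi * x * \<xi>) \<partial>lborel)" for \<xi>
    using fourier_pairD[OF assms(1)] by blast+
  fix \<xi>
  have "(\<integral>x. a (s * (x + t)) * cis (- 2 * pi * x * \<xi>) \<partial>lborel)
    = (\<integral>x. cis (2 * pi * t * \<xi>) * (\<lambda>x. a x * cis (- 2 * pi * x * (\<xi> / s))) (s * (x + t)) \<partial>lborel)"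
    using assms(2) by (intro Bochner_Integration.integral_cong) (auto simp: cis_mult field_simps)
  also have "\<dots> = cis (2 * pi * t * \<xi>) * (\<integral>x. (\<lambda>x. a x * cis (- 2 * pi * x * (\<xi> / s))) (s * (x + t)) \<partial>lborel)"
    by (rule integral_mult_right_zero)
  also have "\<dots> = cis (2 * pi * t * \<xi>) * (complex_of_real (1 / s) * A (\<xi> / s))"
    using assms(2) unfolding A by (subst lborel_integral_scale) simp_all
  finally show "complex_of_real (1 / s) * A (\<xi> / s) * cis (2 * pi * t * \<xi>) = (\<integral>x. a (s * (x + t)) * cis (- 2 * pi * x * \<xi>) \<partial>lborel)"
    by (simp add: mult.commute)
qed

section \<open>The self-dual Gaussian and superpositions of Fourier pairs\<close>

definition gaussian :: "real \<Rightarrow> real" where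
  "gaussian x = exp (- pi * x\<^sup>2)"

lemma gaussian_pos [simp]: "0 < gaussian x" "0 \<le> gaussian x"
  by (simp_all add: gaussian_def)

lemma gaussian_measurable [measurable]: "gaussian \<in> borel_measurable borel"
  unfolding gaussian_def[abs_def] by measurable

lemma gaussian_normal_density: "gaussian x = sqrt (2 * pi) * std_normal_density (0 + sqrt (2 * pi) * x)"
  by (simp add: gaussian_def std_normal_density_def power_mult_distrib)

lemma integrable_gaussian: "integrable lborel gaussian"
proof -
  have "integrable lborel (\<lambda>x. std_normal_density (0 + sqrt (2 * pi) * x))"
    by (rule lborel_integrable_real_affine[OF integrable_normal_density]) simp_all
  then show ?thesis
    unfolding gaussian_normal_density[abs_def] by (rule integrable_mult_right)
qed

text \<open>The known characteristic function of the standard normal distribution, rescaled by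
  sqrt(2 pi). The exponent -pi x^2 is the normalization that makes the function its own transform,
  so both halves of \<open>fourier_pair\<close> come from this single integral.\<close>

lemma gaussian_fourier: "(\<integral>x. complex_of_real (gaussian x) * cis (2 * pi * \<xi> * x) \<partial>lborel) = complex_of_real (gaussian \<xi>)"
proof -
  define c where "c = sqrt (2 * pi)"
  have c: "c > 0" "c * c = 2 * pi" by (simp_all add: c_def)
  have "complex_of_real (gaussian \<xi>) = char std_normal_distribution (c * \<xi>)"
    using c by (simp add: char_std_normal_distribution gaussian_def power_mult_distrib power2_eq_square[of c])
  also have "\<dots> = (\<integral>x. std_normal_density x *\<^sub>R cis (c * \<xi> * x) \<partial>lborel)"
    unfolding char_def by (subst integral_density) (simp_all add: cis_conv_exp)
  also have "\<dots> = c *\<^sub>R (\<integral>x. std_normal_density (0 + c * x) *\<^sub>R cis (c * \<xi> * (0 + c * x)) \<partial>lborel)"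
    using c by (subst lborel_integral_real_affine[of c _ 0]) simp_all
  also have "\<dots> = (\<integral>x. c *\<^sub>R (std_normal_density (0 + c * x) *\<^sub>R cis (c * \<xi> * (0 + c * x))) \<partial>lborel)"
    by (rule integral_scaleR_right[symmetric])
  also have "\<dots> = (\<integral>x. complex_of_real (gaussian x) * cis (2 * pi * \<xi> * x) \<partial>lborel)"
  proof (rule Bochner_Integration.integral_cong[OF refl])
    fix x
    have "c * \<xi> * (0 + c * x) = 2 * pi * \<xi> * x"
      using c(2) by (metis add_0 mult.assoc mult.left_commute)
    then show "c *\<^sub>R (std_normal_density (0 + c * x) *\<^sub>R cis (c * \<xi> * (0 + c * x))) = complex_of_real (gaussian x) * cis (2 * pi * \<xi> * x)"
      by (simp only: gaussian_normal_density c_def[symmetric] scaleR_conv_of_real of_real_mult mult.assoc)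
  qed
  finally show ?thesis by simp
qed

lemma fourier_pair_gaussian: "fourier_pair (\<lambda>x. complex_of_real (gaussian x)) (\<lambda>x. complex_of_real (gaussian x))"
  unfolding fourier_pair_def
proof (intro conjI allI)
  show "integrable lborel (\<lambda>x. complex_of_real (gaussian x))"
    using integrable_gaussian by simp
  then show "integrable lborel (\<lambda>x. complex_of_real (gaussian x))" .
  show "complex_of_real (gaussian x) = (\<integral>\<xi>. complex_of_real (gaussian \<xi>) * cis (2 * pi * x * \<xi>) \<partial>lborel)" for x
    by (rule gaussian_fourier[symmetric])
  show "complex_of_real (gaussian \<xi>) = (\<integral>x. complex_of_real (gaussian x) * cis (- 2 * pi * x * \<xi>) \<partial>lborel)" for \<xi>
    using gaussian_fourier[of "- \<xi>"] by (simp add: gaussian_def mult.assoc mult.commute[of \<xi>])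
qed

lemma integral_gaussian: "(\<integral>x. gaussian x \<partial>lborel) = 1"
proof -
  have "complex_of_real (\<integral>x. gaussian x \<partial>lborel) = 1"
    using gaussian_fourier[of 0] by (simp add: gaussian_def[of 0])
  then show ?thesis using of_real_eq_1_iff by blast
qed

text \<open>Fubini, with absolute integrability from the bound K |w(t)| on the inner integral. The
  factor c plays the role of a character when transforms are computed and is the constant 1 when
  only integrability is wanted.\<close>

lemma integral_superposition:
  fixes w :: "real \<Rightarrow> complex" and A :: "real \<Rightarrow> real \<Rightarrow> complex" and c :: "real \<Rightarrow> complex"
  assumes w: "integrable lborel w" and A [measurable]: "case_prod A \<in> borel_measurable (borel \<Otimes>\<^sub>M borel)"
    and AK: "\<And>t. integrable lborel (A t)" "\<And>t. (\<integral>\<xi>. cmod (A t \<xi>) \<partial>lborel) \<le> K"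
    and c [measurable]: "c \<in> borel_measurable borel" and c1: "\<And>\<xi>. cmod (c \<xi>) \<le> 1"
  shows "integrable lborel (\<lambda>\<xi>. (\<integral>t. w t * A t \<xi> \<partial>lborel) * c \<xi>)"
    and "(\<integral>t. w t * (\<integral>\<xi>. A t \<xi> * c \<xi> \<partial>lborel) \<partial>lborel) = (\<integral>\<xi>. (\<integral>t. w t * A t \<xi> \<partial>lborel) * c \<xi> \<partial>lborel)"
proof -
  have [measurable]: "w \<in> borel_measurable borel" using borel_measurable_integrable[OF w] by simp
  have Ac: "integrable lborel (\<lambda>\<xi>. A t \<xi> * c \<xi>)" for t
  proof (rule Bochner_Integration.integrable_bound[OF AK(1)])
    show "AE \<xi> in lborel. norm (A t \<xi> * c \<xi>) \<le> norm (A t \<xi>)"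
      using c1 by (intro AE_I2) (simp add: norm_mult mult_left_le)
  qed measurable
  have int: "integrable (lborel \<Otimes>\<^sub>M lborel) (\<lambda>(t, \<xi>). w t * (A t \<xi> * c \<xi>))"
  proof (rule lborel_pair.Fubini_integrable)
    show "integrable lborel (\<lambda>t. \<integral>\<xi>. norm (case (t, \<xi>) of (t, \<xi>) \<Rightarrow> w t * (A t \<xi> * c \<xi>)) \<partial>lborel)"
    proof (rule Bochner_Integration.integrable_bound)
      show "integrable lborel (\<lambda>t. K * cmod (w t))" using w by simp
      show "AE t in lborel. norm (\<integral>\<xi>. norm (case (t, \<xi>) of (t, \<xi>) \<Rightarrow> w t * (A t \<xi> * c \<xi>)) \<partial>lborel) \<le> norm (K * cmod (w t))"
      proof (rule AE_I2)
        fix t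
        have "(\<integral>\<xi>. cmod (A t \<xi> * c \<xi>) \<partial>lborel) \<le> (\<integral>\<xi>. cmod (A t \<xi>) \<partial>lborel)"
          using c1 by (intro integral_mono integrable_norm Ac AK) (simp add: norm_mult mult_left_le)
        also have "\<dots> \<le> K" by (rule AK)
        finally have "cmod (w t) * (\<integral>\<xi>. cmod (A t \<xi> * c \<xi>) \<partial>lborel) \<le> cmod (w t) * K"
          by (rule mult_left_mono) simp
        moreover have "0 \<le> (\<integral>\<xi>. cmod (A t \<xi> * c \<xi>) \<partial>lborel)" by simp
        ultimately show "norm (\<integral>\<xi>. norm (case (t, \<xi>) of (t, \<xi>) \<Rightarrow> w t * (A t \<xi> * c \<xi>)) \<partial>lborel) \<le> norm (K * cmod (w t))"
          by (simp add: norm_mult[of "w t"] mult.commute order_trans[OF _ abs_ge_self])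
      qed
    qed measurable
    show "AE t in lborel. integrable lborel (\<lambda>\<xi>. case (t, \<xi>) of (t, \<xi>) \<Rightarrow> w t * (A t \<xi> * c \<xi>))"
      using Ac by (intro AE_I2) simp
  qed measurable
  have eq: "(\<integral>t. w t * (A t \<xi> * c \<xi>) \<partial>lborel) = (\<integral>t. w t * A t \<xi> \<partial>lborel) * c \<xi>" for \<xi>
    by (simp add: mult.assoc[symmetric])
  show "integrable lborel (\<lambda>\<xi>. (\<integral>t. w t * A t \<xi> \<partial>lborel) * c \<xi>)"
    using lborel_pair.integrable_snd[OF int] unfolding eq .
  show "(\<integral>t. w t * (\<integral>\<xi>. A t \<xi> * c \<xi> \<partial>lborel) \<partial>lborel) = (\<integral>\<xi>. (\<integral>t. w t * A t \<xi> \<partial>lborel) * c \<xi> \<partial>lborel)"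
    using lborel_pair.Fubini_integral[OF int] unfolding eq by simp
qed

text \<open>Both transform formulas pass under an integral over the parameter t. Convolving with a
  Gaussian is such a superposition of translates, so inversion for smoothed functions is inherited
  from the Gaussian.\<close>

lemma fourier_pair_superposition:
  fixes w :: "real \<Rightarrow> complex"
  assumes w: "integrable lborel w" and pair: "\<And>t. fourier_pair (a t) (A t)"
    and m: "case_prod a \<in> borel_measurable (borel \<Otimes>\<^sub>M borel)" "case_prod A \<in> borel_measurable (borel \<Otimes>\<^sub>M borel)"
    and K: "\<And>t. (\<integral>x. cmod (a t x) \<partial>lborel) \<le> K" "\<And>t. (\<integral>\<xi>. cmod (A t \<xi>) \<partial>lborel) \<le> K"
  shows "fourier_pair (\<lambda>x. \<integral>t. w t * a t x \<partial>lborel) (\<lambda>\<xi>. \<integral>t. w t * A t \<xi> \<partial>lborel)"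
  unfolding fourier_pair_def
proof (intro conjI allI)
  have A: "A t \<xi> = (\<integral>x. a t x * cis (- 2 * pi * x * \<xi>) \<partial>lborel)" and a: "a t x = (\<integral>\<xi>. A t \<xi> * cis (2 * pi * x * \<xi>) \<partial>lborel)" for t x \<xi>
    using fourier_pairD[OF pair] by blast+
  have int: "integrable lborel (a t)" "integrable lborel (A t)" for t
    using fourier_pair_integrable[OF pair] by blast+
  show "integrable lborel (\<lambda>x. \<integral>t. w t * a t x \<partial>lborel)"
    using integral_superposition(1)[OF w m(1) int(1) K(1), of "\<lambda>x. 1"] by simp
  show "integrable lborel (\<lambda>\<xi>. \<integral>t. w t * A t \<xi> \<partial>lborel)"
    using integral_superposition(1)[OF w m(2) int(2) K(2), of "\<lambda>x. 1"] by simp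
  show "(\<integral>t. w t * a t x \<partial>lborel) = (\<integral>\<xi>. (\<integral>t. w t * A t \<xi> \<partial>lborel) * cis (2 * pi * x * \<xi>) \<partial>lborel)" for x
    unfolding a by (rule integral_superposition(2)[OF w m(2) int(2) K(2)]) simp_all
  show "(\<integral>t. w t * A t \<xi> \<partial>lborel) = (\<integral>x. (\<integral>t. w t * a t x \<partial>lborel) * cis (- 2 * pi * x * \<xi>) \<partial>lborel)" for \<xi>
    unfolding A by (rule integral_superposition(2)[OF w m(1) int(1) K(1)]) simp_all
qed

text \<open>Fubini applied to the inversion formula for a. Here g is merely integrable, since the
  lemma is meant for truncations of L2 functions, whose transforms need not be integrable.\<close>

lemma fourier_pair_inner:
  assumes pair: "fourier_pair a A" and g: "integrable lborel g"
  shows "l2_inner lborel a g = l2_inner lborel A (\<lambda>\<xi>. \<integral>x. g x * cis (- 2 * pi * x * \<xi>) \<partial>lborel)"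
proof -
  note [measurable] = fourier_pair_measurable[OF pair] borel_measurable_integrable[OF g]
  have a: "a x = (\<integral>\<xi>. A \<xi> * cis (2 * pi * x * \<xi>) \<partial>lborel)" for x
    using fourier_pairD(1)[OF pair] .
  have g': "integrable lborel (\<lambda>x. cnj (g x))" using g by simp
  define W where "W x \<xi> = A \<xi> * cis (2 * pi * x * \<xi>)" for x \<xi>
  have "l2_inner lborel a g = (\<integral>x. cnj (g x) * (\<integral>\<xi>. W x \<xi> * 1 \<partial>lborel) \<partial>lborel)"
    unfolding l2_inner_def W_def mult_1_right a[symmetric] by (simp only: mult.commute)
  also have "\<dots> = (\<integral>\<xi>. (\<integral>x. cnj (g x) * W x \<xi> \<partial>lborel) * 1 \<partial>lborel)"
  proof (rule integral_superposition(2)[OF g'])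
    show "case_prod W \<in> borel_measurable (borel \<Otimes>\<^sub>M borel)"
      unfolding W_def by measurable
    show "integrable lborel (W t)" for t
      unfolding W_def by (intro integrable_mult_cis fourier_pair_integrable[OF pair]) simp
    show "(\<integral>\<xi>. cmod (W t \<xi>) \<partial>lborel) \<le> (\<integral>\<xi>. cmod (A \<xi>) \<partial>lborel)" for t
      by (simp add: W_def norm_mult)
  qed auto
  also have "\<dots> = l2_inner lborel A (\<lambda>\<xi>. \<integral>x. g x * cis (- 2 * pi * x * \<xi>) \<partial>lborel)"
    unfolding l2_inner_def
  proof (intro Bochner_Integration.integral_cong refl)
    fix \<xi>
    have "(\<integral>x. cnj (g x) * W x \<xi> \<partial>lborel) = (\<integral>x. A \<xi> * cnj (g x * cis (- 2 * pi * x * \<xi>)) \<partial>lborel)"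
      by (intro Bochner_Integration.integral_cong refl) (simp add: W_def cis_cnj)
    also have "\<dots> = A \<xi> * cnj (\<integral>x. g x * cis (- 2 * pi * x * \<xi>) \<partial>lborel)"
      unfolding integral_mult_right_zero Bochner_Integration.integral_cnj ..
    finally show "(\<integral>x. cnj (g x) * W x \<xi> \<partial>lborel) * 1 = A \<xi> * cnj (\<integral>x. g x * cis (- 2 * pi * x * \<xi>) \<partial>lborel)"
      by simp
  qed
  finally show ?thesis .
qed

lemma fourier_pair_Plancherel:
  assumes "fourier_pair a A" "fourier_pair b B"
  shows "l2_inner lborel a b = l2_inner lborel A B"
proof -
  have "B = (\<lambda>\<xi>. \<integral>x. b x * cis (- 2 * pi * x * \<xi>) \<partial>lborel)"
    using fourier_pairD(2)[OF assms(2)] by blast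
  then show ?thesis
    using fourier_pair_inner[OF assms(1) fourier_pair_integrable(1)[OF assms(2)]] by simp
qed

lemma fourier_pair_norm:
  assumes "fourier_pair a A"
  shows "l2_norm lborel a = l2_norm lborel A"
proof -
  have "complex_of_real ((l2_norm lborel a)\<^sup>2) = complex_of_real ((l2_norm lborel A)\<^sup>2)"
    using fourier_pair_Plancherel[OF assms assms] by (simp only: l2_inner_self)
  then have "(l2_norm lborel a)\<^sup>2 = (l2_norm lborel A)\<^sup>2" by (simp only: of_real_eq_iff)
  then show ?thesis by (rule power2_eq_imp_eq) simp_all
qed


text \<open>The convolution of an interval with the Gaussian of fixed width. Narrower smoothing is
  obtained by stretching the interval and rescaling the result, which stays within Fourier pairs by
  \<open>fourier_pair_affine\<close>.\<close>

definition smooth_indicator :: "real \<Rightarrow> real \<Rightarrow> real \<Rightarrow> real" where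
  "smooth_indicator c d x = (\<integral>t. indicator {c..d} t * gaussian (x - t) \<partial>lborel)"

lemma smooth_indicator_eq:
  "smooth_indicator c d x = (\<integral>t. indicator {c..d} (x - t) * gaussian t \<partial>lborel)"
  unfolding smooth_indicator_def
  by (subst lborel_integral_real_affine[of "-1" _ x]) (simp_all add: algebra_simps)

lemma integrable_indicator_gaussian: "integrable lborel (\<lambda>t. indicator {c..d} (x - t) * gaussian t)"
proof (rule Bochner_Integration.integrable_bound[OF integrable_gaussian])
  show "AE t in lborel. norm (indicator {c..d} (x - t) * gaussian t) \<le> norm (gaussian t)"
    by (intro AE_I2) (auto simp: indicator_def)
qed measurable

lemma smooth_indicator_bounds: "0 \<le> smooth_indicator c d x" "smooth_indicator c d x \<le> 1"
proof -
  show "0 \<le> smooth_indicator c d x"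
    unfolding smooth_indicator_def by (intro integral_nonneg_AE AE_I2) simp
  have "smooth_indicator c d x \<le> (\<integral>t. gaussian t \<partial>lborel)"
    unfolding smooth_indicator_eq
    by (intro integral_mono integrable_indicator_gaussian integrable_gaussian) (auto simp: indicator_def)
  then show "smooth_indicator c d x \<le> 1" by (simp add: integral_gaussian)
qed

lemma smooth_indicator_measurable [measurable]: "smooth_indicator c d \<in> borel_measurable borel"
  unfolding smooth_indicator_def[abs_def] by measurable

text \<open>A superposition of translated Gaussians over the interval. The value at 0 is recorded
  because it is the total mass: smoothing preserves the length of the interval, and the density
  proof needs that mass exactly.\<close>

lemma fourier_pair_smooth_indicator:
  "\<exists>A. fourier_pair (\<lambda>x. complex_of_real (smooth_indicator c d x)) A \<and> (c \<le> d \<longrightarrow> A 0 = complex_of_real (d - c))"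
proof -
  define w :: "real \<Rightarrow> complex" where "w t = complex_of_real (indicator {c..d} t)" for t
  define a where "a t x = complex_of_real (gaussian (1 * (x + - t)))" for t x
  define A where "A t \<xi> = complex_of_real (1 / 1) * complex_of_real (gaussian (\<xi> / 1)) * cis (2 * pi * (- t) * \<xi>)" for t \<xi>
  have wint: "integrable lborel w"
    unfolding w_def by (intro integrable_of_real integrable_real_indicator emeasure_bounded_finite) auto
  have pair: "fourier_pair (a t) (A t)" for t
    unfolding a_def A_def by (rule fourier_pair_affine[OF fourier_pair_gaussian]) simp
  have K: "(\<integral>x. cmod (a t x) \<partial>lborel) \<le> 1" "(\<integral>\<xi>. cmod (A t \<xi>) \<partial>lborel) \<le> 1" for t
  proof -
    have "(\<integral>x. gaussian (x - t) \<partial>lborel) = 1"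
      using lborel_integral_real_affine[of 1 gaussian "-t"] integral_gaussian by simp
    then show "(\<integral>x. cmod (a t x) \<partial>lborel) \<le> 1" by (simp add: a_def)
    show "(\<integral>\<xi>. cmod (A t \<xi>) \<partial>lborel) \<le> 1"
      by (simp add: A_def norm_mult integral_gaussian)
  qed
  have p: "fourier_pair (\<lambda>x. \<integral>t. w t * a t x \<partial>lborel) (\<lambda>\<xi>. \<integral>t. w t * A t \<xi> \<partial>lborel)"
  proof (rule fourier_pair_superposition[OF wint pair _ _ K])
    show "case_prod a \<in> borel_measurable (borel \<Otimes>\<^sub>M borel)" unfolding a_def by measurable
    show "case_prod A \<in> borel_measurable (borel \<Otimes>\<^sub>M borel)" unfolding A_def by measurable
  qed
  have e: "(\<integral>t. w t * a t x \<partial>lborel) = complex_of_real (smooth_indicator c d x)" for x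
    unfolding smooth_indicator_def w_def a_def of_real_mult[symmetric] integral_complex_of_real by simp
  have "(\<integral>t. w t * A t 0 \<partial>lborel) = complex_of_real (d - c)" if "c \<le> d"
  proof -
    have "(\<integral>t. w t * A t 0 \<partial>lborel) = (\<integral>t. complex_of_real (indicator {c..d} t) \<partial>lborel)"
      by (simp add: w_def A_def gaussian_def)
    also have "\<dots> = complex_of_real (\<integral>t. indicator {c..d} t \<partial>lborel)"
      by (rule integral_complex_of_real)
    also have "\<dots> = complex_of_real (d - c)" using that by simp
    finally show ?thesis .
  qed
  with p show ?thesis unfolding e by blast
qed

section \<open>Density of the functions that belong to a Fourier pair\<close>

definition fourier_image :: "(real \<Rightarrow> complex) set" where
  "fourier_image = {a. \<exists>A. fourier_pair a A}"

lemma linear_space_fourier_image: "linear_space fourier_image"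
  unfolding linear_space_def fourier_image_def
  using fourier_pair_zero fourier_pair_add fourier_pair_cmult by blast

text \<open>Let r be a smoothing with values in [0, 1] and mass d - c. From r^2 \<le> r, the squared
  distance to the indicator is at most 2(d - c) minus twice the integral of r over the interval. So
  convergence of r to 1 inside the interval suffices, and the tails outside are controlled by the
  mass alone.\<close>

lemma interval_mem_closure_fourier_image:
  fixes c d :: real
  shows "indicator {c<..<d} \<in> l2_closure lborel fourier_image"
proof (cases "c < d")
  case False
  then have "(indicator {c<..<d} :: real \<Rightarrow> complex) = (\<lambda>x. 0)" by (auto simp: fun_eq_iff)
  then show ?thesis using zero_mem_l2_closure[OF linear_space_fourier_image] by simp
next
  case True
  \<comment> \<open>\<open>Suc n\<close> is the stretching factor, hence positive; the summand 0
    matches the shape of \<open>fourier_pair_affine\<close> with no shift.\<close>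
  define r where "r n x = smooth_indicator (real (Suc n) * c) (real (Suc n) * d) (real (Suc n) * (x + 0))" for n x
  let ?i = "indicator {c<..<d} :: real \<Rightarrow> real"
  have pair: "\<exists>A. fourier_pair (\<lambda>x. complex_of_real (r n x)) A \<and> A 0 = complex_of_real (d - c)" for n
  proof -
    obtain A where A: "fourier_pair (\<lambda>x. complex_of_real (smooth_indicator (real (Suc n) * c) (real (Suc n) * d) x)) A"
      "A 0 = complex_of_real (real (Suc n) * d - real (Suc n) * c)"
      using fourier_pair_smooth_indicator[of "real (Suc n) * c" "real (Suc n) * d"] True by auto
    show ?thesis
    proof (intro exI conjI)
      show "fourier_pair (\<lambda>x. complex_of_real (r n x)) (\<lambda>\<xi>. complex_of_real (1 / real (Suc n)) * A (\<xi> / real (Suc n)) * cis (2 * pi * 0 * \<xi>))"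
        unfolding r_def by (rule fourier_pair_affine[OF A(1)]) simp
      have "complex_of_real (1 / real (Suc n)) * A (0 / real (Suc n)) * cis (2 * pi * 0 * 0)
        = complex_of_real (1 / real (Suc n) * (real (Suc n) * (d - c)))"
        by (simp only: div_0 A(2) of_real_mult[symmetric] right_diff_distrib[symmetric]) simp
      then show "complex_of_real (1 / real (Suc n)) * A (0 / real (Suc n)) * cis (2 * pi * 0 * 0) = complex_of_real (d - c)"
        by (simp del: of_nat_Suc)
    qed
  qed
  have r_int: "integrable lborel (r n)" and r_eq: "(\<integral>x. r n x \<partial>lborel) = d - c" for n
  proof -
    obtain A where A: "fourier_pair (\<lambda>x. complex_of_real (r n x)) A" "A 0 = complex_of_real (d - c)"
      using pair[of n] by blast
    show "integrable lborel (r n)"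
      using integrable_Re[OF fourier_pair_integrable(1)[OF A(1)]] by simp
    have "complex_of_real (\<integral>x. r n x \<partial>lborel) = complex_of_real (d - c)"
      using fourier_pairD(2)[OF A(1), of 0] A(2) by (simp add: integral_complex_of_real)
    then show "(\<integral>x. r n x \<partial>lborel) = d - c" by (simp only: of_real_eq_iff)
  qed
  have r01: "0 \<le> r n x" "r n x \<le> 1" for n x
    unfolding r_def by (rule smooth_indicator_bounds)+
  have r_meas [measurable]: "r n \<in> borel_measurable borel" for n
    using borel_measurable_integrable[OF r_int] by simp
  have ir_int: "integrable lborel (\<lambda>x. ?i x * r n x)" for n
  proof (rule Bochner_Integration.integrable_bound[OF r_int[of n]])
    show "AE x in lborel. norm (?i x * r n x) \<le> norm (r n x)"
      by (intro AE_I2) (auto simp: indicator_def)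
  qed measurable
  have conv: "(\<lambda>n. r n x) \<longlonglongrightarrow> 1" if x: "c < x" "x < d" for x
  proof -
    \<comment> \<open>Undoing the stretch contracts the Gaussian variable by \<open>Suc n\<close>:
      an interior x then stays in the interval for each fixed t and large n.\<close>
    have r: "r n x = (\<integral>t. indicator {c..d} (x - t / real (Suc n)) * gaussian t \<partial>lborel)" for n
      unfolding r_def smooth_indicator_eq
      by (intro Bochner_Integration.integral_cong refl arg_cong2[where f="(*)"])
        (auto simp: indicator_def field_simps simp del: of_nat_Suc)
    have "(\<lambda>n. \<integral>t. indicator {c..d} (x - t / real (Suc n)) * gaussian t \<partial>lborel) \<longlonglongrightarrow> (\<integral>t. gaussian t \<partial>lborel)"
    proof (rule integral_dominated_convergence[OF _ _ integrable_gaussian])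
      show "AE t in lborel. (\<lambda>n. indicator {c..d} (x - t / real (Suc n)) * gaussian t) \<longlonglongrightarrow> gaussian t"
      proof (rule AE_I2)
        fix t :: real
        have lim: "(\<lambda>n. x - t / real (Suc n)) \<longlonglongrightarrow> x"
          using tendsto_diff[OF tendsto_const[of x] LIMSEQ_Suc[OF lim_const_over_n[of t]]] by simp
        have "eventually (\<lambda>n. x - t / real (Suc n) \<in> {c<..<d}) sequentially"
          using topological_tendstoD[OF lim, of "{c<..<d}"] x by simp
        then have "eventually (\<lambda>n. indicator {c..d} (x - t / real (Suc n)) * gaussian t = gaussian t) sequentially"
          by eventually_elim (auto simp: indicator_def)
        then show "(\<lambda>n. indicator {c..d} (x - t / real (Suc n)) * gaussian t) \<longlonglongrightarrow> gaussian t"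
          by (rule tendsto_eventually)
      qed
      show "AE t in lborel. norm (indicator {c..d} (x - t / real (Suc n)) * gaussian t) \<le> gaussian t" for n
        by (intro AE_I2) (auto simp: indicator_def)
    qed measurable
    then show ?thesis unfolding r integral_gaussian .
  qed
  have lim: "(\<lambda>n. \<integral>x. ?i x * r n x \<partial>lborel) \<longlonglongrightarrow> (\<integral>x. ?i x \<partial>lborel)"
  proof (rule integral_dominated_convergence[where w="?i"])
    show "AE x in lborel. (\<lambda>n. ?i x * r n x) \<longlonglongrightarrow> ?i x"
    proof (rule AE_I2)
      fix x show "(\<lambda>n. ?i x * r n x) \<longlonglongrightarrow> ?i x"
        using conv[of x] by (cases "x \<in> {c<..<d}") auto
    qed
    show "AE x in lborel. norm (?i x * r n x) \<le> ?i x" for n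
      using r01[of n] by (intro AE_I2) (auto simp: indicator_def)
  qed (use True in simp_all)
  have i_eq: "(\<integral>x. ?i x \<partial>lborel) = d - c" using True by simp
  have i_int: "integrable lborel ?i"
    by (intro integrable_real_indicator emeasure_bounded_finite) auto
  have bound: "(l2_norm lborel (\<lambda>x. complex_of_real (r n x) - indicator {c<..<d} x))\<^sup>2
      \<le> 2 * (d - c) - 2 * (\<integral>x. ?i x * r n x \<partial>lborel)" for n
  proof -
    have "(\<integral>x. (cmod (complex_of_real (r n x) - indicator {c<..<d} x))\<^sup>2 \<partial>lborel)
      \<le> (\<integral>x. r n x + ?i x - 2 * (?i x * r n x) \<partial>lborel)"
    proof (rule integral_mono')
      show "integrable lborel (\<lambda>x. r n x + ?i x - 2 * (?i x * r n x))"
        by (intro Bochner_Integration.integrable_diff Bochner_Integration.integrable_add integrable_mult_right r_int i_int ir_int)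
      fix x
      have c: "cmod (complex_of_real (r n x) - indicator {c<..<d} x) = \<bar>r n x - ?i x\<bar>"
      proof -
        have "complex_of_real (r n x) - indicator {c<..<d} x = complex_of_real (r n x - ?i x)"
          by (auto simp: indicator_def)
        then show ?thesis by (simp only: norm_of_real)
      qed
      have sq: "(r n x)\<^sup>2 \<le> r n x"
        using r01[of n x] by (simp add: power2_eq_square mult_left_le)
      show "(cmod (complex_of_real (r n x) - indicator {c<..<d} x))\<^sup>2 \<le> r n x + ?i x - 2 * (?i x * r n x)"
        unfolding c power2_abs using sq by (cases "x \<in> {c<..<d}") (auto simp: power2_diff)
      then show "0 \<le> r n x + ?i x - 2 * (?i x * r n x)"
        by (rule order_trans[rotated]) simp
    qed
    also have "\<dots> = (d - c) + (d - c) - 2 * (\<integral>x. ?i x * r n x \<partial>lborel)"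
      using r_int[of n] i_int ir_int[of n]
      by (simp only: Bochner_Integration.integral_diff Bochner_Integration.integral_add Bochner_Integration.integrable_add
          integrable_mult_right integral_mult_right_zero r_eq i_eq)
    finally show ?thesis by (simp add: l2_norm_square)
  qed
  have "(\<lambda>n. (l2_norm lborel (\<lambda>x. complex_of_real (r n x) - indicator {c<..<d} x))\<^sup>2) \<longlonglongrightarrow> 0"
  proof (rule tendsto_sandwich[OF _ _ tendsto_const])
    have "(\<lambda>n. 2 * (d - c) - 2 * (\<integral>x. ?i x * r n x \<partial>lborel)) \<longlonglongrightarrow> 2 * (d - c) - 2 * (d - c)"
      using lim unfolding i_eq by (intro tendsto_intros)
    then show "(\<lambda>n. 2 * (d - c) - 2 * (\<integral>x. ?i x * r n x \<partial>lborel)) \<longlonglongrightarrow> 0" by simp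
  qed (use bound in \<open>auto intro!: always_eventually\<close>)
  from tendsto_real_sqrt[OF this]
  have "(\<lambda>n. l2_norm lborel (\<lambda>x. complex_of_real (r n x) - indicator {c<..<d} x)) \<longlonglongrightarrow> 0" by simp
  moreover have "(\<lambda>x. complex_of_real (r n x)) \<in> l2_closure lborel fourier_image" for n
    using pair[of n] fourier_pair_L2(1) by (auto simp: fourier_image_def intro!: l2_closure_superset)
  moreover have "L2 lborel (indicator {c<..<d})"
    by (intro L2_indicator emeasure_bounded_finite) auto
  ultimately show ?thesis
    by (rule l2_closure_limit[rotated 2])
qed

lemma bounded_support_mem_closure_fourier_image:
  assumes "L2 lborel f" "\<And>x. x \<notin> {c<..<d} \<Longrightarrow> f x = 0"
  shows "f \<in> l2_closure lborel fourier_image"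
proof (rule mem_l2_closure_vanishing_outside[OF linear_space_fourier_image _ _ _ assms])
  show "indicator (box a b \<inter> {c<..<d}) \<in> l2_closure lborel fourier_image" for a b :: real
  proof -
    have eq: "box a b \<inter> {c<..<d} = {max a c<..<min b d}" by auto
    show ?thesis unfolding eq by (rule interval_mem_closure_fourier_image)
  qed
  show "emeasure lborel {c<..<d} < \<infinity>" by (rule emeasure_bounded_finite) simp
qed simp

lemma l2_closure_truncation:
  fixes f :: "'a::euclidean_space \<Rightarrow> complex"
  assumes f: "L2 lborel f"
    and D: "\<And>n::nat. (\<lambda>x. indicator (box (- (real n *\<^sub>R One)) (real n *\<^sub>R One)) x * f x) \<in> l2_closure lborel D"
  shows "f \<in> l2_closure lborel D"
proof (rule l2_closure_limit[OF D f])
  let ?B = "\<lambda>n::nat. box (- (real n *\<^sub>R One)) (real n *\<^sub>R One) :: 'a set"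
  show "(\<lambda>n. l2_norm lborel (\<lambda>x. indicator (?B n) x * f x - f x)) \<longlonglongrightarrow> 0"
  proof (rule tendsto_l2_norm_dominated[OF L2_measurable[OF l2_closure_L2[OF D]] L2_measurable[OF f] L2_integrable[OF f]])
    show "(cmod (indicator (?B n) x * f x - f x))\<^sup>2 \<le> (cmod (f x))\<^sup>2" for n x
      by (auto simp: indicator_def)
    show "AE x in lborel. (\<lambda>n. indicator (?B n) x * f x) \<longlonglongrightarrow> f x"
    proof (rule AE_I2)
      fix x :: 'a
      obtain n where n: "x \<in> ?B n"
        using UN_box_eq_UNIV by blast
      have "x \<in> ?B m" if "m \<ge> n" for m
        using n that by (force simp: mem_box)
      then show "(\<lambda>n. indicator (?B n) x * f x) \<longlonglongrightarrow> f x"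
        by (intro tendsto_eventually eventually_sequentiallyI[of n]) (auto simp: indicator_def)
    qed
  qed
qed

lemma L2_mem_closure_fourier_image:
  assumes "L2 lborel f"
  shows "f \<in> l2_closure lborel fourier_image"
proof (rule l2_closure_truncation[OF assms])
  fix n :: nat
  show "(\<lambda>x. indicator (box (- (real n *\<^sub>R One)) (real n *\<^sub>R One)) x * f x) \<in> l2_closure lborel fourier_image"
  proof (rule bounded_support_mem_closure_fourier_image[where c="- real n" and d="real n"])
    show "L2 lborel (\<lambda>x. indicator (box (- (real n *\<^sub>R One)) (real n *\<^sub>R One)) x * f x)"
      by (rule L2_bounded_mult[OF assms, where B=1]) (auto simp: indicator_def)
  qed (auto simp: indicator_def)
qed

section \<open>The Plancherel transform and products of measures\<close>

lemma truncated_fourier_tendsto: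
  assumes "fourier_L2 f F"
  shows "(\<lambda>n::nat. \<integral>\<^sup>+\<xi>. ennreal ((cmod (F \<xi> - (\<integral>x. (indicator {-real n..real n} x * f x) * cis (- 2 * pi * x * \<xi>) \<partial>lborel)))\<^sup>2) \<partial>lborel) \<longlonglongrightarrow> 0"
proof -
  have eq: "set_lebesgue_integral lborel {-R..R} (\<lambda>x. f x * cis (- 2 * pi * x * \<xi>))
    = (\<integral>x. (indicator {-R..R} x * f x) * cis (- 2 * pi * x * \<xi>) \<partial>lborel)" for R \<xi>
    unfolding set_lebesgue_integral_def
    by (intro Bochner_Integration.integral_cong refl) (auto simp: indicator_def)
  have "((\<lambda>R. \<integral>\<^sup>+\<xi>. ennreal ((cmod (F \<xi> - (\<integral>x. (indicator {-R..R} x * f x) * cis (- 2 * pi * x * \<xi>) \<partial>lborel)))\<^sup>2) \<partial>lborel) \<longlongrightarrow> 0) at_top"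
    using assms unfolding fourier_L2_def eq by blast
  then show ?thesis
    by (rule filterlim_compose) (rule filterlim_real_sequentially)
qed

text \<open>Truncations of f are integrable, so the formula holds for them by
  \<open>fourier_pair_inner\<close>. They converge to f in L2, their transforms converge to F by the
  definition of \<open>fourier_L2\<close>, and both sides are continuous.\<close>

lemma fourier_L2_inner:
  assumes f: "fourier_L2 f F" and pair: "fourier_pair a A"
  shows "l2_inner lborel a f = l2_inner lborel A F"
proof -
  have L: "L2 lborel f" "L2 lborel F" using f by (simp_all add: fourier_L2_def)
  note [measurable] = L[THEN L2_measurable] fourier_pair_measurable[OF pair]
  define fn where "fn n x = indicator {-real n..real n} x * f x" for n x
  define gn where "gn n \<xi> = (\<integral>x. fn n x * cis (- 2 * pi * x * \<xi>) \<partial>lborel)" for n \<xi>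
  have fn_L2: "L2 lborel (fn n)" for n
    unfolding fn_def by (rule L2_bounded_mult[OF L(1), where B=1]) (auto simp: indicator_def)
  have fn_int: "integrable lborel (fn n)" for n
    unfolding fn_def by (intro L2_mult_integrable L(1) L2_indicator) auto
  have [measurable]: "fn n \<in> borel_measurable borel" for n
    using L2_measurable[OF fn_L2] by simp
  have gn_meas [measurable]: "gn n \<in> borel_measurable borel" for n
    unfolding gn_def by measurable
  have inner: "l2_inner lborel (fn n) a = l2_inner lborel (gn n) A" for n
    using fourier_pair_inner[OF pair fn_int[of n]] unfolding gn_def[symmetric]
    by (simp add: l2_inner_commute[of _ "fn n"] l2_inner_commute[of _ "gn n"])
  have "(\<lambda>n. l2_norm lborel (\<lambda>x. fn n x - f x)) \<longlonglongrightarrow> 0"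
  proof (rule tendsto_l2_norm_dominated[OF _ _ L2_integrable[OF L(1)]])
    show "(cmod (fn n x - f x))\<^sup>2 \<le> (cmod (f x))\<^sup>2" for n x
      by (auto simp: fn_def indicator_def)
    show "AE x in lborel. (\<lambda>n. fn n x) \<longlonglongrightarrow> f x"
    proof (rule AE_I2)
      fix x :: real
      obtain N :: nat where N: "\<bar>x\<bar> \<le> real N" using real_arch_simple by blast
      have "fn n x = f x" if "n \<ge> N" for n
        using that N by (auto simp: fn_def indicator_def)
      then show "(\<lambda>n. fn n x) \<longlonglongrightarrow> f x"
        by (intro tendsto_eventually eventually_sequentiallyI[of N]) auto
    qed
  qed simp_all
  then have lim1: "(\<lambda>n. l2_inner lborel (fn n) a) \<longlonglongrightarrow> l2_inner lborel f a"
    by (rule tendsto_l2_inner[OF fn_L2 L(1) fourier_pair_L2(1)[OF pair]])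
  define N where "N n = (\<integral>\<^sup>+\<xi>. ennreal ((cmod (F \<xi> - gn n \<xi>))\<^sup>2) \<partial>lborel)" for n
  have N0: "N \<longlonglongrightarrow> 0"
    using truncated_fourier_tendsto[OF f] unfolding N_def gn_def fn_def .
  have "(\<lambda>n. l2_inner lborel (gn n) A) \<longlonglongrightarrow> l2_inner lborel F A"
  proof (rule LIM_zero_cancel, rule Lim_null_comparison)
    \<comment> \<open>The truncated transforms are not known to be in L2 beforehand; for large n
      this follows from their finite distance to F.\<close>
    have "eventually (\<lambda>n. N n < \<infinity>) sequentially"
      using order_tendstoD(2)[OF N0, of \<infinity>] by simp
    then show "eventually (\<lambda>n. norm (l2_inner lborel (gn n) A - l2_inner lborel F A) \<le> sqrt (enn2real (N n)) * l2_norm lborel A) sequentially"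
    proof eventually_elim
      case (elim n)
      have D: "L2 lborel (\<lambda>\<xi>. F \<xi> - gn n \<xi>)"
        using elim unfolding N_def by (intro L2_I_nn_integral) simp_all
      have nrm: "l2_norm lborel (\<lambda>\<xi>. F \<xi> - gn n \<xi>) = sqrt (enn2real (N n))"
        unfolding N_def L2_nn_integral[OF D] by simp
      have G: "L2 lborel (gn n)"
        using L2_diff[OF L(2) D] by simp
      have "l2_inner lborel (gn n) A - l2_inner lborel F A = - l2_inner lborel (\<lambda>\<xi>. F \<xi> - gn n \<xi>) A"
        using l2_inner_diff_left[OF L(2) G fourier_pair_L2(2)[OF pair]] by simp
      then show ?case
        using l2_Cauchy_Schwarz[OF D fourier_pair_L2(2)[OF pair]] by (simp add: nrm)
    qed
    have "(\<lambda>n. enn2real (N n)) \<longlonglongrightarrow> 0"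
      by (rule tendsto_enn2real) (use N0 in simp_all)
    from tendsto_mult[OF tendsto_real_sqrt[OF this] tendsto_const[of "l2_norm lborel A"]]
    show "(\<lambda>n. sqrt (enn2real (N n)) * l2_norm lborel A) \<longlonglongrightarrow> 0" by simp
  qed
  then have "l2_inner lborel f a = l2_inner lborel F A"
    using lim1 unfolding inner by (rule LIMSEQ_unique[rotated])
  then show ?thesis
    using l2_inner_commute by metis
qed

text \<open>Duality: F is tested against members of the dense set. Each of these is a transform by
  \<open>fourier_pair_swap\<close>, so the inner product moves over to f, with the norm of the test
  function preserved.\<close>

lemma fourier_L2_norm_le:
  assumes f: "fourier_L2 f F"
  shows "l2_norm lborel F \<le> l2_norm lborel f"
proof -
  have L: "L2 lborel f" "L2 lborel F" using f by (simp_all add: fourier_L2_def)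
  obtain a where a: "\<forall>n::nat. a n \<in> fourier_image \<and> L2 lborel (a n)"
    "(\<lambda>n. l2_norm lborel (\<lambda>x. a n x - F x)) \<longlonglongrightarrow> 0"
    using l2_closure_seq[OF L2_mem_closure_fourier_image[OF L(2)]] by blast
  have "cmod (l2_inner lborel F F) \<le> l2_norm lborel F * l2_norm lborel f"
  proof (rule LIMSEQ_le)
    show "(\<lambda>n. cmod (l2_inner lborel (a n) F)) \<longlonglongrightarrow> cmod (l2_inner lborel F F)"
      using a by (intro tendsto_norm tendsto_l2_inner L) auto
    show "(\<lambda>n. l2_norm lborel (a n) * l2_norm lborel f) \<longlonglongrightarrow> l2_norm lborel F * l2_norm lborel f"
      using a by (intro tendsto_mult tendsto_const tendsto_l2_norm L) auto
    have "cmod (l2_inner lborel (a n) F) \<le> l2_norm lborel (a n) * l2_norm lborel f" for n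
    proof -
      obtain A where A: "fourier_pair (a n) A" using a(1) by (auto simp: fourier_image_def)
      note p = fourier_pair_swap[OF A]
      have "cmod (l2_inner lborel (a n) F) = cmod (l2_inner lborel (\<lambda>x. A (- x)) f)"
        using fourier_L2_inner[OF f p] by simp
      also have "\<dots> \<le> l2_norm lborel (\<lambda>x. A (- x)) * l2_norm lborel f"
        by (rule l2_Cauchy_Schwarz[OF fourier_pair_L2(1)[OF p] L(1)])
      also have "l2_norm lborel (\<lambda>x. A (- x)) = l2_norm lborel (a n)"
        by (rule fourier_pair_norm[OF p])
      finally show ?thesis .
    qed
    then show "\<exists>N. \<forall>n\<ge>N. cmod (l2_inner lborel (a n) F) \<le> l2_norm lborel (a n) * l2_norm lborel f" by blast
  qed
  then have "l2_norm lborel F * l2_norm lborel F \<le> l2_norm lborel F * l2_norm lborel f"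
    unfolding l2_inner_self by (simp only: norm_of_real abs_power2 power2_abs power2_eq_square abs_mult_self_eq)
  then show ?thesis
    using l2_norm_nonneg[of lborel F] l2_norm_nonneg[of lborel f] by (cases "l2_norm lborel F = 0") auto
qed

text \<open>The support is an intersection over a possibly uncountable family, whose null sets
  cannot simply be united. Lindelof's theorem selects countably many complements with the same
  union.\<close>

lemma AE_zero_outside_ess_supp:
  fixes h :: "'a::second_countable_topology \<Rightarrow> 'b::zero"
  shows "AE x in M. x \<notin> ess_supp M h \<longrightarrow> h x = 0"
proof -
  define C where "C = {F. closed F \<and> (AE x in M. x \<notin> F \<longrightarrow> h x = 0)}"
  obtain U where U: "U \<subseteq> uminus ` C" "countable U" "\<Union>U = \<Union>(uminus ` C)"
    by (rule Lindelof[of "uminus ` C"]) (auto simp: C_def)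
  have "AE x in M. \<forall>u\<in>U. x \<in> u \<longrightarrow> h x = 0"
  proof (subst AE_ball_countable[OF U(2)], rule ballI)
    fix u assume "u \<in> U"
    then obtain F where "F \<in> C" "u = - F" using U(1) by auto
    then show "AE x in M. x \<in> u \<longrightarrow> h x = 0" by (simp add: C_def)
  qed
  then show ?thesis
  proof eventually_elim
    case (elim x)
    show ?case
    proof
      assume "x \<notin> ess_supp M h"
      then have "x \<in> \<Union>(uminus ` C)" by (auto simp: ess_supp_def C_def)
      then show "h x = 0" using elim U(3) by blast
    qed
  qed
qed

section \<open>Iterated integrals, slices and tensor products\<close>

lemma lborel_prod_integral:
  fixes f :: "'a::euclidean_space \<times> 'b::euclidean_space \<Rightarrow> complex"
  assumes "integrable lborel f"
  shows "(\<integral>x. (\<integral>y. f (x, y) \<partial>lborel) \<partial>lborel) = integral\<^sup>L lborel f"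
    and "(\<integral>y. (\<integral>x. f (x, y) \<partial>lborel) \<partial>lborel) = integral\<^sup>L lborel f"
proof -
  have i: "integrable (lborel \<Otimes>\<^sub>M lborel) f"
    using assms by (simp add: lborel_prod)
  show 1: "(\<integral>x. (\<integral>y. f (x, y) \<partial>lborel) \<partial>lborel) = integral\<^sup>L lborel f"
    using lborel_pair.integral_fst'[OF i] by (simp only: lborel_prod)
  have i': "integrable (lborel \<Otimes>\<^sub>M lborel) (case_prod (\<lambda>x y. f (x, y)))"
    using i by simp
  show "(\<integral>y. (\<integral>x. f (x, y) \<partial>lborel) \<partial>lborel) = integral\<^sup>L lborel f"
    using lborel_pair.Fubini_integral[OF i'] 1 by simp
qed

lemma lborel_prod_nn_integral:
  fixes f :: "'a::euclidean_space \<times> 'b::euclidean_space \<Rightarrow> ennreal"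
  assumes "f \<in> borel_measurable borel"
  shows "(\<integral>\<^sup>+x. (\<integral>\<^sup>+y. f (x, y) \<partial>lborel) \<partial>lborel) = integral\<^sup>N lborel f"
    and "(\<integral>\<^sup>+y. (\<integral>\<^sup>+x. f (x, y) \<partial>lborel) \<partial>lborel) = integral\<^sup>N lborel f"
proof -
  have m: "f \<in> borel_measurable (lborel \<Otimes>\<^sub>M lborel)"
    unfolding lborel_prod using assms by simp
  show "(\<integral>\<^sup>+x. (\<integral>\<^sup>+y. f (x, y) \<partial>lborel) \<partial>lborel) = integral\<^sup>N lborel f"
    using lborel.nn_integral_fst[OF m] by (simp only: lborel_prod)
  show "(\<integral>\<^sup>+y. (\<integral>\<^sup>+x. f (x, y) \<partial>lborel) \<partial>lborel) = integral\<^sup>N lborel f"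
    using lborel_pair.nn_integral_snd[OF m] by (simp only: lborel_prod)
qed

lemma borel_measurable_slices:
  fixes f :: "'a::euclidean_space \<times> 'b::euclidean_space \<Rightarrow> 'c::topological_space"
  assumes "f \<in> borel_measurable borel"
  shows "(\<lambda>x. f (x, y)) \<in> borel_measurable borel" "(\<lambda>y. f (x, y)) \<in> borel_measurable borel"
  using assms unfolding borel_prod[symmetric] by measurable

lemma L2_slices:
  fixes f :: "'a::euclidean_space \<times> 'b::euclidean_space \<Rightarrow> complex"
  assumes "L2 lborel f"
  shows "AE x in lborel. L2 lborel (\<lambda>y. f (x, y))" "AE y in lborel. L2 lborel (\<lambda>x. f (x, y))"
proof -
  have fm: "f \<in> borel_measurable borel" using L2_measurable[OF assms] by simp
  have i: "integrable (lborel \<Otimes>\<^sub>M lborel) (\<lambda>p. (cmod (f p))\<^sup>2)"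
    using L2_integrable[OF assms] by (simp add: lborel_prod)
  show "AE x in lborel. L2 lborel (\<lambda>y. f (x, y))"
    using lborel_pair.AE_integrable_fst'[OF i]
    by eventually_elim (simp add: L2_def borel_measurable_slices[OF fm])
  have i': "integrable (lborel \<Otimes>\<^sub>M lborel) (case_prod (\<lambda>x y. (cmod (f (x, y)))\<^sup>2))"
    using i by (simp add: split_def)
  show "AE y in lborel. L2 lborel (\<lambda>x. f (x, y))"
    using lborel_pair.AE_integrable_snd[OF i']
    by eventually_elim (simp add: L2_def borel_measurable_slices[OF fm])
qed

definition tensor :: "('a \<Rightarrow> complex) \<Rightarrow> ('b \<Rightarrow> complex) \<Rightarrow> 'a \<times> 'b \<Rightarrow> complex" where
  "tensor a b = (\<lambda>(x, y). a x * b y)"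

lemma tensor_measurable [measurable]:
  assumes "a \<in> borel_measurable borel" "b \<in> borel_measurable borel"
  shows "tensor a b \<in> borel_measurable (borel :: ('a::euclidean_space \<times> 'b::euclidean_space) measure)"
  using assms unfolding tensor_def borel_prod[symmetric] by measurable

lemma L2_tensor:
  fixes a :: "'a::euclidean_space \<Rightarrow> complex" and b :: "'b::euclidean_space \<Rightarrow> complex"
  assumes "L2 lborel a" "L2 lborel b"
  shows "L2 lborel (tensor a b)"
proof (rule L2_I_nn_integral)
  have [measurable]: "a \<in> borel_measurable borel" "b \<in> borel_measurable borel"
    using assms[THEN L2_measurable] by simp_all
  show "tensor a b \<in> borel_measurable lborel" by simp
  have "(\<integral>\<^sup>+p. ennreal ((cmod (tensor a b p))\<^sup>2) \<partial>lborel)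
    = (\<integral>\<^sup>+x. \<integral>\<^sup>+y. ennreal ((cmod (tensor a b (x, y)))\<^sup>2) \<partial>lborel \<partial>lborel)"
    by (rule lborel_prod_nn_integral(1)[symmetric]) measurable
  also have "\<dots> = (\<integral>\<^sup>+x. \<integral>\<^sup>+y. ennreal ((cmod (a x))\<^sup>2) * ennreal ((cmod (b y))\<^sup>2) \<partial>lborel \<partial>lborel)"
    by (simp add: tensor_def norm_mult power_mult_distrib ennreal_mult')
  also have "\<dots> = ennreal ((l2_norm lborel a)\<^sup>2) * ennreal ((l2_norm lborel b)\<^sup>2)"
    by (simp add: nn_integral_cmult nn_integral_multc L2_nn_integral[OF assms(1)] L2_nn_integral[OF assms(2)])
  also have "\<dots> < \<infinity>" by (simp add: ennreal_mult_less_top)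
  finally show "(\<integral>\<^sup>+p. ennreal ((cmod (tensor a b p))\<^sup>2) \<partial>lborel) < \<infinity>" .
qed

lemma l2_inner_tensor:
  fixes a a' :: "'a::euclidean_space \<Rightarrow> complex" and b b' :: "'b::euclidean_space \<Rightarrow> complex"
  assumes "L2 lborel a" "L2 lborel b" "L2 lborel a'" "L2 lborel b'"
  shows "l2_inner lborel (tensor a b) (tensor a' b') = l2_inner lborel a a' * l2_inner lborel b b'"
proof -
  have "l2_inner lborel (tensor a b) (tensor a' b')
    = (\<integral>x. \<integral>y. tensor a b (x, y) * cnj (tensor a' b' (x, y)) \<partial>lborel \<partial>lborel)"
    unfolding l2_inner_def
    by (rule lborel_prod_integral(1)[symmetric], rule L2_inner_integrable) (intro L2_tensor assms)+
  also have "\<dots> = (\<integral>x. \<integral>y. (a x * cnj (a' x)) * (b y * cnj (b' y)) \<partial>lborel \<partial>lborel)"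
    by (simp add: tensor_def mult_ac)
  also have "\<dots> = l2_inner lborel a a' * l2_inner lborel b b'"
    unfolding l2_inner_def by simp
  finally show ?thesis .
qed

section \<open>Coefficients of tensor products\<close>

definition pairing :: "(real \<times> real \<Rightarrow> complex) \<Rightarrow> (real \<Rightarrow> complex) \<Rightarrow> real \<Rightarrow> complex" where
  "pairing \<Psi> b s = (\<integral>y. cnj (\<Psi> (s, y)) * b y \<partial>lborel)"

lemma pairing_inner: "pairing \<Psi> b s = l2_inner lborel b (\<lambda>y. \<Psi> (s, y))"
  by (simp add: pairing_def l2_inner_def mult.commute)

locale partial_fourier =
  fixes \<psi> \<Psi> :: "real \<times> real \<Rightarrow> complex"
  assumes psi_L2: "L2 lborel \<psi>"
    and partial: "partial_fourier1 \<psi> \<Psi>"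
    and supp: "AE y in lborel. ess_supp lborel (\<lambda>s. \<Psi> (s, y)) \<subseteq> {-1/2..1/2}"
begin

lemma psi_measurable: "\<psi> \<in> borel_measurable borel"
  using L2_measurable[OF psi_L2] by simp

lemma Psi_measurable: "\<Psi> \<in> borel_measurable borel"
  using partial by (simp add: partial_fourier1_def)

lemma Psi_pair_measurable [measurable]: "\<Psi> \<in> borel_measurable (borel \<Otimes>\<^sub>M borel)"
  using Psi_measurable by (simp add: borel_prod)

lemma psi_pair_measurable [measurable]: "\<psi> \<in> borel_measurable (borel \<Otimes>\<^sub>M borel)"
  using psi_measurable by (simp add: borel_prod)

text \<open>\<open>partial_fourier1\<close> only speaks about slices at fixed y. Integrating the
  slicewise norm bound over y recovers square-integrability on the plane, which justifies every
  later exchange of the two variables.\<close>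

lemma Psi_L2: "L2 lborel \<Psi>"
proof (rule L2_I_nn_integral)
  show "\<Psi> \<in> borel_measurable lborel" using Psi_measurable by simp
  note [measurable] = Psi_measurable psi_measurable
  have "(\<integral>\<^sup>+p. ennreal ((cmod (\<Psi> p))\<^sup>2) \<partial>lborel) = (\<integral>\<^sup>+y. \<integral>\<^sup>+s. ennreal ((cmod (\<Psi> (s, y)))\<^sup>2) \<partial>lborel \<partial>lborel)"
    by (rule lborel_prod_nn_integral(2)[symmetric]) measurable
  also have "\<dots> \<le> (\<integral>\<^sup>+y. \<integral>\<^sup>+x. ennreal ((cmod (\<psi> (x, y)))\<^sup>2) \<partial>lborel \<partial>lborel)"
  proof (rule nn_integral_mono_AE)
    have "AE y in lborel. fourier_L2 (\<lambda>x. \<psi> (x, y)) (\<lambda>s. \<Psi> (s, y))"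
      using partial by (simp add: partial_fourier1_def)
    then show "AE y in lborel. (\<integral>\<^sup>+s. ennreal ((cmod (\<Psi> (s, y)))\<^sup>2) \<partial>lborel) \<le> (\<integral>\<^sup>+x. ennreal ((cmod (\<psi> (x, y)))\<^sup>2) \<partial>lborel)"
    proof eventually_elim
      case (elim y)
      then have L: "L2 lborel (\<lambda>x. \<psi> (x, y))" "L2 lborel (\<lambda>s. \<Psi> (s, y))"
        by (simp_all add: fourier_L2_def)
      show ?case
        unfolding L2_nn_integral[OF L(1)] L2_nn_integral[OF L(2)]
        using fourier_L2_norm_le[OF elim] by (intro ennreal_leI power_mono) simp_all
    qed
  qed
  also have "\<dots> = (\<integral>\<^sup>+p. ennreal ((cmod (\<psi> p))\<^sup>2) \<partial>lborel)"
    by (rule lborel_prod_nn_integral(2)) measurable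
  also have "\<dots> < \<infinity>" by (simp add: L2_nn_integral[OF psi_L2])
  finally show "(\<integral>\<^sup>+p. ennreal ((cmod (\<Psi> p))\<^sup>2) \<partial>lborel) < \<infinity>" .
qed

lemma Psi_slice_L2: "AE s in lborel. L2 lborel (\<lambda>y. \<Psi> (s, y))"
  by (rule L2_slices(1)[OF Psi_L2])

text \<open>The support hypothesis is per y, whereas the pairing integrates over y at fixed s; joint
  measurability allows the two almost-everywhere quantifiers to be exchanged. The endpoints are null
  and are dropped to match the open interval of \<open>fourier_mode\<close>.\<close>

lemma Psi_vanishes: "AE s in lborel. s \<notin> {-1/2<..<1/2} \<longrightarrow> (AE y in lborel. \<Psi> (s, y) = 0)"
proof -
  have "AE y in lborel. AE s in lborel. s \<notin> {-1/2<..<1/2} \<longrightarrow> \<Psi> (s, y) = 0"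
    using supp
  proof eventually_elim
    case (elim y)
    have "AE s in lborel. s \<noteq> (-1/2::real)" "AE s in lborel. s \<noteq> (1/2::real)"
      by (rule AE_lborel_singleton)+
    then show ?case
      using AE_zero_outside_ess_supp[of lborel "\<lambda>s. \<Psi> (s, y)"]
    proof eventually_elim
      case (elim s)
      show ?case
      proof
        assume "s \<notin> {-1/2<..<1/2}"
        then have "s \<notin> {-1/2..1/2}" using elim(1,2) by auto
        then show "\<Psi> (s, y) = 0"
          using elim(3) \<open>ess_supp lborel (\<lambda>s. \<Psi> (s, y)) \<subseteq> {-1/2..1/2}\<close> by blast
      qed
    qed
  qed
  then have "AE s in lborel. AE y in lborel. s \<notin> {-1/2<..<1/2} \<longrightarrow> \<Psi> (s, y) = 0"
    by (subst lborel_pair.AE_commute) measurable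
  then show ?thesis
    by eventually_elim auto
qed

lemma pairing_measurable [measurable]:
  assumes "b \<in> borel_measurable borel"
  shows "pairing \<Psi> b \<in> borel_measurable borel"
proof -
  note [measurable] = assms
  show ?thesis unfolding pairing_def[abs_def] by measurable
qed

text \<open>By Cauchy-Schwarz in y the square is at most the squared norm of b times that of the
  slice of \<Psi> at s, whose integral over s is finite by \<open>Psi_L2\<close>.\<close>

lemma pairing_L2:
  assumes b: "L2 lborel b"
  shows "L2 lborel (pairing \<Psi> b)"
proof (rule L2_I_nn_integral)
  have [measurable]: "b \<in> borel_measurable borel" using L2_measurable[OF b] by simp
  note [measurable] = Psi_measurable
  show "pairing \<Psi> b \<in> borel_measurable lborel" by simp
  have "(\<integral>\<^sup>+s. ennreal ((cmod (pairing \<Psi> b s))\<^sup>2) \<partial>lborel)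
    \<le> (\<integral>\<^sup>+s. ennreal ((l2_norm lborel b)\<^sup>2) * (\<integral>\<^sup>+y. ennreal ((cmod (\<Psi> (s, y)))\<^sup>2) \<partial>lborel) \<partial>lborel)"
  proof (rule nn_integral_mono_AE)
    show "AE s in lborel. ennreal ((cmod (pairing \<Psi> b s))\<^sup>2) \<le> ennreal ((l2_norm lborel b)\<^sup>2) * (\<integral>\<^sup>+y. ennreal ((cmod (\<Psi> (s, y)))\<^sup>2) \<partial>lborel)"
      using Psi_slice_L2
    proof eventually_elim
      case (elim s)
      have "cmod (pairing \<Psi> b s) \<le> l2_norm lborel b * l2_norm lborel (\<lambda>y. \<Psi> (s, y))"
        unfolding pairing_inner by (rule l2_Cauchy_Schwarz[OF b elim])
      then have "(cmod (pairing \<Psi> b s))\<^sup>2 \<le> (l2_norm lborel b)\<^sup>2 * (l2_norm lborel (\<lambda>y. \<Psi> (s, y)))\<^sup>2"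
        unfolding power_mult_distrib[symmetric] by (rule power_mono) simp
      then show ?case
        unfolding L2_nn_integral[OF elim] ennreal_mult'[OF zero_le_power2, symmetric] by (rule ennreal_leI)
    qed
  qed
  also have "\<dots> = ennreal ((l2_norm lborel b)\<^sup>2) * (\<integral>\<^sup>+s. \<integral>\<^sup>+y. ennreal ((cmod (\<Psi> (s, y)))\<^sup>2) \<partial>lborel \<partial>lborel)"
    by (rule nn_integral_cmult) measurable
  also have "(\<integral>\<^sup>+s. \<integral>\<^sup>+y. ennreal ((cmod (\<Psi> (s, y)))\<^sup>2) \<partial>lborel \<partial>lborel) = ennreal ((l2_norm lborel \<Psi>)\<^sup>2)"
    unfolding L2_nn_integral[OF Psi_L2, symmetric] by (rule lborel_prod_nn_integral(1)) measurable
  finally show "(\<integral>\<^sup>+s. ennreal ((cmod (pairing \<Psi> b s))\<^sup>2) \<partial>lborel) < \<infinity>"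
    by (rule order_le_less_trans) (simp add: ennreal_mult_less_top)
qed

lemma pairing_vanishes: "AE s in lborel. s \<notin> {-1/2<..<1/2} \<longrightarrow> pairing \<Psi> b s = 0"
  using Psi_vanishes
proof eventually_elim
  case (elim s)
  show ?case
  proof
    assume "s \<notin> {-1/2<..<1/2}"
    then have "AE y in lborel. cnj (\<Psi> (s, y)) * b y = 0" using elim by auto
    then show "pairing \<Psi> b s = 0"
      unfolding pairing_def by (rule integral_eq_zero_AE)
  qed
qed

lemma psi_km_measurable: "psi_km \<psi> p \<in> borel_measurable borel"
  unfolding psi_km_def borel_prod[symmetric] by (cases p) simp

lemma psi_km_L2: "L2 lborel (psi_km \<psi> (k, m))"
proof (rule L2_I_nn_integral)
  define s where "s = 2 powr real_of_int k"
  have s: "s > 0" by (simp add: s_def)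
  note [measurable] = psi_km_measurable psi_measurable
  show "psi_km \<psi> (k, m) \<in> borel_measurable lborel" by simp
  have "(\<integral>\<^sup>+p. ennreal ((cmod (psi_km \<psi> (k, m) p))\<^sup>2) \<partial>lborel)
    = (\<integral>\<^sup>+y. \<integral>\<^sup>+x. ennreal ((cmod (psi_km \<psi> (k, m) (x, y)))\<^sup>2) \<partial>lborel \<partial>lborel)"
    by (rule lborel_prod_nn_integral(2)[symmetric]) measurable
  also have "\<dots> = (\<integral>\<^sup>+y. \<integral>\<^sup>+x. ennreal s * (ennreal ((2 powr (- real_of_int k / 2))\<^sup>2) * ennreal ((cmod (\<psi> (x, y)))\<^sup>2)) \<partial>lborel \<partial>lborel)"
  proof (rule nn_integral_cong)
    fix y :: real
    have "(\<integral>\<^sup>+x. ennreal ((cmod (psi_km \<psi> (k, m) (x, y)))\<^sup>2) \<partial>lborel)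
      = ennreal s * (\<integral>\<^sup>+x. ennreal ((cmod (psi_km \<psi> (k, m) (s * m + s * x, y)))\<^sup>2) \<partial>lborel)"
      using s by (subst nn_integral_real_affine[of _ s "s * m"]) (simp_all add: borel_measurable_slices[OF psi_km_measurable])
    also have "\<dots> = (\<integral>\<^sup>+x. ennreal s * ennreal ((cmod (psi_km \<psi> (k, m) (s * m + s * x, y)))\<^sup>2) \<partial>lborel)"
      by (rule nn_integral_cmult[symmetric]) (simp add: psi_km_def s_def[symmetric] borel_measurable_slices[OF psi_measurable])
    also have "\<dots> = (\<integral>\<^sup>+x. ennreal s * (ennreal ((2 powr (- real_of_int k / 2))\<^sup>2) * ennreal ((cmod (\<psi> (x, y)))\<^sup>2)) \<partial>lborel)"
      using s by (intro nn_integral_cong) (simp add: psi_km_def s_def[symmetric] norm_mult power_mult_distrib ennreal_mult')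
    finally show "(\<integral>\<^sup>+x. ennreal ((cmod (psi_km \<psi> (k, m) (x, y)))\<^sup>2) \<partial>lborel)
      = (\<integral>\<^sup>+x. ennreal s * (ennreal ((2 powr (- real_of_int k / 2))\<^sup>2) * ennreal ((cmod (\<psi> (x, y)))\<^sup>2)) \<partial>lborel)" .
  qed
  also have "\<dots> = (\<integral>\<^sup>+p. ennreal s * (ennreal ((2 powr (- real_of_int k / 2))\<^sup>2) * ennreal ((cmod (\<psi> p))\<^sup>2)) \<partial>lborel)"
    by (rule lborel_prod_nn_integral(2)) measurable
  also have "\<dots> = ennreal s * (ennreal ((2 powr (- real_of_int k / 2))\<^sup>2) * ennreal ((l2_norm lborel \<psi>)\<^sup>2))"
    by (subst nn_integral_cmult, measurable)+ (simp add: L2_nn_integral[OF psi_L2])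
  also have "\<dots> < \<infinity>" by (simp add: ennreal_mult_less_top)
  finally show "(\<integral>\<^sup>+p. ennreal ((cmod (psi_km \<psi> (k, m) p))\<^sup>2) \<partial>lborel) < \<infinity>" .
qed

text \<open>The substitution x = s (u + m) moves dilation and translation from \<psi> to a. Only the
  transform of the original slice is then used, so the exceptional set of y does not depend on k or
  m. The Jacobian s cancels the factor 1/s of the rescaled transform.\<close>

lemma psi_km_slice_inner:
  assumes pair: "fourier_pair a A" and four: "fourier_L2 (\<lambda>x. \<psi> (x, y)) (\<lambda>s. \<Psi> (s, y))"
    and s: "s = 2 powr real_of_int k"
  shows "(\<integral>x. a x * cnj (psi_km \<psi> (k, m) (x, y)) \<partial>lborel)
    = complex_of_real (2 powr (- real_of_int k / 2)) * (\<integral>\<eta>. A (\<eta> / s) * cis (2 * pi * m * \<eta>) * cnj (\<Psi> (\<eta>, y)) \<partial>lborel)"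
proof -
  define c where "c = complex_of_real (2 powr (- real_of_int k / 2))"
  have s0: "s > 0" by (simp add: s)
  have "(\<integral>x. a x * cnj (psi_km \<psi> (k, m) (x, y)) \<partial>lborel)
    = s *\<^sub>R (\<integral>u. a (s * m + s * u) * cnj (psi_km \<psi> (k, m) (s * m + s * u, y)) \<partial>lborel)"
    using s0 by (subst lborel_integral_real_affine[of s _ "s * m"]) simp_all
  also have "\<dots> = s *\<^sub>R (\<integral>u. c * (a (s * (u + m)) * cnj (\<psi> (u, y))) \<partial>lborel)"
  proof (intro arg_cong[where f="\<lambda>z. s *\<^sub>R z"] Bochner_Integration.integral_cong refl)
    fix u
    have "psi_km \<psi> (k, m) (s * m + s * u, y) = c * \<psi> (u, y)"
      using s0 by (simp add: psi_km_def c_def s[symmetric])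
    moreover have "s * m + s * u = s * (u + m)" by (simp add: algebra_simps)
    moreover have "cnj c = c" by (simp add: c_def)
    ultimately show "a (s * m + s * u) * cnj (psi_km \<psi> (k, m) (s * m + s * u, y)) = c * (a (s * (u + m)) * cnj (\<psi> (u, y)))"
      by simp
  qed
  also have "\<dots> = s *\<^sub>R (c * l2_inner lborel (\<lambda>u. a (s * (u + m))) (\<lambda>u. \<psi> (u, y)))"
    by (simp add: l2_inner_def)
  also have "l2_inner lborel (\<lambda>u. a (s * (u + m))) (\<lambda>u. \<psi> (u, y))
    = l2_inner lborel (\<lambda>\<eta>. complex_of_real (1 / s) * A (\<eta> / s) * cis (2 * pi * m * \<eta>)) (\<lambda>\<eta>. \<Psi> (\<eta>, y))"
    by (rule fourier_L2_inner[OF four fourier_pair_affine[OF pair s0]])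
  also have "\<dots> = complex_of_real (1 / s) * (\<integral>\<eta>. A (\<eta> / s) * cis (2 * pi * m * \<eta>) * cnj (\<Psi> (\<eta>, y)) \<partial>lborel)"
    unfolding l2_inner_def integral_mult_right_zero[symmetric] by (simp only: mult.assoc)
  also have "s *\<^sub>R (c * (complex_of_real (1 / s) * (\<integral>\<eta>. A (\<eta> / s) * cis (2 * pi * m * \<eta>) * cnj (\<Psi> (\<eta>, y)) \<partial>lborel)))
    = c * (\<integral>\<eta>. A (\<eta> / s) * cis (2 * pi * m * \<eta>) * cnj (\<Psi> (\<eta>, y)) \<partial>lborel)"
    using s0 by (simp add: scaleR_conv_of_real)
  finally show ?thesis unfolding c_def .
qed

text \<open>The slice formula is integrated against b, and the order of integration in y and the
  frequency is exchanged; the product of the tensor of T and b with the conjugate of \<Psi> is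
  integrable because both factors are in L2 of the plane.\<close>

lemma tensor_psi_km_inner:
  assumes pair: "fourier_pair a A" and b: "L2 lborel b" and s: "s = 2 powr real_of_int k"
  shows "l2_inner lborel (tensor a b) (psi_km \<psi> (k, m))
    = complex_of_real (2 powr (- real_of_int k / 2)) * (\<integral>\<eta>. A (\<eta> / s) * cis (2 * pi * m * \<eta>) * pairing \<Psi> b \<eta> \<partial>lborel)"
proof -
  define c where "c = complex_of_real (2 powr (- real_of_int k / 2))"
  define T where "T = (\<lambda>\<eta>. A (\<eta> / s) * cis (2 * pi * m * \<eta>))"
  have s0: "s > 0" by (simp add: s)
  have [measurable]: "b \<in> borel_measurable borel" using L2_measurable[OF b] by simp
  note [measurable] = fourier_pair_measurable[OF pair] psi_km_measurable Psi_measurable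
  have Tm [measurable]: "T \<in> borel_measurable borel" unfolding T_def by measurable
  \<comment> \<open>T is s times the transform of the rescaled and shifted a, and so inherits
    square-integrability from a Fourier pair.\<close>
  have T_eq: "T = (\<lambda>\<eta>. complex_of_real s * (complex_of_real (1 / s) * A (\<eta> / s) * cis (2 * pi * m * \<eta>)))"
    using s0 by (simp add: T_def mult.assoc[symmetric] of_real_mult[symmetric] del: of_real_mult)
  have TL: "L2 lborel T"
    unfolding T_eq by (rule L2_cmult[OF fourier_pair_L2(2)[OF fourier_pair_affine[OF pair s0]]])
  have int: "integrable lborel (\<lambda>p. tensor T b p * cnj (\<Psi> p))"
    by (rule L2_inner_integrable[OF L2_tensor[OF TL b] Psi_L2])
  have int2: "integrable lborel (\<lambda>p. tensor a b p * cnj (psi_km \<psi> (k, m) p))"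
    by (rule L2_inner_integrable[OF L2_tensor[OF fourier_pair_L2(1)[OF pair] b] psi_km_L2])
  have "l2_inner lborel (tensor a b) (psi_km \<psi> (k, m))
    = (\<integral>y. \<integral>x. tensor a b (x, y) * cnj (psi_km \<psi> (k, m) (x, y)) \<partial>lborel \<partial>lborel)"
    unfolding l2_inner_def by (rule lborel_prod_integral(2)[OF int2, symmetric])
  also have "\<dots> = (\<integral>y. c * (\<integral>\<eta>. tensor T b (\<eta>, y) * cnj (\<Psi> (\<eta>, y)) \<partial>lborel) \<partial>lborel)"
  proof (rule integral_cong_AE)
    have m1: "(\<lambda>p. tensor a b p * cnj (psi_km \<psi> (k, m) p)) \<in> borel_measurable (borel \<Otimes>\<^sub>M borel)"
      unfolding borel_prod by measurable
    have m2: "(\<lambda>p. tensor T b p * cnj (\<Psi> p)) \<in> borel_measurable (borel \<Otimes>\<^sub>M borel)"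
      unfolding borel_prod by measurable
    show "(\<lambda>y. \<integral>x. tensor a b (x, y) * cnj (psi_km \<psi> (k, m) (x, y)) \<partial>lborel) \<in> borel_measurable lborel"
      using m1 by measurable
    show "(\<lambda>y. c * (\<integral>\<eta>. tensor T b (\<eta>, y) * cnj (\<Psi> (\<eta>, y)) \<partial>lborel)) \<in> borel_measurable lborel"
      using m2 by measurable
    have "AE y in lborel. fourier_L2 (\<lambda>x. \<psi> (x, y)) (\<lambda>s. \<Psi> (s, y))"
      using partial by (simp add: partial_fourier1_def)
    then show "AE y in lborel. (\<integral>x. tensor a b (x, y) * cnj (psi_km \<psi> (k, m) (x, y)) \<partial>lborel)
      = c * (\<integral>\<eta>. tensor T b (\<eta>, y) * cnj (\<Psi> (\<eta>, y)) \<partial>lborel)"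
    proof eventually_elim
      case (elim y)
      have "(\<integral>x. tensor a b (x, y) * cnj (psi_km \<psi> (k, m) (x, y)) \<partial>lborel)
        = (\<integral>x. b y * (a x * cnj (psi_km \<psi> (k, m) (x, y))) \<partial>lborel)"
        by (intro Bochner_Integration.integral_cong refl) (simp add: tensor_def mult_ac)
      also have "\<dots> = b y * (c * (\<integral>\<eta>. T \<eta> * cnj (\<Psi> (\<eta>, y)) \<partial>lborel))"
        unfolding integral_mult_right_zero psi_km_slice_inner[OF pair elim s] T_def c_def ..
      also have "\<dots> = c * (\<integral>\<eta>. b y * (T \<eta> * cnj (\<Psi> (\<eta>, y))) \<partial>lborel)"
        unfolding integral_mult_right_zero by (simp only: mult_ac)
      also have "(\<integral>\<eta>. b y * (T \<eta> * cnj (\<Psi> (\<eta>, y))) \<partial>lborel) = (\<integral>\<eta>. tensor T b (\<eta>, y) * cnj (\<Psi> (\<eta>, y)) \<partial>lborel)"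
        by (intro Bochner_Integration.integral_cong refl) (simp add: tensor_def mult_ac)
      finally show ?case .
    qed
  qed
  also have "\<dots> = c * (\<integral>\<eta>. \<integral>y. tensor T b (\<eta>, y) * cnj (\<Psi> (\<eta>, y)) \<partial>lborel \<partial>lborel)"
    unfolding integral_mult_right_zero lborel_prod_integral[OF int] ..
  also have "(\<integral>\<eta>. \<integral>y. tensor T b (\<eta>, y) * cnj (\<Psi> (\<eta>, y)) \<partial>lborel \<partial>lborel) = (\<integral>\<eta>. T \<eta> * pairing \<Psi> b \<eta> \<partial>lborel)"
  proof (intro Bochner_Integration.integral_cong refl)
    fix \<eta>
    have "(\<integral>y. tensor T b (\<eta>, y) * cnj (\<Psi> (\<eta>, y)) \<partial>lborel) = (\<integral>y. T \<eta> * (cnj (\<Psi> (\<eta>, y)) * b y) \<partial>lborel)"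
      by (intro Bochner_Integration.integral_cong refl) (simp add: tensor_def mult_ac)
    then show "(\<integral>y. tensor T b (\<eta>, y) * cnj (\<Psi> (\<eta>, y)) \<partial>lborel) = T \<eta> * pairing \<Psi> b \<eta>"
      unfolding integral_mult_right_zero pairing_def .
  qed
  finally show ?thesis unfolding c_def T_def .
qed

text \<open>The function whose Fourier coefficients are computed at scale k, dilated back so that A
  is evaluated at the same point \<xi> for all k; only then can the sum over k be taken under one
  integral.\<close>

definition scale_component :: "int \<Rightarrow> (real \<Rightarrow> complex) \<Rightarrow> (real \<Rightarrow> complex) \<Rightarrow> real \<Rightarrow> complex" where
  "scale_component k A b \<xi> = A \<xi> * pairing \<Psi> b (2 powr real_of_int k * \<xi>)"

text \<open>At a fixed scale this is Parseval on the unit interval and holds without either side of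
  the equivalence. It is the exact point where the support condition enters.\<close>

lemma tensor_psi_km_expansion:
  assumes pair: "fourier_pair a A" and b: "L2 lborel b" and pair': "fourier_pair a' A'" and b': "L2 lborel b'"
  shows "((\<lambda>m. l2_inner lborel (tensor a b) (psi_km \<psi> (k, m)) * l2_inner lborel (psi_km \<psi> (k, m)) (tensor a' b'))
    has_sum l2_inner lborel (scale_component k A b) (scale_component k A' b')) UNIV"
proof -
  define s where "s = 2 powr real_of_int k"
  have s0: "s > 0" by (simp add: s_def)
  let ?I = "{-1/2<..<1/2::real}"
  define c where "c = complex_of_real (2 powr (- real_of_int k / 2))"
  \<comment> \<open>Parseval requires vanishing everywhere outside the interval, whereas the pairing
    vanishes there only almost everywhere; the indicator bridges the two without changing any
    integral.\<close>
  define h where "h A b \<eta> = indicator ?I \<eta> * (A (\<eta> / s) * pairing \<Psi> b \<eta>)" for A b \<eta>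
  have h: "L2 lborel (h A b)"
    "l2_inner lborel (tensor a b) (psi_km \<psi> (k, m)) = c * l2_inner lborel (h A b) (fourier_mode m)"
    if p: "fourier_pair a A" and b: "L2 lborel b" for a A b m
  proof -
    have bm [measurable]: "b \<in> borel_measurable borel" using L2_measurable[OF b] by simp
    note [measurable] = fourier_pair_measurable[OF p]
    have "L2 lborel (\<lambda>\<eta>. (indicator ?I \<eta> * A (\<eta> / s)) * pairing \<Psi> b \<eta>)"
    proof (rule L2_bounded_mult[OF pairing_L2[OF b]])
      show "cmod (indicator ?I \<eta> * A (\<eta> / s)) \<le> (\<integral>x. cmod (a x) \<partial>lborel)" for \<eta>
        using fourier_pair_bounded(2)[OF p, of "\<eta> / s"] by (auto simp: indicator_def)
    qed measurable
    then show "L2 lborel (h A b)" unfolding h_def by (simp only: mult.assoc)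
    have "l2_inner lborel (h A b) (fourier_mode m) = (\<integral>\<eta>. A (\<eta> / s) * cis (2 * pi * m * \<eta>) * pairing \<Psi> b \<eta> \<partial>lborel)"
      unfolding l2_inner_def
    proof (rule integral_cong_AE)
      show "AE \<eta> in lborel. h A b \<eta> * cnj (fourier_mode m \<eta>) = A (\<eta> / s) * cis (2 * pi * m * \<eta>) * pairing \<Psi> b \<eta>"
        using pairing_vanishes[of b]
      proof eventually_elim
        case (elim \<eta>)
        then show ?case
          by (cases "\<eta> \<in> ?I") (auto simp: h_def fourier_mode_def cis_cnj mult_ac)
      qed
    qed (unfold h_def, measurable)
    then show "l2_inner lborel (tensor a b) (psi_km \<psi> (k, m)) = c * l2_inner lborel (h A b) (fourier_mode m)"
      unfolding tensor_psi_km_inner[OF p b s_def] c_def by simp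
  qed
  have parseval: "((\<lambda>m. l2_inner lborel (h A b) (fourier_mode m) * l2_inner lborel (fourier_mode m) (h A' b'))
      has_sum l2_inner lborel (h A b) (h A' b')) UNIV"
    by (rule fourier_series_Parseval[OF h(1)[OF pair b] h(1)[OF pair' b']]) (simp_all add: h_def)
  \<comment> \<open>The normalization 2^(-k/2) occurs once in each coefficient; the resulting 1/s
    compensates the Jacobian of \<eta> = s \<xi>.\<close>
  have cc: "c * cnj c = complex_of_real (1 / s)"
    unfolding c_def s_def complex_cnj_complex_of_real of_real_mult[symmetric] powr_add[symmetric]
    by (simp add: powr_minus_divide)
  have "c * l2_inner lborel (h A b) (fourier_mode m) * (cnj c * l2_inner lborel (fourier_mode m) (h A' b'))
    = complex_of_real (1 / s) * (l2_inner lborel (h A b) (fourier_mode m) * l2_inner lborel (fourier_mode m) (h A' b'))" for m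
    unfolding cc[symmetric] by (simp only: mult_ac)
  moreover have "l2_inner lborel (psi_km \<psi> (k, m)) (tensor a' b') = cnj c * l2_inner lborel (fourier_mode m) (h A' b')" for m
    by (subst l2_inner_commute, subst h(2)[OF pair' b'], subst l2_inner_commute[of _ _ "h A' b'"]) simp
  moreover have "complex_of_real (1 / s) * l2_inner lborel (h A b) (h A' b') = l2_inner lborel (scale_component k A b) (scale_component k A' b')"
  proof -
    have [measurable]: "b \<in> borel_measurable borel" "b' \<in> borel_measurable borel"
      using L2_measurable[OF b] L2_measurable[OF b'] by simp_all
    note [measurable] = fourier_pair_measurable[OF pair] fourier_pair_measurable[OF pair']
    have "l2_inner lborel (h A b) (h A' b') = (\<integral>\<eta>. A (\<eta> / s) * pairing \<Psi> b \<eta> * cnj (A' (\<eta> / s) * pairing \<Psi> b' \<eta>) \<partial>lborel)"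
      unfolding l2_inner_def
    proof (rule integral_cong_AE)
      show "AE \<eta> in lborel. h A b \<eta> * cnj (h A' b' \<eta>) = A (\<eta> / s) * pairing \<Psi> b \<eta> * cnj (A' (\<eta> / s) * pairing \<Psi> b' \<eta>)"
        using pairing_vanishes[of b]
        by eventually_elim (auto simp: h_def indicator_def)
      show "(\<lambda>\<eta>. h A b \<eta> * cnj (h A' b' \<eta>)) \<in> borel_measurable lborel"
        unfolding h_def by measurable
    qed measurable
    also have "\<dots> = s *\<^sub>R l2_inner lborel (scale_component k A b) (scale_component k A' b')"
      unfolding l2_inner_def scale_component_def s_def[symmetric]
      using s0 by (subst lborel_integral_real_affine[of s _ 0]) simp_all
    finally show ?thesis using s0 by (simp add: scaleR_conv_of_real)
  qed
  ultimately show ?thesis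
    using has_sum_cmult_right[OF parseval, of "complex_of_real (1 / s)"] unfolding h(2)[OF pair b] by simp
qed

end

section \<open>Density of tensor products\<close>

lemma integrable_count_space_iff:
  fixes f :: "'i \<Rightarrow> complex"
  shows "integrable (count_space UNIV) f \<longleftrightarrow> f summable_on UNIV"
    and "integrable (count_space UNIV) f \<Longrightarrow> integral\<^sup>L (count_space UNIV) f = infsum f UNIV"
proof -
  have "integrable (count_space UNIV) f \<longleftrightarrow> Infinite_Set_Sum.abs_summable_on f UNIV"
    by (simp add: Infinite_Set_Sum.abs_summable_on_def)
  also have "\<dots> \<longleftrightarrow> (\<lambda>x. norm (f x)) summable_on UNIV"
    by (rule abs_summable_equivalent[symmetric])
  also have "\<dots> \<longleftrightarrow> f summable_on UNIV"
    by (rule summable_on_iff_abs_summable_on_complex[symmetric])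
  finally show "integrable (count_space UNIV) f \<longleftrightarrow> f summable_on UNIV" .
  show "integral\<^sup>L (count_space UNIV) f = infsum f UNIV" if "integrable (count_space UNIV) f"
    using infsetsum_infsum[of f UNIV] that
    by (simp add: Infinite_Set_Sum.abs_summable_on_def infsetsum_def)
qed

lemma has_sum_count_space_iff:
  fixes f :: "'i \<Rightarrow> complex"
  shows "(f has_sum c) UNIV \<longleftrightarrow> integrable (count_space UNIV) f \<and> integral\<^sup>L (count_space UNIV) f = c"
  using integrable_count_space_iff[of f] by (auto simp: has_sum_iff)

lemma reproducing_iff_has_sum:
  "reproducing M \<Phi> \<longleftrightarrow> (\<forall>f g. L2 M f \<longrightarrow> L2 M g \<longrightarrow>
     ((\<lambda>p. l2_inner M f (\<Phi> p) * l2_inner M (\<Phi> p) g) has_sum l2_inner M f g) UNIV)"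
  unfolding reproducing_def has_sum_count_space_iff ..

text \<open>The passage between \<open>ennreal\<close> sums, in which Tonelli is applied, and
  \<open>has_sum\<close>, in which the identities are stated. A finite real value c is what makes
  the two equivalent.\<close>

lemma nn_integral_count_space_eq_iff:
  fixes g :: "'i \<Rightarrow> real"
  assumes g: "\<And>i. 0 \<le> g i" and c: "0 \<le> c"
  shows "(\<integral>\<^sup>+i. ennreal (g i) \<partial>count_space UNIV) = ennreal c \<longleftrightarrow> (g has_sum c) UNIV"
proof -
  have "(g has_sum c) UNIV \<longleftrightarrow> ((\<lambda>i. complex_of_real (g i)) has_sum complex_of_real c) UNIV"
    by (rule has_sum_of_real_iff[symmetric])
  also have "\<dots> \<longleftrightarrow> integrable (count_space UNIV) g \<and> integral\<^sup>L (count_space UNIV) g = c"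
    unfolding has_sum_count_space_iff by (simp add: complex_of_real_integrable_eq)
  also have "\<dots> \<longleftrightarrow> (\<integral>\<^sup>+i. ennreal (g i) \<partial>count_space UNIV) = ennreal c"
  proof
    assume "integrable (count_space UNIV) g \<and> integral\<^sup>L (count_space UNIV) g = c"
    then show "(\<integral>\<^sup>+i. ennreal (g i) \<partial>count_space UNIV) = ennreal c"
      using nn_integral_eq_integral[of "count_space UNIV" g] g by auto
  next
    assume eq: "(\<integral>\<^sup>+i. ennreal (g i) \<partial>count_space UNIV) = ennreal c"
    have int: "integrable (count_space UNIV) g"
      by (rule integrableI_nonneg) (use g eq in auto)
    have "ennreal (integral\<^sup>L (count_space UNIV) g) = ennreal c"
      using nn_integral_eq_integral[OF int] g eq by simp
    then show "integrable (count_space UNIV) g \<and> integral\<^sup>L (count_space UNIV) g = c"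
      using int c g by (simp add: ennreal_inj integral_nonneg)
  qed
  finally show ?thesis by blast
qed

text \<open>The difference w - v has integral 0. Finiteness of the integral of v permits the
  cancellation in \<open>ennreal\<close>.\<close>

lemma nn_integral_le_AE:
  fixes w v :: "'a \<Rightarrow> ennreal"
  assumes [measurable]: "w \<in> borel_measurable M" "v \<in> borel_measurable M"
    and "AE x in M. v x \<le> w x" and "(\<integral>\<^sup>+x. w x \<partial>M) \<le> (\<integral>\<^sup>+x. v x \<partial>M)" and "(\<integral>\<^sup>+x. v x \<partial>M) < \<infinity>"
  shows "AE x in M. w x \<le> v x"
proof -
  have "(\<integral>\<^sup>+x. v x \<partial>M) + (\<integral>\<^sup>+x. w x - v x \<partial>M) = (\<integral>\<^sup>+x. v x + (w x - v x) \<partial>M)"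
    by (rule nn_integral_add[symmetric]) measurable
  also have "\<dots> = (\<integral>\<^sup>+x. w x \<partial>M)"
    by (rule nn_integral_cong_AE) (use assms(3) in \<open>eventually_elim, simp add: add_diff_inverse_ennreal\<close>)
  also have "\<dots> \<le> (\<integral>\<^sup>+x. v x \<partial>M) + 0" using assms(4) by simp
  finally have "(\<integral>\<^sup>+x. w x - v x \<partial>M) = 0"
    using assms(5) by (subst (asm) ennreal_add_left_cancel_le) auto
  then have "AE x in M. w x - v x = 0"
    by (subst (asm) nn_integral_0_iff_AE) measurable
  then show ?thesis
    by eventually_elim (simp add: diff_eq_0_iff_ennreal order_less_imp_le)
qed

text \<open>The functions that satisfy the integral identity include an \<open>L\<^sup>2\<close>-dense set; Fatou's
  lemma extends one inequality to indicators, and the Gaussian, which vanishes nowhere, turns the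
  resulting bound on \<open>w\<close> into an equality.\<close>

lemma AE_eq_const_of_fourier_pair:
  fixes w :: "real \<Rightarrow> ennreal"
  assumes w [measurable]: "w \<in> borel_measurable borel" and C: "0 \<le> C"
    and eq: "\<And>a A. fourier_pair a A \<Longrightarrow>
      (\<integral>\<^sup>+\<xi>. ennreal ((cmod (A \<xi>))\<^sup>2) * w \<xi> \<partial>lborel) = ennreal (C * (l2_norm lborel A)\<^sup>2)"
  shows "AE \<xi> in lborel. w \<xi> = ennreal C"
proof -
  have le: "(\<integral>\<^sup>+\<xi>. indicator E \<xi> * w \<xi> \<partial>lborel) \<le> ennreal (C * (l2_norm lborel (indicator E))\<^sup>2)"
    if E [measurable]: "E \<in> sets borel" and E2: "L2 lborel (indicator E)" for E :: "real set"
  proof -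
    obtain A where A: "\<forall>n::nat. A n \<in> fourier_image \<and> L2 lborel (A n)"
      "(\<lambda>n. l2_norm lborel (\<lambda>x. A n x - indicator E x)) \<longlonglongrightarrow> 0"
      using l2_closure_seq[OF L2_mem_closure_fourier_image[OF E2]] by blast
    obtain r :: "nat \<Rightarrow> nat" where r: "strict_mono r" "AE x in lborel. (\<lambda>n. A (r n) x) \<longlonglongrightarrow> indicator E x"
      using l2_norm_tendsto_AE_subseq[OF _ E2 A(2)] A(1) by blast
    have Am [measurable]: "A n \<in> borel_measurable borel" for n
      using A(1) L2_measurable[of lborel "A n"] by simp
    define u where "u n \<xi> = ennreal ((cmod (A (r n) \<xi>))\<^sup>2) * w \<xi>" for n \<xi>
    have u_eq: "(\<integral>\<^sup>+\<xi>. u n \<xi> \<partial>lborel) = ennreal (C * (l2_norm lborel (A (r n)))\<^sup>2)" for n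
    proof -
      \<comment> \<open>The approximants are taken from \<open>fourier_image\<close> but must act as
        transforms; \<open>fourier_pair_swap\<close> makes them so.\<close>
      obtain B where "fourier_pair (A (r n)) B" using A(1) by (auto simp: fourier_image_def)
      from eq[OF fourier_pair_swap[OF this]] show ?thesis unfolding u_def .
    qed
    have "(\<integral>\<^sup>+\<xi>. indicator E \<xi> * w \<xi> \<partial>lborel) \<le> (\<integral>\<^sup>+\<xi>. liminf (\<lambda>n. u n \<xi>) \<partial>lborel)"
    proof (rule nn_integral_mono_AE)
      show "AE \<xi> in lborel. indicator E \<xi> * w \<xi> \<le> liminf (\<lambda>n. u n \<xi>)"
        using r(2)
      proof eventually_elim
        case (elim \<xi>)
        show ?case
        proof (cases "\<xi> \<in> E")
          case True
          then have "(\<lambda>n. (cmod (A (r n) \<xi>))\<^sup>2) \<longlonglongrightarrow> (cmod 1)\<^sup>2"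
            using elim by (intro tendsto_power tendsto_norm) simp
          then have "(\<lambda>n. ennreal ((cmod (A (r n) \<xi>))\<^sup>2)) \<longlonglongrightarrow> ennreal ((cmod 1)\<^sup>2)"
            by (rule tendsto_ennrealI)
          then have "(\<lambda>n. u n \<xi>) \<longlonglongrightarrow> ennreal ((cmod 1)\<^sup>2) * w \<xi>"
            unfolding u_def by (intro tendsto_mult_ennreal tendsto_const) auto
          then have "liminf (\<lambda>n. u n \<xi>) = ennreal ((cmod 1)\<^sup>2) * w \<xi>"
            by (intro lim_imp_Liminf) auto
          then show ?thesis using True by simp
        qed simp
      qed
    qed
    also have "\<dots> \<le> liminf (\<lambda>n. \<integral>\<^sup>+\<xi>. u n \<xi> \<partial>lborel)"
      by (rule nn_integral_liminf) (unfold u_def, measurable)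
    also have "\<dots> = ennreal (C * (l2_norm lborel (indicator E))\<^sup>2)"
      unfolding u_eq
    proof (rule lim_imp_Liminf)
      have "(\<lambda>n. l2_norm lborel (A (r n))) \<longlonglongrightarrow> l2_norm lborel (indicator E)"
        using LIMSEQ_subseq_LIMSEQ[OF tendsto_l2_norm[OF _ E2 A(2)] r(1)] A(1) by (simp add: o_def)
      then show "(\<lambda>n. ennreal (C * (l2_norm lborel (A (r n)))\<^sup>2)) \<longlonglongrightarrow> ennreal (C * (l2_norm lborel (indicator E))\<^sup>2)"
        by (intro tendsto_ennrealI tendsto_mult tendsto_const tendsto_power)
    qed simp
    finally show ?thesis .
  qed
  have ind: "AE \<xi> in lborel. \<xi> \<in> {-real n..real n} \<longrightarrow> w \<xi> \<le> ennreal C" for n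
  proof -
    \<comment> \<open>On the set where w exceeds C, the bound \<open>le\<close> says that the
      integral of w is at most that of C, so equality holds almost everywhere and the set is null.
      Restriction to a bounded interval makes its measure finite.\<close>
    define E where "E = {\<xi> \<in> {-real n..real n}. ennreal C < w \<xi>}"
    have E [measurable]: "E \<in> sets borel"
      unfolding E_def by measurable
    have "bounded E"
      by (rule bounded_subset[of "{-real n..real n}"]) (auto simp: E_def)
    then have fin: "emeasure lborel E < \<infinity>"
      by (rule emeasure_bounded_finite)
    then have E2: "L2 lborel (indicator E)"
      by (intro L2_indicator) auto
    have v: "(\<integral>\<^sup>+\<xi>. indicator E \<xi> * ennreal C \<partial>lborel) = ennreal (C * (l2_norm lborel (indicator E))\<^sup>2)"
    proof -
      have "(\<integral>\<^sup>+\<xi>. indicator E \<xi> * ennreal C \<partial>lborel) = (\<integral>\<^sup>+\<xi>. ennreal C * ennreal ((cmod (indicator E \<xi>))\<^sup>2) \<partial>lborel)"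
        by (intro nn_integral_cong) (simp add: indicator_def)
      also have "\<dots> = ennreal C * ennreal ((l2_norm lborel (indicator E))\<^sup>2)"
        by (subst nn_integral_cmult) (simp_all add: L2_nn_integral[OF E2])
      finally show ?thesis using C by (simp add: ennreal_mult')
    qed
    have "AE \<xi> in lborel. indicator E \<xi> * w \<xi> \<le> indicator E \<xi> * ennreal C"
    proof (rule nn_integral_le_AE)
      show "AE \<xi> in lborel. indicator E \<xi> * ennreal C \<le> indicator E \<xi> * w \<xi>"
        by (intro AE_I2) (auto simp: indicator_def E_def order_less_imp_le)
      show "(\<integral>\<^sup>+\<xi>. indicator E \<xi> * w \<xi> \<partial>lborel) \<le> (\<integral>\<^sup>+\<xi>. indicator E \<xi> * ennreal C \<partial>lborel)"
        using le[OF E E2] v by simp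
      show "(\<integral>\<^sup>+\<xi>. indicator E \<xi> * ennreal C \<partial>lborel) < \<infinity>"
        unfolding v by simp
    qed measurable
    then show ?thesis
    proof eventually_elim
      case (elim \<xi>)
      then show ?case by (cases "\<xi> \<in> E") (auto simp: E_def not_less)
    qed
  qed
  then have "AE \<xi> in lborel. \<forall>n::nat. \<xi> \<in> {-real n..real n} \<longrightarrow> w \<xi> \<le> ennreal C"
    by (subst AE_all_countable) blast
  then have upper: "AE \<xi> in lborel. w \<xi> \<le> ennreal C"
  proof eventually_elim
    case (elim \<xi>)
    obtain n :: nat where "\<bar>\<xi>\<bar> \<le> real n" using real_arch_simple by blast
    then have "\<xi> \<in> {-real n..real n}" unfolding atLeastAtMost_iff by linarith
    then show ?case using elim by blast
  qed
  define G where "G \<xi> = ennreal ((cmod (complex_of_real (gaussian \<xi>)))\<^sup>2)" for \<xi>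
  have Gm [measurable]: "G \<in> borel_measurable borel" unfolding G_def by measurable
  have Gw: "(\<integral>\<^sup>+\<xi>. G \<xi> * w \<xi> \<partial>lborel) = ennreal (C * (l2_norm lborel (\<lambda>x. complex_of_real (gaussian x)))\<^sup>2)"
    unfolding G_def by (rule eq[OF fourier_pair_gaussian])
  have GC: "(\<integral>\<^sup>+\<xi>. G \<xi> * ennreal C \<partial>lborel) = ennreal (C * (l2_norm lborel (\<lambda>x. complex_of_real (gaussian x)))\<^sup>2)"
  proof -
    have "(\<integral>\<^sup>+\<xi>. G \<xi> * ennreal C \<partial>lborel) = (\<integral>\<^sup>+\<xi>. G \<xi> \<partial>lborel) * ennreal C"
      by (rule nn_integral_multc) simp
    also have "(\<integral>\<^sup>+\<xi>. G \<xi> \<partial>lborel) = ennreal ((l2_norm lborel (\<lambda>x. complex_of_real (gaussian x)))\<^sup>2)"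
      unfolding G_def by (rule L2_nn_integral[OF fourier_pair_L2(1)[OF fourier_pair_gaussian]])
    finally show ?thesis using C by (simp add: ennreal_mult' mult.commute)
  qed
  have "AE \<xi> in lborel. G \<xi> * ennreal C \<le> G \<xi> * w \<xi>"
  proof (rule nn_integral_le_AE)
    show "AE \<xi> in lborel. G \<xi> * w \<xi> \<le> G \<xi> * ennreal C"
      using upper by eventually_elim (rule mult_left_mono, simp_all)
    show "(\<integral>\<^sup>+\<xi>. G \<xi> * ennreal C \<partial>lborel) \<le> (\<integral>\<^sup>+\<xi>. G \<xi> * w \<xi> \<partial>lborel)"
      unfolding Gw GC ..
    show "(\<integral>\<^sup>+\<xi>. G \<xi> * w \<xi> \<partial>lborel) < \<infinity>"
      unfolding Gw by simp
  qed measurable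
  then show ?thesis
    using upper
  proof eventually_elim
    case (elim \<xi>)
    have "ennreal C \<le> w \<xi>"
      using elim(1) by (subst (asm) ennreal_mult_le_mult_iff) (auto simp: G_def gaussian_def)
    with elim(2) show ?case by simp
  qed
qed

section \<open>Tensor products span a dense subspace of L2 of the plane\<close>

lemma l2_norm_tensor:
  fixes a :: "'a::euclidean_space \<Rightarrow> complex" and b :: "'b::euclidean_space \<Rightarrow> complex"
  assumes "L2 lborel a" "L2 lborel b"
  shows "l2_norm lborel (tensor a b) = l2_norm lborel a * l2_norm lborel b"
proof -
  have "complex_of_real ((l2_norm lborel (tensor a b))\<^sup>2) = complex_of_real ((l2_norm lborel a * l2_norm lborel b)\<^sup>2)"
    using l2_inner_tensor[OF assms assms] by (simp only: l2_inner_self of_real_mult[symmetric] power_mult_distrib)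
  then have "(l2_norm lborel (tensor a b))\<^sup>2 = (l2_norm lborel a * l2_norm lborel b)\<^sup>2"
    by (simp only: of_real_eq_iff)
  then show ?thesis by (rule power2_eq_imp_eq) simp_all
qed

text \<open>Only the first factor comes from a Fourier pair, since the transform acts in the first
  variable alone; the second ranges over all of L2.\<close>

definition fourier_tensors :: "(real \<times> real \<Rightarrow> complex) set" where
  "fourier_tensors = {tensor a b | a b. a \<in> fourier_image \<and> L2 lborel b}"

lemma fourier_image_L2: "a \<in> fourier_image \<Longrightarrow> L2 lborel a"
  using fourier_pair_L2(1) by (auto simp: fourier_image_def)

lemma tensor_mem_closure:
  assumes u: "L2 lborel u" and b: "L2 lborel b"
  shows "tensor u b \<in> l2_closure lborel (linear_hull fourier_tensors)"
proof -
  obtain a where a: "\<forall>n::nat. a n \<in> fourier_image \<and> L2 lborel (a n)"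
    "(\<lambda>n. l2_norm lborel (\<lambda>x. a n x - u x)) \<longlonglongrightarrow> 0"
    using l2_closure_seq[OF L2_mem_closure_fourier_image[OF u]] by blast
  show ?thesis
  proof (rule l2_closure_limit[where f="\<lambda>n. tensor (a n) b"])
    show "tensor (a n) b \<in> l2_closure lborel (linear_hull fourier_tensors)" for n
      using a(1) b by (intro l2_closure_superset linear_hull.base L2_tensor) (auto simp: fourier_tensors_def)
    show "L2 lborel (tensor u b)" by (rule L2_tensor[OF u b])
    have "(\<lambda>p. tensor (a n) b p - tensor u b p) = tensor (\<lambda>x. a n x - u x) b" for n
      by (auto simp: tensor_def left_diff_distrib)
    then have "l2_norm lborel (\<lambda>p. tensor (a n) b p - tensor u b p) = l2_norm lborel (\<lambda>x. a n x - u x) * l2_norm lborel b" for n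
      using l2_norm_tensor[OF L2_diff[of lborel "a n" u] b] a(1) u by simp
    then show "(\<lambda>n. l2_norm lborel (\<lambda>p. tensor (a n) b p - tensor u b p)) \<longlonglongrightarrow> 0"
      using tendsto_mult[OF a(2) tendsto_const[of "l2_norm lborel b"]] by simp
  qed
qed

text \<open>A box in the plane is a product of intervals, so its indicator is a tensor; truncation
  to growing boxes supplies the sets of finite measure.\<close>

lemma L2_mem_closure_fourier_tensors:
  fixes f :: "real \<times> real \<Rightarrow> complex"
  assumes f: "L2 lborel f"
  shows "f \<in> l2_closure lborel (linear_hull fourier_tensors)"
proof (rule l2_closure_truncation[OF f])
  fix n :: nat
  let ?B = "box (- (real n *\<^sub>R One)) (real n *\<^sub>R One) :: (real \<times> real) set"
  have box: "box p q = {fst p<..<fst q} \<times> {snd p<..<snd q}" for p q :: "real \<times> real"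
    by (simp add: box_prod[of p q])
  show "(\<lambda>x. indicator ?B x * f x) \<in> l2_closure lborel (linear_hull fourier_tensors)"
  proof (rule mem_l2_closure_vanishing_outside[OF linear_space_linear_hull])
    show "emeasure lborel ?B < \<infinity>" by (rule emeasure_bounded_finite[OF bounded_box])
    show "L2 lborel (\<lambda>x. indicator ?B x * f x)"
      by (rule L2_bounded_mult[OF f, where B=1]) (auto simp: indicator_def)
    show "indicator (box p q \<inter> ?B) \<in> l2_closure lborel (linear_hull fourier_tensors)" for p q
    proof -
      let ?X = "{fst p<..<fst q} \<inter> {fst (- (real n *\<^sub>R One :: real \<times> real))<..<fst (real n *\<^sub>R One :: real \<times> real)}"
      let ?Y = "{snd p<..<snd q} \<inter> {snd (- (real n *\<^sub>R One :: real \<times> real))<..<snd (real n *\<^sub>R One :: real \<times> real)}"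
      have "indicator (box p q \<inter> ?B) = tensor (indicator ?X) (indicator ?Y)"
        unfolding box by (auto simp: tensor_def indicator_def fun_eq_iff)
      moreover have "tensor (indicator ?X) (indicator ?Y) \<in> l2_closure lborel (linear_hull fourier_tensors)"
        by (intro tensor_mem_closure L2_indicator emeasure_bounded_finite bounded_Int) auto
      ultimately show ?thesis by simp
    qed
  qed auto
qed

section \<open>The pointwise expansion\<close>

context partial_fourier
begin

text \<open>Valued in \<open>ennreal\<close> because finiteness of the sum over scales is part of
  what has to be shown.\<close>

definition weight :: "(real \<Rightarrow> complex) \<Rightarrow> real \<Rightarrow> ennreal" where
  "weight b \<xi> = (\<integral>\<^sup>+k. ennreal ((cmod (pairing \<Psi> b (2 powr real_of_int k * \<xi>)))\<^sup>2) \<partial>count_space (UNIV :: int set))"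

lemma weight_measurable:
  assumes "L2 lborel b"
  shows "weight b \<in> borel_measurable borel"
proof -
  have [measurable]: "b \<in> borel_measurable borel" using L2_measurable[OF assms] by simp
  interpret sigma_finite_measure "count_space (UNIV :: int set)"
    by (rule sigma_finite_measure_count_space)
  have "(\<lambda>p. ennreal ((cmod (pairing \<Psi> b (2 powr real_of_int (fst p) * snd p)))\<^sup>2)) \<in> borel_measurable (count_space (UNIV :: int set) \<Otimes>\<^sub>M borel)"
    by (rule measurable_pair_measure_countable1) simp_all
  then have "(\<lambda>(\<xi>, k). ennreal ((cmod (pairing \<Psi> b (2 powr real_of_int k * \<xi>)))\<^sup>2)) \<in> borel_measurable (borel \<Otimes>\<^sub>M count_space (UNIV :: int set))"
    using measurable_compose[OF measurable_pair_swap'] by (simp add: split_def)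
  then show ?thesis
    unfolding weight_def[abs_def] by (rule borel_measurable_nn_integral)
qed

lemma scale_component_L2:
  assumes pair: "fourier_pair a A" and b: "L2 lborel b"
  shows "L2 lborel (scale_component k A b)"
  unfolding scale_component_def[abs_def]
proof (rule L2_bounded_mult)
  note [measurable] = fourier_pair_measurable[OF pair]
  show "A \<in> borel_measurable lborel" by simp
  show "cmod (A x) \<le> (\<integral>x. cmod (a x) \<partial>lborel)" for x by (rule fourier_pair_bounded(2)[OF pair])
  have "integrable lborel (\<lambda>\<xi>. (cmod (pairing \<Psi> b (0 + 2 powr real_of_int k * \<xi>)))\<^sup>2)"
    by (rule lborel_integrable_real_affine[OF L2_integrable[OF pairing_L2[OF b]]]) simp
  moreover have "(\<lambda>\<xi>. pairing \<Psi> b (2 powr real_of_int k * \<xi>)) \<in> borel_measurable borel"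
    using L2_measurable[OF b] by simp
  ultimately show "L2 lborel (\<lambda>\<xi>. pairing \<Psi> b (2 powr real_of_int k * \<xi>))"
    by (simp add: L2_def)
qed

lemma nn_integral_scale_component:
  assumes pair: "fourier_pair a A" and b: "L2 lborel b"
  shows "(\<integral>\<^sup>+k. \<integral>\<^sup>+\<xi>. ennreal ((cmod (scale_component k A b \<xi>))\<^sup>2) \<partial>lborel \<partial>count_space UNIV)
    = (\<integral>\<^sup>+\<xi>. ennreal ((cmod (A \<xi>))\<^sup>2) * weight b \<xi> \<partial>lborel)"
proof -
  have [measurable]: "scale_component k A b \<in> borel_measurable borel" for k
    using L2_measurable[OF scale_component_L2[OF pair b]] by simp
  have "(\<integral>\<^sup>+k. \<integral>\<^sup>+\<xi>. ennreal ((cmod (scale_component k A b \<xi>))\<^sup>2) \<partial>lborel \<partial>count_space UNIV)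
    = (\<integral>\<^sup>+\<xi>. \<integral>\<^sup>+k. ennreal ((cmod (scale_component k A b \<xi>))\<^sup>2) \<partial>count_space UNIV \<partial>lborel)"
    by (rule nn_integral_count_space_nn_integral[symmetric]) simp_all
  also have "\<dots> = (\<integral>\<^sup>+\<xi>. ennreal ((cmod (A \<xi>))\<^sup>2) * weight b \<xi> \<partial>lborel)"
    unfolding weight_def scale_component_def
    by (intro nn_integral_cong, subst nn_integral_cmult[symmetric])
      (simp_all add: norm_mult power_mult_distrib ennreal_mult')
  finally show ?thesis .
qed

text \<open>All terms are nonnegative, so the sums over m and k and the integral may be rearranged
  with no convergence hypothesis. Both directions of the equivalence start from this
  identity.\<close>

lemma tensor_psi_km_square_sum:
  assumes pair: "fourier_pair a A" and b: "L2 lborel b"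
  shows "(\<integral>\<^sup>+p. ennreal ((cmod (l2_inner lborel (tensor a b) (psi_km \<psi> p)))\<^sup>2) \<partial>count_space UNIV)
    = (\<integral>\<^sup>+\<xi>. ennreal ((cmod (A \<xi>))\<^sup>2) * weight b \<xi> \<partial>lborel)"
proof -
  have "(\<integral>\<^sup>+m. ennreal ((cmod (l2_inner lborel (tensor a b) (psi_km \<psi> (k, m))))\<^sup>2) \<partial>count_space UNIV)
    = (\<integral>\<^sup>+\<xi>. ennreal ((cmod (scale_component k A b \<xi>))\<^sup>2) \<partial>lborel)" for k
    unfolding L2_nn_integral[OF scale_component_L2[OF pair b]]
    using tensor_psi_km_expansion[OF pair b pair b, of k]
    unfolding l2_inner_mult_commute l2_inner_self has_sum_of_real_iff
    by (subst nn_integral_count_space_eq_iff) simp_all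
  then show ?thesis
    unfolding nn_integral_scale_component[OF pair b, symmetric]
    by (simp add: nn_integral_fst_count_space[symmetric])
qed

text \<open>With b fixed and a varying, the reproducing identity on the diagonal says that
  \<open>weight b\<close> integrates against every |A|^2 like a constant, and
  \<open>AE_eq_const_of_fourier_pair\<close> concludes.\<close>

lemma reproducing_imp_weight:
  assumes rep: "reproducing lborel (psi_km \<psi>)" and b: "L2 lborel b"
  shows "AE \<xi> in lborel. weight b \<xi> = ennreal ((l2_norm lborel b)\<^sup>2)"
proof (rule AE_eq_const_of_fourier_pair[OF weight_measurable[OF b]])
  fix a A assume pair: "fourier_pair a A"
  have "((\<lambda>p. l2_inner lborel (tensor a b) (psi_km \<psi> p) * l2_inner lborel (psi_km \<psi> p) (tensor a b))
      has_sum l2_inner lborel (tensor a b) (tensor a b)) UNIV"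
    using rep L2_tensor[OF fourier_pair_L2(1)[OF pair] b] unfolding reproducing_iff_has_sum by blast
  then have "((\<lambda>p. (cmod (l2_inner lborel (tensor a b) (psi_km \<psi> p)))\<^sup>2) has_sum (l2_norm lborel (tensor a b))\<^sup>2) UNIV"
    unfolding l2_inner_mult_commute l2_inner_self has_sum_of_real_iff .
  then have "(\<integral>\<^sup>+p. ennreal ((cmod (l2_inner lborel (tensor a b) (psi_km \<psi> p)))\<^sup>2) \<partial>count_space UNIV)
      = ennreal ((l2_norm lborel (tensor a b))\<^sup>2)"
    by (subst nn_integral_count_space_eq_iff) simp_all
  then show "(\<integral>\<^sup>+\<xi>. ennreal ((cmod (A \<xi>))\<^sup>2) * weight b \<xi> \<partial>lborel) = ennreal ((l2_norm lborel b)\<^sup>2 * (l2_norm lborel A)\<^sup>2)"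
    unfolding tensor_psi_km_square_sum[OF pair b] l2_norm_tensor[OF fourier_pair_L2(1)[OF pair] b] fourier_pair_norm[OF pair]
    by (simp add: power_mult_distrib mult.commute)
qed simp

text \<open>The pairing is additive in b only where the slice is in L2, since divergent integrals
  have the default value 0. Dilations preserve null sets and there are countably many k, so one null
  set serves all scales.\<close>

lemma AE_dilated_slices_L2: "AE \<xi> in lborel. \<forall>k::int. L2 lborel (\<lambda>y. \<Psi> (2 powr real_of_int k * \<xi>, y))"
proof (subst AE_all_countable, rule allI)
  fix k :: int
  \<comment> \<open>The condition is rephrased as finiteness of a Borel function because
    \<open>AE_borel_affine\<close> transports measurable predicates.\<close>
  define N where "N s = (\<integral>\<^sup>+y. ennreal ((cmod (\<Psi> (s, y)))\<^sup>2) \<partial>lborel)" for s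
  have Nm [measurable]: "N \<in> borel_measurable borel"
    unfolding N_def by measurable
  have "AE s in lborel. N s < \<infinity>"
    using Psi_slice_L2 by eventually_elim (simp add: N_def L2_nn_integral)
  then have "AE \<xi> in lborel. N (0 + 2 powr real_of_int k * \<xi>) < \<infinity>"
    by (intro AE_borel_affine[where P="\<lambda>s. N s < \<infinity>"]) simp_all
  then show "AE \<xi> in lborel. L2 lborel (\<lambda>y. \<Psi> (2 powr real_of_int k * \<xi>, y))"
    by eventually_elim (simp add: N_def L2_I_nn_integral borel_measurable_slices[OF Psi_measurable])
qed

section \<open>From diagonal identities to pairs by polarization\<close>

lemma complex_polarization:
  fixes x y :: complex
  shows "x * cnj y = (complex_of_real ((cmod (x + y))\<^sup>2) + (-1) * complex_of_real ((cmod (x - y))\<^sup>2)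
    + \<i> * complex_of_real ((cmod (x + \<i> * y))\<^sup>2) + (-\<i>) * complex_of_real ((cmod (x - \<i> * y))\<^sup>2)) / 4"
  unfolding complex_norm_square by (simp add: algebra_simps)

lemma l2_polarization:
  assumes f: "L2 M f" and g: "L2 M g"
  shows "l2_inner M f g = (complex_of_real ((l2_norm M (\<lambda>x. f x + g x))\<^sup>2) + (-1) * complex_of_real ((l2_norm M (\<lambda>x. f x - g x))\<^sup>2)
    + \<i> * complex_of_real ((l2_norm M (\<lambda>x. f x + \<i> * g x))\<^sup>2) + (-\<i>) * complex_of_real ((l2_norm M (\<lambda>x. f x - \<i> * g x))\<^sup>2)) / 4"
  using f g L2_cmult[OF g, of \<i>]
  unfolding l2_inner_self[symmetric]
  by (simp add: l2_inner_add_left l2_inner_add_right l2_inner_diff_left l2_inner_diff_right L2_add L2_diff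
      l2_inner_cmult_left l2_inner_cmult_right algebra_simps)

definition pointwise_expansion :: "(real \<Rightarrow> complex) \<Rightarrow> (real \<Rightarrow> complex) \<Rightarrow> bool" where
  "pointwise_expansion f g \<longleftrightarrow> (AE \<xi> in lborel.
     ((\<lambda>k::int. pairing \<Psi> f (2 powr real_of_int k * \<xi>) * cnj (pairing \<Psi> g (2 powr real_of_int k * \<xi>)))
       has_sum l2_inner lborel f g) UNIV)"

text \<open>The diagonal identity is used for the four functions f + g, f - g, f + i g and f - i g.
  Outside the union of their null sets and that of \<open>AE_dilated_slices_L2\<close> the pairing
  is linear, so polarizing each summand and the inner product gives matching combinations.\<close>

lemma reproducing_imp_pointwise_expansion:
  assumes rep: "reproducing lborel (psi_km \<psi>)" and f: "L2 lborel f" and g: "L2 lborel g"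
  shows "pointwise_expansion f g"
proof -
  have sq: "AE \<xi> in lborel. ((\<lambda>k::int. (cmod (pairing \<Psi> b (2 powr real_of_int k * \<xi>)))\<^sup>2) has_sum (l2_norm lborel b)\<^sup>2) UNIV"
    if "L2 lborel b" for b
    using reproducing_imp_weight[OF rep that]
    by eventually_elim (simp add: weight_def nn_integral_count_space_eq_iff)
  note ig = L2_cmult[OF g, of \<i>]
  show ?thesis
    unfolding pointwise_expansion_def
    using AE_dilated_slices_L2 sq[OF L2_add[OF f g]] sq[OF L2_diff[OF f g]] sq[OF L2_add[OF f ig]] sq[OF L2_diff[OF f ig]]
  proof eventually_elim
    case (elim \<xi>)
    let ?p = "\<lambda>b k. pairing \<Psi> b (2 powr real_of_int k * \<xi>)"
    have lin: "?p (\<lambda>x. f x + g x) k = ?p f k + ?p g k" "?p (\<lambda>x. f x - g x) k = ?p f k - ?p g k"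
        "?p (\<lambda>x. f x + \<i> * g x) k = ?p f k + \<i> * ?p g k" "?p (\<lambda>x. f x - \<i> * g x) k = ?p f k - \<i> * ?p g k" for k
      using elim(1)[rule_format, of k] f g ig
      by (simp_all add: pairing_inner l2_inner_add_left l2_inner_diff_left l2_inner_cmult_left)
    have c: "((\<lambda>k. complex_of_real ((cmod (?p b k))\<^sup>2)) has_sum complex_of_real ((l2_norm lborel b)\<^sup>2)) UNIV"
      if "((\<lambda>k. (cmod (?p b k))\<^sup>2) has_sum (l2_norm lborel b)\<^sup>2) UNIV" for b
      using that by (rule has_sum_of_real)
    note s = c[OF elim(2)] has_sum_cmult_right[OF c[OF elim(3)], of "-1"]
      has_sum_cmult_right[OF c[OF elim(4)], of \<i>] has_sum_cmult_right[OF c[OF elim(5)], of "-\<i>"]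
    show ?case
      using has_sum_divide_const[OF has_sum_add[OF has_sum_add[OF has_sum_add[OF s(1,2)] s(3)] s(4)], of 4]
      unfolding lin complex_polarization[of "?p f _" "?p g _"] l2_polarization[OF f g] .
  qed
qed

section \<open>From the pointwise identity back to the reproducing property\<close>

lemma pointwise_expansion_imp_weight:
  assumes "pointwise_expansion b b"
  shows "AE \<xi> in lborel. weight b \<xi> = ennreal ((l2_norm lborel b)\<^sup>2)"
  using assms unfolding pointwise_expansion_def
proof eventually_elim
  case (elim \<xi>)
  then have "((\<lambda>k::int. (cmod (pairing \<Psi> b (2 powr real_of_int k * \<xi>)))\<^sup>2) has_sum (l2_norm lborel b)\<^sup>2) UNIV"
    unfolding complex_norm_square[symmetric] l2_inner_self has_sum_of_real_iff .
  then show ?case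
    unfolding weight_def by (subst nn_integral_count_space_eq_iff) simp_all
qed

lemma nn_integral_weight:
  assumes "pointwise_expansion b b" "fourier_pair a A"
  shows "(\<integral>\<^sup>+\<xi>. ennreal ((cmod (A \<xi>))\<^sup>2) * weight b \<xi> \<partial>lborel) = ennreal ((l2_norm lborel A)\<^sup>2 * (l2_norm lborel b)\<^sup>2)"
proof -
  note [measurable] = fourier_pair_measurable[OF assms(2)]
  have "(\<integral>\<^sup>+\<xi>. ennreal ((cmod (A \<xi>))\<^sup>2) * weight b \<xi> \<partial>lborel) = (\<integral>\<^sup>+\<xi>. ennreal ((cmod (A \<xi>))\<^sup>2) * ennreal ((l2_norm lborel b)\<^sup>2) \<partial>lborel)"
  proof (rule nn_integral_cong_AE)
    show "AE \<xi> in lborel. ennreal ((cmod (A \<xi>))\<^sup>2) * weight b \<xi> = ennreal ((cmod (A \<xi>))\<^sup>2) * ennreal ((l2_norm lborel b)\<^sup>2)"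
      using pointwise_expansion_imp_weight[OF assms(1)] by eventually_elim simp
  qed
  also have "\<dots> = ennreal ((l2_norm lborel A)\<^sup>2) * ennreal ((l2_norm lborel b)\<^sup>2)"
    by (subst nn_integral_multc) (simp_all add: L2_nn_integral[OF fourier_pair_L2(2)[OF assms(2)]])
  finally show ?thesis by (simp add: ennreal_mult')
qed

text \<open>Fubini on counting measure times Lebesgue measure: each family of scale components is in
  L2 of the product space by the diagonal case, so their product is integrable. That the sum exists
  is a hypothesis here, because the caller derives it from absolute summability over all (k,
  m).\<close>

lemma scale_component_sum:
  assumes pw: "\<forall>f g. L2 lborel f \<longrightarrow> L2 lborel g \<longrightarrow> pointwise_expansion f g"
    and pair: "fourier_pair a A" and b: "L2 lborel b" and pair': "fourier_pair a' A'" and b': "L2 lborel b'"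
    and sum: "((\<lambda>k. l2_inner lborel (scale_component k A b) (scale_component k A' b')) has_sum S) UNIV"
  shows "S = l2_inner lborel A A' * l2_inner lborel b b'"
proof -
  interpret sigma_finite_measure "count_space (UNIV :: int set)"
    by (rule sigma_finite_measure_count_space)
  interpret P: pair_sigma_finite "count_space (UNIV :: int set)" "lborel :: real measure" ..
  let ?N = "count_space (UNIV :: int set) \<Otimes>\<^sub>M (lborel :: real measure)"
  have L: "L2 ?N (\<lambda>(k, \<xi>). scale_component k A b \<xi>)"
    if pair: "fourier_pair a A" and b: "L2 lborel b" for a A b
  proof (rule L2_I_nn_integral)
    show m: "(\<lambda>(k, \<xi>). scale_component k A b \<xi>) \<in> borel_measurable ?N"
      by (rule measurable_pair_measure_countable1) (use L2_measurable[OF scale_component_L2[OF pair b]] in simp_all)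
    then have "(\<integral>\<^sup>+p. ennreal ((cmod (case p of (k, \<xi>) \<Rightarrow> scale_component k A b \<xi>))\<^sup>2) \<partial>?N)
      = (\<integral>\<^sup>+k. \<integral>\<^sup>+\<xi>. ennreal ((cmod (scale_component k A b \<xi>))\<^sup>2) \<partial>lborel \<partial>count_space UNIV)"
      by (subst lborel.nn_integral_fst[symmetric]) simp_all
    also have "\<dots> < \<infinity>"
      unfolding nn_integral_scale_component[OF pair b] nn_integral_weight[OF pw[rule_format, OF b b] pair] by simp
    finally show "(\<integral>\<^sup>+p. ennreal ((cmod (case p of (k, \<xi>) \<Rightarrow> scale_component k A b \<xi>))\<^sup>2) \<partial>?N) < \<infinity>" .
  qed
  have int: "integrable ?N (case_prod (\<lambda>k \<xi>. scale_component k A b \<xi> * cnj (scale_component k A' b' \<xi>)))"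
    using L2_inner_integrable[OF L[OF pair b] L[OF pair' b']] by (simp add: split_def)
  have "S = (\<integral>k. l2_inner lborel (scale_component k A b) (scale_component k A' b') \<partial>count_space UNIV)"
    using sum unfolding has_sum_count_space_iff by simp
  also have "\<dots> = (\<integral>\<xi>. (\<integral>k. scale_component k A b \<xi> * cnj (scale_component k A' b' \<xi>) \<partial>count_space UNIV) \<partial>lborel)"
    unfolding l2_inner_def by (rule P.Fubini_integral[OF int, symmetric])
  also have "\<dots> = (\<integral>\<xi>. (A \<xi> * cnj (A' \<xi>)) * l2_inner lborel b b' \<partial>lborel)"
  proof (rule integral_cong_AE)
    show "(\<lambda>\<xi>. \<integral>k. scale_component k A b \<xi> * cnj (scale_component k A' b' \<xi>) \<partial>count_space UNIV) \<in> borel_measurable lborel"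
      using P.integrable_snd[OF int] by (rule borel_measurable_integrable)
    show "(\<lambda>\<xi>. (A \<xi> * cnj (A' \<xi>)) * l2_inner lborel b b') \<in> borel_measurable lborel"
      using fourier_pair_measurable[OF pair] fourier_pair_measurable[OF pair'] by simp
    show "AE \<xi> in lborel. (\<integral>k. scale_component k A b \<xi> * cnj (scale_component k A' b' \<xi>) \<partial>count_space UNIV)
      = (A \<xi> * cnj (A' \<xi>)) * l2_inner lborel b b'"
      using pw[rule_format, OF b b'] unfolding pointwise_expansion_def
    proof eventually_elim
      case (elim \<xi>)
      have "scale_component k A b \<xi> * cnj (scale_component k A' b' \<xi>)
        = (A \<xi> * cnj (A' \<xi>)) * (pairing \<Psi> b (2 powr real_of_int k * \<xi>) * cnj (pairing \<Psi> b' (2 powr real_of_int k * \<xi>)))" for k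
        by (simp add: scale_component_def)
      then show ?case
        using has_sum_cmult_right[OF elim, of "A \<xi> * cnj (A' \<xi>)"]
        unfolding has_sum_count_space_iff by simp
    qed
  qed
  also have "\<dots> = l2_inner lborel A A' * l2_inner lborel b b'"
    unfolding l2_inner_def by simp
  finally show ?thesis .
qed

text \<open>The identity is needed for an unordered sum over (k, m), while the computation is
  iterated: first m, by Parseval, then k. Summability of the double family on tensors is therefore
  settled before it is evaluated.\<close>

lemma pointwise_expansion_imp_reproducing:
  assumes pw: "\<forall>f g. L2 lborel f \<longrightarrow> L2 lborel g \<longrightarrow> pointwise_expansion f g"
  shows "reproducing lborel (psi_km \<psi>)"
  unfolding reproducing_iff_has_sum
proof (intro allI impI)
  fix f g :: "real \<times> real \<Rightarrow> complex"
  assume "L2 lborel f" "L2 lborel g"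
  note cl = this[THEN L2_mem_closure_fourier_tensors]
  show "((\<lambda>p. l2_inner lborel f (psi_km \<psi> p) * l2_inner lborel (psi_km \<psi> p) g) has_sum l2_inner lborel f g) UNIV"
  proof (rule linear_hull_expansion[OF _ _ _ cl])
    show "L2 lborel (psi_km \<psi> p)" for p
      by (cases p) (simp add: psi_km_L2)
    show "L2 lborel d" if "d \<in> fourier_tensors" for d
      using that L2_tensor[OF fourier_image_L2] by (auto simp: fourier_tensors_def)
    fix d d' assume "d \<in> fourier_tensors" "d' \<in> fourier_tensors"
    then obtain a b a' b' A A' where d: "d = tensor a b" "fourier_pair a A" "L2 lborel b"
      and d': "d' = tensor a' b'" "fourier_pair a' A'" "L2 lborel b'"
      by (auto simp: fourier_tensors_def fourier_image_def)
    define T where "T p = l2_inner lborel (tensor a b) (psi_km \<psi> p) * l2_inner lborel (psi_km \<psi> p) (tensor a' b')" for p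
    have sq: "(\<lambda>p. (cmod (l2_inner lborel (tensor a b) (psi_km \<psi> p)))\<^sup>2) summable_on UNIV"
      if "fourier_pair a A" "L2 lborel b" for a A b
    proof -
      have "((\<lambda>p. (cmod (l2_inner lborel (tensor a b) (psi_km \<psi> p)))\<^sup>2) has_sum ((l2_norm lborel A)\<^sup>2 * (l2_norm lborel b)\<^sup>2)) UNIV"
        using tensor_psi_km_square_sum[OF that] nn_integral_weight[OF pw[rule_format, OF that(2,2)] that(1)]
        by (subst nn_integral_count_space_eq_iff[symmetric]) simp_all
      then show ?thesis by (rule has_sum_imp_summable)
    qed
    \<comment> \<open>The off-diagonal terms are dominated by |x| |y| \<le> |x|^2 + |y|^2 with the
      square sums of the two diagonal cases.\<close>
    have "(\<lambda>p. norm (T p)) summable_on UNIV"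
    proof (rule summable_on_comparison_test[OF summable_on_add[OF sq[OF d(2,3)] sq[OF d'(2,3)]]])
      fix p
      let ?x = "cmod (l2_inner lborel (tensor a b) (psi_km \<psi> p))" and ?y = "cmod (l2_inner lborel (tensor a' b') (psi_km \<psi> p))"
      have "cmod (l2_inner lborel (psi_km \<psi> p) (tensor a' b')) = ?y"
        by (subst l2_inner_commute) simp
      then have "norm (T p) = ?x * ?y" by (simp add: T_def norm_mult)
      also have "\<dots> \<le> ?x\<^sup>2 + ?y\<^sup>2"
        using sum_squares_bound[of ?x ?y] mult_nonneg_nonneg[OF norm_ge_zero norm_ge_zero,
          of "l2_inner lborel (tensor a b) (psi_km \<psi> p)" "l2_inner lborel (tensor a' b') (psi_km \<psi> p)"] by linarith
      finally show "norm (T p) \<le> ?x\<^sup>2 + ?y\<^sup>2" .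
    qed simp
    then have summ: "T summable_on UNIV"
      by (rule abs_summable_summable)
    \<comment> \<open>Summing over m inside the summable double family leaves a sum over k with the
      same total, whose value \<open>scale_component_sum\<close> identifies.\<close>
    have "((\<lambda>k. l2_inner lborel (scale_component k A b) (scale_component k A' b')) has_sum infsum T UNIV) UNIV"
    proof (rule has_sum_SigmaD[where f=T and A=UNIV and B="\<lambda>_. UNIV"])
      show "(T has_sum infsum T UNIV) (UNIV \<times> UNIV)"
        using has_sum_infsum[OF summ] by simp
      show "((\<lambda>m. T (k, m)) has_sum l2_inner lborel (scale_component k A b) (scale_component k A' b')) UNIV" for k
        unfolding T_def by (rule tensor_psi_km_expansion[OF d(2,3) d'(2,3)])
    qed
    then have "infsum T UNIV = l2_inner lborel A A' * l2_inner lborel b b'"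
      by (rule scale_component_sum[OF pw d(2,3) d'(2,3)])
    also have "\<dots> = l2_inner lborel (tensor a b) (tensor a' b')"
      unfolding l2_inner_tensor[OF fourier_pair_L2(1)[OF d(2)] d(3) fourier_pair_L2(1)[OF d'(2)] d'(3)]
        fourier_pair_Plancherel[OF d(2) d'(2)] ..
    finally show "((\<lambda>p. l2_inner lborel d (psi_km \<psi> p) * l2_inner lborel (psi_km \<psi> p) d') has_sum l2_inner lborel d d') UNIV"
      using has_sum_infsum[OF summ] unfolding d d' T_def by simp
  qed
qed

end

theorem theorem1p3:
  fixes \<psi> \<Psi> :: "real \<times> real \<Rightarrow> complex"
  assumes "L2 lborel \<psi>"
    and "partial_fourier1 \<psi> \<Psi>"
    and "AE y in lborel. ess_supp lborel (\<lambda>s. \<Psi> (s, y)) \<subseteq> {-1/2..1/2}"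
  shows "reproducing lborel (psi_km \<psi>) \<longleftrightarrow>
    (\<forall>f g. L2 lborel f \<longrightarrow> L2 lborel g \<longrightarrow>
      (AE \<xi> in lborel.
        ((\<lambda>k::int. (\<integral>y. cnj (\<Psi> (2 powr real_of_int k * \<xi>, y)) * f y \<partial>lborel) *
                    (\<integral>y. \<Psi> (2 powr real_of_int k * \<xi>, y) * cnj (g y) \<partial>lborel))
          has_sum l2_inner lborel f g) UNIV))"
proof -
  interpret partial_fourier \<psi> \<Psi>
    using assms by (rule partial_fourier.intro)
  have "(\<integral>y. \<Psi> (s, y) * cnj (g y) \<partial>lborel) = cnj (pairing \<Psi> g s)" for g s
    unfolding pairing_def by (simp flip: Bochner_Integration.integral_cnj)
  then have "(\<forall>f g. L2 lborel f \<longrightarrow> L2 lborel g \<longrightarrow>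
      (AE \<xi> in lborel.
        ((\<lambda>k::int. (\<integral>y. cnj (\<Psi> (2 powr real_of_int k * \<xi>, y)) * f y \<partial>lborel) *
                    (\<integral>y. \<Psi> (2 powr real_of_int k * \<xi>, y) * cnj (g y) \<partial>lborel))
          has_sum l2_inner lborel f g) UNIV))
    \<longleftrightarrow> (\<forall>f g. L2 lborel f \<longrightarrow> L2 lborel g \<longrightarrow> pointwise_expansion f g)"
    unfolding pointwise_expansion_def pairing_def by simp
  then show ?thesis
    using reproducing_imp_pointwise_expansion pointwise_expansion_imp_reproducing by blast
qed

end
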